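(* Let $n\geq 3$ and let $r,s\in\mathbb{N}$ with $r+s=n$. Let $\mathcal{S}_{r,s}$ be the set of nondegenerate $n$-ary quadratic forms $f\in\mathbb{Z}[t_1,\dots,t_n]$ of signature $(r,s)$. Then the set $\mathcal{D}_{r,s}\coloneqq\{\delta(f)\mid f\in\mathcal{S}_{r,s}\}$ is dense in $[0,1]$.
   Context: A form $f$ has signature $(r,s)$ if over $\mathbb{R}$ it is equivalent to $x_1^2+\dots+x_r^2-x_{r+1}^2-\dots-x_{r+s}^2$. $D_f\coloneqq f(\mathbb{Z}^n)\setminus\{0\}$. For $S\subset\mathbb{Z}$: $S$ is positive if it contains no negative integers, negative if it contains no positive integers, indefinite otherwise. The density of $S$ is $\lim_{N\to\infty}\#(S\cap[1,N])/N$, $\lim_{N\to\infty}\#(S\cap[-N,-1])/N$, or $\lim_{N\to\infty}\#(S\cap[-N,N])/(2N)$ according as $S$ is positive, negative or indefinite. $\delta(f)$ denotes the density of $D_f$. *)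

theory Defs
  imports "HOL-Analysis.Elementary_Topology" "Jordan_Normal_Form.Determinant"
begin

text \<open>
  A quadratic form in \<open>\<int>[t\<^sub>1,\<dots>,t\<^sub>n]\<close> is stored as the upper triangular matrix \<open>A\<close> of its
  coefficients: it is \<open>\<Sum>i\<le>j. A\<^sub>i\<^sub>j t\<^sub>i t\<^sub>j\<close>, so that off-diagonal coefficients may be odd, and each
  polynomial corresponds to exactly one such matrix. Variables are indexed by \<open>0,\<dots>,n-1\<close>.
\<close>

definition int_quadratic_forms :: "nat \<Rightarrow> int mat set" where
  "int_quadratic_forms n = {A \<in> carrier_mat n n. upper_triangular A}"

definition qf_eval :: "'a::comm_ring_1 mat \<Rightarrow> 'a vec \<Rightarrow> 'a" where
  "qf_eval A x = (\<Sum>i\<in>{0..<dim_vec x}. \<Sum>j\<in>{i..<dim_vec x}. A $$ (i, j) * x $ i * x $ j)"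

text \<open>
  \<open>A + A\<^sup>T\<close> is the Gram matrix of the polar form \<open>f(x + y) - f(x) - f(y)\<close>.
\<close>

definition qf_nondegenerate :: "int mat \<Rightarrow> bool" where
  "qf_nondegenerate A \<longleftrightarrow> det (A + transpose_mat A) \<noteq> 0"

definition qf_has_signature :: "int mat \<Rightarrow> nat \<Rightarrow> nat \<Rightarrow> bool" where
  "qf_has_signature A r s \<longleftrightarrow>
     (\<exists>P :: real mat. P \<in> carrier_mat (r + s) (r + s) \<and> invertible_mat P \<and>
        (\<forall>x \<in> carrier_vec (r + s).
           qf_eval (map_mat of_int A) (P *\<^sub>v x) =
             (\<Sum>i\<in>{0..<r}. (x $ i)\<^sup>2) - (\<Sum>i\<in>{r..<r + s}. (x $ i)\<^sup>2)))"

definition qf_values :: "int mat \<Rightarrow> int set" where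
  "qf_values A = qf_eval A ` carrier_vec (dim_row A) - {0}"

definition positive_set :: "int set \<Rightarrow> bool" where
  "positive_set S \<longleftrightarrow> (\<forall>k\<in>S. \<not> k < 0)"

definition negative_set :: "int set \<Rightarrow> bool" where
  "negative_set S \<longleftrightarrow> (\<forall>k\<in>S. \<not> k > 0)"

text \<open>
  A set that is both positive and negative is contained in \<open>{0}\<close>; both clauses then give density 0.
\<close>

definition has_density :: "int set \<Rightarrow> real \<Rightarrow> bool" where
  "has_density S d \<longleftrightarrow>
     (if positive_set S then
        (\<lambda>N::nat. real (card (S \<inter> {1..int N})) / real N) \<longlonglongrightarrow> d
      else if negative_set S then
        (\<lambda>N::nat. real (card (S \<inter> {- int N..-1})) / real N) \<longlonglongrightarrow> d
      else
        (\<lambda>N::nat. real (card (S \<inter> {- int N..int N})) / (2 * real N)) \<longlonglongrightarrow> d)"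

definition forms_of_signature :: "nat \<Rightarrow> nat \<Rightarrow> int mat set" where
  "forms_of_signature r s =
     {A \<in> int_quadratic_forms (r + s). qf_nondegenerate A \<and> qf_has_signature A r s}"

text \<open>
  Limits are unique, so every form contributes at most one element here; stating the density as a
  relation keeps the unspecified value of a nonexistent limit out of the set.
\<close>

definition form_densities :: "nat \<Rightarrow> nat \<Rightarrow> real set" where
  "form_densities r s = {d. \<exists>A \<in> forms_of_signature r s. has_density (qf_values A) d}"

definition dense_in :: "'a::topological_space set \<Rightarrow> 'a set \<Rightarrow> bool" where
  "dense_in D X \<longleftrightarrow> D \<subseteq> X \<and> X \<subseteq> closure D"

end

theory Submission
  imports Defs "HOL-Number_Theory.Number_Theory" "HOL-Analysis.Convex" "HOL-Analysis.Elementary_Metric_Spaces"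
    "HOL-Real_Asymp.Real_Asymp"
begin

text \<open>
  For a finite set \<open>A\<close> of primes, the integers \<open>N\<close> such that every \<open>p \<in> A\<close> dividing \<open>N\<close> divides it twice have
  density \<open>\<Prod>p\<in>A. 1 - 1/p + 1/p\<^sup>2\<close>. As \<open>\<Sum>1/p\<close> diverges, these products are dense in \<open>[0, 1]\<close>, even
  if finitely many primes are excluded, so it suffices to find forms whose value set is this one, up to a
  factor close to 1 in the density. With \<open>m = \<Prod>A\<close> the condition at \<open>p\<close> is forced by a form that is an
  anisotropic plane modulo \<open>p\<close>.

  In the indefinite case \<open>z\<^sup>2 + u y\<^sup>2 + m t y\<close>, with \<open>-u\<close> a nonresidue modulo every \<open>p \<in> A\<close>, represents
  exactly these integers, and the terms \<open>\<plusminus>m\<^sup>2 w\<^sup>2\<close> do not enlarge the set of values.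

  In the definite case take \<open>x\<^sup>2 + y\<^sup>2 + y z + c z\<^sup>2\<close> on the sublattice \<open>x \<equiv> l z (mod m)\<close>, where \<open>q = 4c - 1\<close> is
  a large prime. Almost all locally represented integers are represented: for \<open>Q\<close> divisible by all small
  primes, a second moment estimate (counting collisions \<open>f(v) = f(v')\<close> with \<open>v\<close>, \<open>v'\<close> in a thin box and in a
  fixed class modulo \<open>Q\<close>) and the Cauchy--Schwarz inequality bound the number of omitted integers in the
  corresponding class. The only other local obstruction is at \<open>q\<close>; the form is self-similar under
  multiplication by \<open>q\<^sup>2\<close>, so the density exists, and it changes by at most a factor \<open>1 - 1/q\<close>. Further
  variables enter through multiples of \<open>m\<^sup>2 w\<^sup>2\<close>.
\<close>

section \<open>Congruences and collisions of a binary form\<close>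

text \<open>In the indefinite case the variable \<open>t\<close> occurs linearly, so
  representability is a divisibility question and congruences settle it exactly. A definite ternary
  form offers no such variable; local conditions decide representability only up to a null set,
  which is enough for a density. The box is shaped so that counting collisions stays elementary:
  \<open>x\<close> has size B^15, \<open>y\<close> size B^10, \<open>z\<close> size B^6. As 15 + 10
  + 6 > 30, an integer of size B^30 has on average about B representations. The \<open>x\<close> in
  a collision differ by O(B^5), less than every side of the box, so congruences modulo such
  differences equidistribute in it. The prime \<open>q\<close> cannot be avoided: a definite ternary
  form is anisotropic over the reals, hence, by reciprocity for Hilbert symbols, at some finite
  prime. Here this prime is \<open>q\<close>, where -q is the discriminant of the binary part and
  \<open>q\<close> is 3 modulo 4, so that -1 is a nonresidue. In three variables its effect is made
  small by taking \<open>q\<close> large; a fourth variable removes it.\<close>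

lemma int_div_less:
  fixes z k f :: int
  assumes "f > 0" "z < k * f"
  shows "z div f < k"
proof (rule ccontr)
  assume "\<not> z div f < k"
  then have "k * f \<le> (z div f) * f" using assms by (intro mult_right_mono) auto
  also have "\<dots> \<le> z" using div_mult_mod_eq[of z f] pos_mod_sign[of f z] assms by linarith
  finally show False using assms by simp
qed

text \<open>Any two solutions differ by a multiple of \<open>f = e div gcd b e\<close>, so each of
  the \<open>n div f\<close> blocks of \<open>f\<close> consecutive integers contains at most
  one.\<close>

lemma card_linear_cong_le:
  fixes e n b t :: int
  assumes "n > 0" "e > 0" "e dvd n"
  shows "int (card {z \<in> {0..<n}. e dvd b * z + t}) \<le> (n div e) * gcd b e"
proof -
  define g where "g = gcd b e"
  have g: "g > 0" "g dvd b" "g dvd e" using assms by (auto simp: g_def)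
  define f where "f = e div g"
  have fg: "e = f * g" and f: "f > 0"
    using g assms by (auto simp: f_def pos_imp_zdiv_pos_iff zdvd_imp_le)
  have cop: "coprime (b div g) f"
    unfolding f_def g_def by (rule div_gcd_coprime) (use assms in auto)
  have same: "f dvd z - w" if "e dvd b * z + t" "e dvd b * w + t" for z w
  proof -
    have "e dvd (b * z + t) - (b * w + t)" using that by (rule dvd_diff)
    moreover have "(b * z + t) - (b * w + t) = (b div g) * (z - w) * g"
      using g by (auto simp: algebra_simps)
    ultimately have "f * g dvd (b div g) * (z - w) * g" by (simp add: fg)
    then have "f dvd (b div g) * (z - w)" using g by simp
    with cop show ?thesis by (simp add: coprime_commute coprime_dvd_mult_right_iff)
  qed
  let ?S = "{z \<in> {0..<n}. e dvd b * z + t}"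
  have nf: "n div f = (n div e) * g" "f dvd n"
    using assms f g fg by (auto simp: dvd_def)
  have inj: "inj_on (\<lambda>z. z div f) ?S"
  proof (rule inj_onI)
    fix z w assume "z \<in> ?S" "w \<in> ?S" and eq: "z div f = w div f"
    then have "f dvd z - w" by (auto intro: same)
    then have "z mod f = w mod f" by (simp add: mod_eq_dvd_iff)
    with eq show "z = w" by (metis div_mult_mod_eq)
  qed
  have sub: "(\<lambda>z. z div f) ` ?S \<subseteq> {0..<n div f}"
  proof clarsimp
    fix z assume "0 \<le> z" "z < n"
    moreover have "(n div f) * f = n" using nf(2) by (simp only: dvd_div_mult_self)
    ultimately have "z < (n div f) * f" by linarith
    then have "z div f < n div f" using f by (intro int_div_less)
    with \<open>0 \<le> z\<close> show "0 \<le> z div f \<and> z div f < n div f"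
      using f by (simp add: pos_imp_zdiv_nonneg_iff)
  qed
  have "card ?S = card ((\<lambda>z. z div f) ` ?S)" using inj by (simp add: card_image)
  also have "\<dots> \<le> card {0..<n div f}" by (rule card_mono) (use sub in auto)
  finally have "card ?S \<le> nat (n div f)" by simp
  moreover have "0 \<le> n div f" using assms f by (simp add: pos_imp_zdiv_nonneg_iff)
  ultimately have "int (card ?S) \<le> n div f" by (simp only: le_nat_iff)
  then show ?thesis by (simp add: nf g_def)
qed

text \<open>For fixed \<open>z\<close> the congruence is solvable in \<open>y\<close> only if
  \<open>gcd a n\<close> divides \<open>b * z + t\<close>, and then it has at most
  \<open>gcd a n\<close> solutions. The one-variable bound counts the admissible
  \<open>z\<close>.\<close>

lemma card_linear_cong2_le:
  fixes n a b t :: int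
  assumes "n > 0"
  shows "int (card {(y, z) \<in> {0..<n} \<times> {0..<n}. n dvd a * y + b * z + t}) \<le> n * gcd (gcd a b) n"
proof -
  define e where "e = gcd a n"
  have e: "e > 0" "e dvd n" "e dvd a" using assms by (auto simp: e_def)
  let ?Z = "{z \<in> {0..<n}. e dvd b * z + t}"
  let ?Y = "\<lambda>z. {y \<in> {0..<n}. n dvd a * y + (b * z + t)}"
  have fZ: "finite ?Z" by (rule finite_subset[of _ "{0..<n}"]) auto
  have fY: "finite (?Y z)" for z by (rule finite_subset[of _ "{0..<n}"]) auto
  have fS: "finite (Sigma ?Z ?Y)" using fZ fY by (rule finite_SigmaI)
  have sub: "{(y, z) \<in> {0..<n} \<times> {0..<n}. n dvd a * y + b * z + t} \<subseteq> (\<lambda>(z, y). (y, z)) ` Sigma ?Z ?Y"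
  proof (rule subsetI, clarify)
    fix y z assume yz: "y \<in> {0..<n}" "z \<in> {0..<n}" "n dvd a * y + b * z + t"
    have "e dvd a * y + (b * z + t)" using yz(3) e by (metis add.assoc dvd_trans)
    then have "e dvd b * z + t" using e by (simp add: dvd_add_right_iff)
    with yz show "(y, z) \<in> (\<lambda>(z, y). (y, z)) ` Sigma ?Z ?Y"
      by (auto simp: image_iff add.assoc)
  qed
  have "card {(y, z) \<in> {0..<n} \<times> {0..<n}. n dvd a * y + b * z + t} \<le> card (Sigma ?Z ?Y)"
    by (rule order_trans[OF card_mono[OF finite_imageI[OF fS] sub] card_image_le[OF fS]])
  also have "\<dots> = (\<Sum>z\<in>?Z. card (?Y z))" by (rule card_SigmaI) (use fZ fY in blast)+
  finally have "int (card {(y, z) \<in> {0..<n} \<times> {0..<n}. n dvd a * y + b * z + t}) \<le> (\<Sum>z\<in>?Z. int (card (?Y z)))"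
    by (simp only: of_nat_sum[symmetric] of_nat_le_iff)
  also have "\<dots> \<le> (\<Sum>z\<in>?Z. e)"
  proof (rule sum_mono)
    fix z
    show "int (card (?Y z)) \<le> e"
      using card_linear_cong_le[OF assms assms dvd_refl, of a "b * z + t"] assms by (simp add: e_def)
  qed
  also have "\<dots> = int (card ?Z) * e" by simp
  also have "\<dots> \<le> (n div e * gcd b e) * e"
    using card_linear_cong_le[OF assms e(1,2), of b t] e by (intro mult_right_mono) auto
  also have "\<dots> = n * gcd b e" using e by (simp add: dvd_div_mult_self mult.commute mult.left_commute)
  also have "gcd b e = gcd (gcd a b) n" by (simp add: e_def ac_simps)
  finally show ?thesis .
qed

section \<open>Collisions of the binary form modulo n\<close>

definition bqf :: "int \<Rightarrow> int \<Rightarrow> int \<Rightarrow> int" where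
  "bqf c y z = y * y + y * z + c * z * z"

lemma bqf_mod:
  assumes "[y = y'] (mod n)" "[z = z'] (mod n)"
  shows "[bqf c y z = bqf c y' z'] (mod n)"
  unfolding bqf_def using assms by (intro cong_add cong_mult) auto

text \<open>The two linear forms are the partial derivatives of \<open>bqf c\<close>. Their matrix,
  with rows (2, 1) and (1, 2c), has determinant \<open>4 * c - 1\<close>, a unit modulo
  \<open>n\<close>.\<close>

lemma gcd_bqf_gradient:
  fixes s t n c :: int
  assumes "coprime n (4 * c - 1)"
  shows "gcd (gcd (2 * s + t) (s + 2 * c * t)) n = gcd (gcd s t) n"
proof (rule zdvd_antisym_nonneg)
  let ?e = "gcd (gcd (2 * s + t) (s + 2 * c * t)) n"
  have e: "?e dvd 2 * s + t" "?e dvd s + 2 * c * t" "?e dvd n" by (meson dvd_trans gcd_dvd1 gcd_dvd2)+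
  have cop: "coprime ?e (4 * c - 1)" using e(3) assms by (rule coprime_divisors[OF _ dvd_refl])
  have "?e dvd 2 * (s + 2 * c * t) - (2 * s + t)" using e by (intro dvd_diff dvd_mult)
  also have "\<dots> = (4 * c - 1) * t" by (simp add: algebra_simps)
  finally have t: "?e dvd t" using cop by (simp add: coprime_dvd_mult_right_iff)
  have "?e dvd (s + 2 * c * t) - 2 * c * t" using e t by (intro dvd_diff dvd_mult)
  then have "?e dvd s" by simp
  with t e show "?e dvd gcd (gcd s t) n" by simp
next
  have "gcd (gcd s t) n dvd s" "gcd (gcd s t) n dvd t" by (meson dvd_trans gcd_dvd1 gcd_dvd2)+
  then show "gcd (gcd s t) n dvd gcd (gcd (2 * s + t) (s + 2 * c * t)) n"
    by (intro gcd_greatest dvd_add dvd_mult) auto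
qed auto

text \<open>The gcd is itself a common divisor of \<open>s\<close>, \<open>t\<close> and
  \<open>n\<close>, hence at most the sum of all of them; a divisor \<open>d\<close> of
  \<open>n\<close> divides both entries of exactly \<open>(n / d)^2\<close> pairs.\<close>

lemma sum_gcd_le:
  fixes n :: int
  assumes "n > 0"
  shows "(\<Sum>(s, t)\<in>{0..<n}\<times>{0..<n}. real_of_int (gcd (gcd s t) n))
    \<le> real_of_int n ^ 2 * (\<Sum>d | d > 0 \<and> d dvd n. 1 / real_of_int d)"
proof -
  let ?D = "{d. d > 0 \<and> d dvd n}"
  have fD: "finite ?D" by (rule finite_subset[of _ "{0..n}"]) (use assms zdvd_imp_le in auto)
  have "(\<Sum>(s, t)\<in>{0..<n}\<times>{0..<n}. real_of_int (gcd (gcd s t) n))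
     \<le> (\<Sum>(s, t)\<in>{0..<n}\<times>{0..<n}. \<Sum>d\<in>?D. if d dvd s \<and> d dvd t then real_of_int d else 0)"
  proof (rule sum_mono, clarify)
    fix s t
    have "gcd (gcd s t) n \<in> ?D" using assms by simp
    have "real_of_int (gcd (gcd s t) n) = (if gcd (gcd s t) n dvd s \<and> gcd (gcd s t) n dvd t then real_of_int (gcd (gcd s t) n) else 0)"
      by (metis dvd_trans gcd_dvd1 gcd_dvd2)
    also have "\<dots> \<le> (\<Sum>d\<in>?D. if d dvd s \<and> d dvd t then real_of_int d else 0)"
      by (rule member_le_sum[where f = "\<lambda>d. if d dvd s \<and> d dvd t then real_of_int d else 0"]) (use assms fD in auto)
    finally show "real_of_int (gcd (gcd s t) n) \<le> (\<Sum>d\<in>?D. if d dvd s \<and> d dvd t then real_of_int d else 0)" .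
  qed
  also have "\<dots> = (\<Sum>d\<in>?D. \<Sum>(s, t)\<in>{0..<n}\<times>{0..<n}. if d dvd s \<and> d dvd t then real_of_int d else 0)"
    unfolding split_def by (rule sum.swap)
  also have "\<dots> = (\<Sum>d\<in>?D. real_of_int n ^ 2 * (1 / real_of_int d))"
  proof (rule sum.cong)
    fix d assume "d \<in> ?D"
    then obtain m where d: "d > 0" and m: "n = d * m" by auto
    then have m0: "m > 0" using assms zero_less_mult_pos by blast
    have "{s \<in> {0..<n}. d dvd s} = (\<lambda>i. d * i) ` {0..<m}"
    proof -
      have "x \<in> (\<lambda>i. d * i) ` {0..<m}" if "0 \<le> x" "x < n" "d dvd x" for x
      proof -
        from that(3) obtain i where "x = d * i" ..
        then show ?thesis using that d m
          by (auto simp: zero_le_mult_iff)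
      qed
      then show ?thesis using d m by auto
    qed
    then have cs: "card {s \<in> {0..<n}. d dvd s} = nat m"
      using d by (simp add: card_image inj_on_def)
    have "(\<Sum>(s, t)\<in>{0..<n}\<times>{0..<n}. if d dvd s \<and> d dvd t then real_of_int d else 0)
      = (\<Sum>(s, t)\<in>{s \<in> {0..<n}. d dvd s} \<times> {s \<in> {0..<n}. d dvd s}. real_of_int d)"
      by (rule sum.mono_neutral_cong_right) (auto split: if_splits)
    also have "\<dots> = real (nat m * nat m) * real_of_int d"
      by (simp only: split_def sum_constant card_cartesian_product cs of_nat_mult)
    also have "\<dots> = real_of_int n ^ 2 * (1 / real_of_int d)"
      using m0 d by (simp add: m power2_eq_square field_simps)
    finally show "(\<Sum>(s, t)\<in>{0..<n}\<times>{0..<n}. if d dvd s \<and> d dvd t then real_of_int d else 0) = real_of_int n ^ 2 * (1 / real_of_int d)" .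
  qed auto
  finally show ?thesis by (simp add: sum_distrib_left)
qed

lemma bqf_shift: "bqf c (y + s) (z + t) - bqf c y z = (2 * s + t) * y + (s + 2 * c * t) * z + bqf c s t"
  by (simp add: bqf_def algebra_simps)

text \<open>If the first point is the second plus \<open>(s, t)\<close>, the quadratic part in the
  second point cancels by \<open>bqf_shift\<close>, and a linear congruence with the gradient at
  \<open>(s, t)\<close> as coefficients remains. A perfectly equidistributed form would give n^3;
  the divisor sum measures the loss.\<close>

lemma card_bqf_collisions_mod_le:
  fixes n c :: int
  assumes "n > 0" "coprime n (4 * c - 1)"
  shows "real (card {((y, z), (y', z')) \<in> ({0..<n} \<times> {0..<n}) \<times> ({0..<n} \<times> {0..<n}). n dvd bqf c y z - bqf c y' z'})
    \<le> real_of_int n ^ 3 * (\<Sum>d | d > 0 \<and> d dvd n. 1 / real_of_int d)" (is "real (card ?K) \<le> _")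
proof -
  let ?I = "{0..<n} \<times> {0..<n}"
  let ?Y = "\<lambda>(s, t). {(y, z) \<in> ?I. n dvd (2 * s + t) * y + (s + 2 * c * t) * z + bqf c s t}"
  let ?f = "\<lambda>((y, z), (y', z')). (((y - y') mod n, (z - z') mod n), (y', z'))"
  have inj: "inj_on ?f ?K"
  proof (rule inj_onI)
    fix x x' assume xx: "x \<in> ?K" "x' \<in> ?K" "?f x = ?f x'"
    obtain y z y' z' where x: "x = ((y, z), (y', z'))" by (metis prod.exhaust)
    obtain u v u' v' where x': "x' = ((u, v), (u', v'))" by (metis prod.exhaust)
    have *: "y \<in> {0..<n}" "u \<in> {0..<n}" "z \<in> {0..<n}" "v \<in> {0..<n}" "u' = y'" "v' = z'"
      "(y - y') mod n = (u - y') mod n" "(z - z') mod n = (v - z') mod n"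
      using xx unfolding x x' by auto
    have "n dvd (y - y') - (u - y')" "n dvd (z - z') - (v - z')" using *(7,8) by (simp_all only: mod_eq_dvd_iff)
    then have "y mod n = u mod n" "z mod n = v mod n" by (simp_all add: mod_eq_dvd_iff)
    then show "x = x'" using *(1-6) by (simp add: x x')
  qed
  have sub: "?f ` ?K \<subseteq> Sigma ?I ?Y"
  proof (rule image_subsetI)
    fix x assume xK: "x \<in> ?K"
    obtain y z y' z' where x: "x = ((y, z), (y', z'))" by (metis prod.exhaust)
    have *: "n dvd bqf c y z - bqf c y' z'" using xK by (simp add: x)
    have "[bqf c (y' + (y - y') mod n) (z' + (z - z') mod n) = bqf c y z] (mod n)"
      by (rule bqf_mod) (simp_all add: unique_euclidean_semiring_class.cong_def mod_add_right_eq)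
    then have "n dvd bqf c (y' + (y - y') mod n) (z' + (z - z') mod n) - bqf c y z"
      by (simp add: cong_iff_dvd_diff)
    from dvd_add[OF this *] have "n dvd bqf c (y' + (y - y') mod n) (z' + (z - z') mod n) - bqf c y' z'"
      by simp
    then show "?f x \<in> Sigma ?I ?Y" using xK assms by (simp add: x bqf_shift)
  qed
  have fY: "finite (?Y st)" for st by (cases st) (auto intro: finite_subset[of _ ?I])
  have "card ?K = card (?f ` ?K)" using inj by (simp add: card_image)
  also have "\<dots> \<le> card (Sigma ?I ?Y)" by (rule card_mono) (use sub fY in auto)
  also have "\<dots> = (\<Sum>st\<in>?I. card (?Y st))" using fY by (subst card_SigmaI) auto
  finally have "real (card ?K) \<le> (\<Sum>st\<in>?I. real (card (?Y st)))"
    by (simp only: of_nat_sum[symmetric] of_nat_le_iff)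
  also have "\<dots> \<le> (\<Sum>(s, t)\<in>?I. real_of_int n * real_of_int (gcd (gcd s t) n))"
  proof (rule sum_mono)
    fix x :: "int \<times> int"
    obtain s t where x: "x = (s, t)" by (cases x)
    have "int (card (?Y (s, t))) \<le> n * gcd (gcd s t) n"
      using card_linear_cong2_le[OF assms(1), of "2 * s + t" "s + 2 * c * t" "bqf c s t"]
      by (simp add: gcd_bqf_gradient[OF assms(2)])
    then have "real_of_int (int (card (?Y (s, t)))) \<le> real_of_int (n * gcd (gcd s t) n)"
      by (rule of_int_le_iff[THEN iffD2])
    then show "real (card (?Y x)) \<le> (case x of (s, t) \<Rightarrow> real_of_int n * real_of_int (gcd (gcd s t) n))"
      by (simp add: x)
  qed
  also have "\<dots> = real_of_int n * (\<Sum>(s, t)\<in>?I. real_of_int (gcd (gcd s t) n))"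
    by (simp add: sum_distrib_left split_def)
  also have "\<dots> \<le> real_of_int n * (real_of_int n ^ 2 * (\<Sum>d | d > 0 \<and> d dvd n. 1 / real_of_int d))"
    using assms by (intro mult_left_mono sum_gcd_le) auto
  finally show ?thesis by (simp add: power3_eq_cube power2_eq_square mult.assoc)
qed

lemma bqf_residue_cong:
  fixes Q r :: int
  shows "[bqf c (y0 + Q * (j mod r)) (z0 + Q * (l mod r)) = bqf c (y0 + Q * j) (z0 + Q * l)] (mod (Q * r))"
proof (rule bqf_mod)
  have "[Q * (i mod r) = Q * i] (mod (Q * r))" for i
    by (rule cong_cmult_leftI) simp
  then show "[y0 + Q * (j mod r) = y0 + Q * j] (mod (Q * r))" "[z0 + Q * (l mod r) = z0 + Q * l] (mod (Q * r))"
    by (auto intro: cong_add)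
qed

text \<open>The sizes of the fibres of \<open>f\<close> add up to \<open>card A\<close>, and their
  squares to the number of collisions.\<close>

lemma card_squared_le_collisions:
  assumes "finite A"
  shows "(card A)\<^sup>2 \<le> card (f ` A) * card {(a, b) \<in> A \<times> A. f a = f b}"
proof -
  let ?c = "\<lambda>y. card {a \<in> A. f a = y}"
  have 1: "card A = (\<Sum>y\<in>f ` A. ?c y)"
    using sum.image_gen[OF assms, of "\<lambda>_. 1::nat" f] by simp
  have "{(a, b) \<in> A \<times> A. f a = f b} = (\<Union>y\<in>f ` A. {a \<in> A. f a = y} \<times> {a \<in> A. f a = y})" by auto
  also have "card \<dots> = (\<Sum>y\<in>f ` A. card ({a \<in> A. f a = y} \<times> {a \<in> A. f a = y}))"
    using assms by (subst card_UN_disjoint) auto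
  finally have 2: "card {(a, b) \<in> A \<times> A. f a = f b} = (\<Sum>y\<in>f ` A. (?c y)\<^sup>2)"
    by (simp add: card_cartesian_product power2_eq_square)
  have "(\<Sum>y\<in>f ` A. real (?c y))\<^sup>2 \<le> (\<Sum>y\<in>f ` A. (real (?c y))\<^sup>2) * card (f ` A)"
    by (rule sum_squared_le_sum_of_squares)
  then have "real ((card A)\<^sup>2) \<le> real (card {(a, b) \<in> A \<times> A. f a = f b} * card (f ` A))"
    unfolding 1 2 by simp
  then show ?thesis by (simp only: of_nat_le_iff mult.commute)
qed

text \<open>
  Averaging over translates by a full period decouples a congruence condition from a size condition.
\<close>

lemma card_mult_period_le:
  fixes n :: int and G S K :: "((int \<times> int) \<times> (int \<times> int)) set"
  assumes n: "n > 0" and fin: "finite S" "finite K"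
    and S: "\<And>j l j' l' h1 h2 h3 h4. ((j, l), (j', l')) \<in> G \<Longrightarrow> h1 \<in> {0..<n} \<Longrightarrow> h2 \<in> {0..<n} \<Longrightarrow>
      h3 \<in> {0..<n} \<Longrightarrow> h4 \<in> {0..<n} \<Longrightarrow> ((j + h1, l + h2), (j' + h3, l' + h4)) \<in> S"
    and K: "\<And>j l j' l'. ((j, l), (j', l')) \<in> G \<Longrightarrow> ((j mod n, l mod n), (j' mod n, l' mod n)) \<in> K"
  shows "card G * nat n ^ 4 \<le> card K * card S"
proof -
  let ?I = "{0..<n}"
  let ?H = "(?I \<times> ?I) \<times> (?I \<times> ?I)"
  \<comment> \<open>The residues of a point of \<open>G\<close> together with the shifted point
    determine both the point and the shift; this makes the map injective.\<close>
  let ?f = "\<lambda>(((j, l), (j', l')), ((h1, h2), (h3, h4))).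
    (((j mod n, l mod n), (j' mod n, l' mod n)), ((j + h1, l + h2), (j' + h3, l' + h4)))"
  have eq: "h = h'" if "h \<in> ?I" "h' \<in> ?I" "j mod n = j' mod n" "j + h = j' + h'" for h h' j j' :: int
  proof -
    have "n dvd j - j'" using that by (simp add: mod_eq_dvd_iff)
    then have "n dvd h' - h" using that by (metis add_diff_cancel_left add_diff_cancel_left' add_diff_eq diff_add_cancel)
    then show ?thesis using that by (metis atLeastLessThan_iff mod_eq_dvd_iff mod_pos_pos_trivial)
  qed
  have inj: "inj_on ?f (G \<times> ?H)"
  proof (rule inj_onI)
    fix x y assume xy: "x \<in> G \<times> ?H" "y \<in> G \<times> ?H" "?f x = ?f y"
    obtain j l j' l' h1 h2 h3 h4 where x: "x = (((j, l), (j', l')), ((h1, h2), (h3, h4)))" by (metis prod.exhaust)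
    obtain i k i' k' g1 g2 g3 g4 where y: "y = (((i, k), (i', k')), ((g1, g2), (g3, g4)))" by (metis prod.exhaust)
    have *: "h1 \<in> ?I" "h2 \<in> ?I" "h3 \<in> ?I" "h4 \<in> ?I" "g1 \<in> ?I" "g2 \<in> ?I" "g3 \<in> ?I" "g4 \<in> ?I"
      "j mod n = i mod n" "l mod n = k mod n" "j' mod n = i' mod n" "l' mod n = k' mod n"
      "j + h1 = i + g1" "l + h2 = k + g2" "j' + h3 = i' + g3" "l' + h4 = k' + g4"
      using xy by (simp_all add: x y)
    have "h1 = g1" "h2 = g2" "h3 = g3" "h4 = g4"
      by (rule eq[of _ _ j i] eq[of _ _ l k] eq[of _ _ j' i'] eq[of _ _ l' k']; fact *)+
    with * show "x = y" by (simp add: x y)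
  qed
  have sub: "?f ` (G \<times> ?H) \<subseteq> K \<times> S" using S K by auto
  have "card (G \<times> ?H) = card (?f ` (G \<times> ?H))" using inj by (simp only: card_image)
  also have "\<dots> \<le> card (K \<times> S)" by (rule card_mono) (use sub fin in auto)
  finally show ?thesis by (simp add: card_cartesian_product power4_eq_xxxx mult.assoc)
qed

text \<open>Separates the primes of \<open>Q\<close>, where the derivative in \<open>y\<close> will
  be a unit, from the others, where only the discriminant is known to be one. The two kinds are
  counted differently.\<close>

lemma coprime_part_exists:
  fixes a Q :: int
  assumes "a > 0"
  shows "\<exists>u v. a = u * v \<and> u > 0 \<and> v > 0 \<and> coprime v Q \<and> (\<forall>p. prime p \<longrightarrow> p dvd u \<longrightarrow> p dvd Q)"
  using assms
proof (induction "nat a" arbitrary: a rule: less_induct)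
  case less
  show ?case
  proof (cases "coprime a Q")
    case True
    then show ?thesis using less.prems by (intro exI[of _ 1] exI[of _ a]) auto
  next
    case False
    then have "gcd a Q \<noteq> 1" "gcd a Q \<noteq> 0" using less.prems by (auto simp: coprime_iff_gcd_eq_1)
    then obtain p where p: "prime p" "p dvd gcd a Q"
      by (metis gcd_ge_0_int prime_divisor_exists zdvd1_eq abs_of_nonneg)
    then have "p dvd a" by (metis dvd_trans gcd_dvd1)
    then obtain b where b: "a = p * b" ..
    have p1: "p > 1" using p prime_gt_1_int by blast
    then have b0: "b > 0" using less.prems b by (simp add: zero_less_mult_iff)
    moreover have "b < a" using b p1 b0 by simp
    ultimately obtain u v where uv: "b = u * v" "u > 0" "v > 0" "coprime v Q" "\<forall>p. prime p \<longrightarrow> p dvd u \<longrightarrow> p dvd Q"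
      using less.hyps[of b] by (metis nat_mono_iff less.prems)
    have "\<forall>r. prime r \<longrightarrow> r dvd p * u \<longrightarrow> r dvd Q"
      using uv p by (metis dvd_gcdD2 dvd_trans prime_dvd_multD primes_dvd_imp_eq)
    then show ?thesis using uv b p1 by (intro exI[of _ "p * u"] exI[of _ v]) auto
  qed
qed

text \<open>All values of the shifted form agree modulo \<open>Q\<close>, so the congruence modulo
  \<open>Q * n\<close> amounts to one condition modulo \<open>n\<close>, which about n^3 of the n^4
  quadruples should meet. The count is split by the Chinese remainder theorem over
  \<open>n = m * v\<close>, where \<open>m\<close> is built from primes of \<open>Q\<close> and
  \<open>v\<close> is coprime to \<open>Q\<close>; only \<open>v\<close> costs a divisor
  sum.\<close>

lemma card_bqf_cong_period_le:
  fixes a k Q c y0 z0 t :: int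
  assumes pos: "a > 0" "k > 0" "Q > 0"
    and rad: "\<And>p. prime p \<Longrightarrow> p dvd 2 * k * (4 * c - 1) \<Longrightarrow> p dvd Q"
    and unit: "coprime (2 * y0 + z0) Q" and t: "a dvd t"
  defines "n \<equiv> 2 * k * Q * a"
  shows "real (card {((j, l), (j', l')) \<in> ({0..<n} \<times> {0..<n}) \<times> ({0..<n} \<times> {0..<n}).
      Q * n dvd bqf c (y0 + Q * j) (z0 + Q * l) - bqf c (y0 + Q * j') (z0 + Q * l') - t})
    \<le> real_of_int n ^ 3 * (\<Sum>d | d > 0 \<and> d dvd a \<and> coprime d Q. 1 / real_of_int d)"
    (is "real (card ?K) \<le> _")
proof -
  obtain u v where uv: "a = u * v" "u > 0" "v > 0" "coprime v Q" "\<And>p. prime p \<Longrightarrow> p dvd u \<Longrightarrow> p dvd Q"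
    using coprime_part_exists[OF pos(1)] by metis
  define m where "m = 2 * k * Q * u"
  have m: "m > 0" "n = m * v" using pos uv by (auto simp: m_def n_def)
  have mQ: "p dvd Q" if "prime p" "p dvd m" for p
    using that uv(5) rad unfolding m_def by (metis dvd_mult2 prime_dvd_multD)
  have cop_m: "coprime m w" if "coprime w Q" for w
  proof (rule coprimeI)
    fix d assume "d dvd m" "d dvd w"
    show "is_unit d"
    proof (rule ccontr)
      assume "\<not> is_unit d"
      moreover have "d \<noteq> 0" using \<open>d dvd m\<close> m by auto
      ultimately obtain p where p: "prime p" "p dvd d"
        by (metis prime_divisor_exists)
      then have "p dvd Q" "p dvd w" using mQ \<open>d dvd m\<close> \<open>d dvd w\<close> by (auto intro: dvd_trans)
      with that p show False by (metis coprime_common_divisor not_prime_unit)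
    qed
  qed
  have mv: "coprime m v" using cop_m uv by blast
  have cv: "coprime v (4 * c - 1)"
  proof (rule coprimeI)
    fix d assume "d dvd v" "d dvd 4 * c - 1"
    show "is_unit d"
    proof (rule ccontr)
      assume "\<not> is_unit d"
      moreover have "d \<noteq> 0" using \<open>d dvd v\<close> uv by auto
      ultimately obtain p where p: "prime p" "p dvd d"
        by (metis prime_divisor_exists)
      then have "p dvd Q" "p dvd v" using rad[of p] \<open>d dvd v\<close> \<open>d dvd 4 * c - 1\<close>
        by (auto intro: dvd_trans dvd_mult)
      with uv p show False by (metis coprime_common_divisor not_prime_unit)
    qed
  qed
  let ?y = "\<lambda>j. y0 + Q * j" and ?z = "\<lambda>l. z0 + Q * l"
  let ?B = "\<lambda>r. ({0..<r} \<times> {0..<r}) \<times> ({0..<r} \<times> {0..<r})"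
  let ?K1 = "{((j, l), (j', l')) \<in> ?B m. Q * m dvd bqf c (?y j) (?z l) - bqf c (?y j') (?z l') - t}"
  let ?K2 = "{((j, l), (j', l')) \<in> ?B v. v dvd bqf c (?y j) (?z l) - bqf c (?y j') (?z l')}"
  let ?K3 = "{((y, z), (y', z')) \<in> ?B v. v dvd bqf c y z - bqf c y' z'}"
  have fB: "finite (?B r)" for r :: int by simp
  have fK: "finite ?K1" "finite ?K2" "finite ?K3"
    by (rule finite_subset[OF _ fB[of m]] finite_subset[OF _ fB[of v]]; blast)+
  let ?md = "\<lambda>r ((j, l), (j', l')). ((j mod r, l mod r), (j' mod r, l' mod r))"
  have sub12: "(\<lambda>x. (?md m x, ?md v x)) ` ?K \<subseteq> ?K1 \<times> ?K2"
  proof (rule image_subsetI)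
    fix x assume xK: "x \<in> ?K"
    obtain j l j' l' where x: "x = ((j, l), (j', l'))" by (metis prod.exhaust)
    from xK have D: "Q * n dvd bqf c (?y j) (?z l) - bqf c (?y j') (?z l') - t" by (simp add: x)
    have "Q * m dvd Q * n" "v dvd Q * n" by (auto simp: m)
    with D have D1: "Q * m dvd bqf c (?y j) (?z l) - bqf c (?y j') (?z l') - t"
      and D2: "v dvd bqf c (?y j) (?z l) - bqf c (?y j') (?z l') - t" by (auto intro: dvd_trans)
    have "v dvd t" using t uv by (metis dvd_mult_right)
    from dvd_add[OF D2 this] have D2: "v dvd bqf c (?y j) (?z l) - bqf c (?y j') (?z l')" by simp
    have D1': "Q * m dvd bqf c (?y (j mod m)) (?z (l mod m)) - bqf c (?y (j' mod m)) (?z (l' mod m)) - t"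
    proof -
      have "[bqf c (?y (j mod m)) (?z (l mod m)) - bqf c (?y (j' mod m)) (?z (l' mod m)) - t =
         bqf c (?y j) (?z l) - bqf c (?y j') (?z l') - t] (mod (Q * m))"
        by (intro cong_diff bqf_residue_cong cong_refl)
      with D1 show ?thesis by (metis cong_dvd_iff)
    qed
    have D2': "v dvd bqf c (?y (j mod v)) (?z (l mod v)) - bqf c (?y (j' mod v)) (?z (l' mod v))"
    proof -
      have "[bqf c (?y (j mod v)) (?z (l mod v)) - bqf c (?y (j' mod v)) (?z (l' mod v)) =
         bqf c (?y j) (?z l) - bqf c (?y j') (?z l')] (mod v)"
        by (rule cong_dvd_modulus[of _ _ "Q * v"]) (intro cong_diff bqf_residue_cong, simp)
      with D2 show ?thesis by (metis cong_dvd_iff)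
    qed
    show "(?md m x, ?md v x) \<in> ?K1 \<times> ?K2"
      using D1' D2' m uv by (simp add: x)
  qed
  have inj12: "inj_on (\<lambda>x. (?md m x, ?md v x)) ?K"
  proof (rule inj_onI)
    have key: "x = y" if "x \<in> {0..<n}" "y \<in> {0..<n}" "x mod m = y mod m" "x mod v = y mod v" for x y
    proof -
      have "m dvd x - y" "v dvd x - y" using that by (auto simp: mod_eq_dvd_iff)
      then have "n dvd x - y" using mv m by (simp add: divides_mult)
      then show ?thesis using that by (metis atLeastLessThan_iff mod_eq_dvd_iff mod_pos_pos_trivial)
    qed
    fix x x' assume xx: "x \<in> ?K" "x' \<in> ?K" "(?md m x, ?md v x) = (?md m x', ?md v x')"
    obtain j l j' l' where x: "x = ((j, l), (j', l'))" by (metis prod.exhaust)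
    obtain i k i' k' where x': "x' = ((i, k), (i', k'))" by (metis prod.exhaust)
    have "j = i" "l = k" "j' = i'" "l' = k'"
      by (rule key; use xx in \<open>simp add: x x'\<close>)+
    then show "x = x'" by (simp add: x x')
  qed
  have "card ?K = card ((\<lambda>x. (?md m x, ?md v x)) ` ?K)" using inj12 by (simp only: card_image)
  also have "\<dots> \<le> card (?K1 \<times> ?K2)" using sub12 fK by (intro card_mono finite_cartesian_product)
  finally have K: "card ?K \<le> card ?K1 * card ?K2" by (simp only: card_cartesian_product)
  \<comment> \<open>Modulo \<open>m\<close> the other three coordinates determine \<open>j\<close>:
    changing \<open>j\<close> alone changes the value by \<open>Q\<close> times the change times a
    number congruent to \<open>2 * y0 + z0\<close> modulo \<open>Q\<close>, which is a unit modulo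
    \<open>m\<close>.\<close>
  have K1: "card ?K1 \<le> card ({0..<m} \<times> ({0..<m} \<times> {0..<m}))"
  proof (rule card_inj_on_le)
    show "inj_on (\<lambda>((j, l), (j', l')). (l, (j', l'))) ?K1"
    proof (rule inj_onI)
      fix x x' assume xx: "x \<in> ?K1" "x' \<in> ?K1"
        "(\<lambda>((j, l), (j', l')). (l, (j', l'))) x = (\<lambda>((j, l), (j', l')). (l, (j', l'))) x'"
      obtain j l j' l' where x: "x = ((j, l), (j', l'))" by (metis prod.exhaust)
      with xx(3) obtain i where x': "x' = ((i, l), (j', l'))" by (auto split: prod.splits)
      have ji: "j \<in> {0..<m}" "i \<in> {0..<m}"
        and 1: "Q * m dvd bqf c (?y j) (?z l) - bqf c (?y j') (?z l') - t"
        and 2: "Q * m dvd bqf c (?y i) (?z l) - bqf c (?y j') (?z l') - t"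
        using xx(1,2) by (simp_all add: x x')
      have "Q * m dvd bqf c (?y j) (?z l) - bqf c (?y i) (?z l)"
        using dvd_diff[OF 1 2] by simp
      also have "bqf c (?y j) (?z l) - bqf c (?y i) (?z l) = Q * ((j - i) * (2 * y0 + z0 + (i + j + l) * Q))"
        by (simp add: bqf_def algebra_simps)
      finally have "m dvd (j - i) * (2 * y0 + z0 + (i + j + l) * Q)" using pos by simp
      moreover have "coprime m (2 * y0 + z0 + (i + j + l) * Q)"
      proof (rule cop_m)
        show "coprime (2 * y0 + z0 + (i + j + l) * Q) Q"
          using unit gcd_add_mult[of Q "i + j + l" "2 * y0 + z0"]
          by (simp add: coprime_iff_gcd_eq_1 gcd.commute add.commute)
      qed
      ultimately have "m dvd j - i" by (simp add: coprime_dvd_mult_left_iff)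
      then have "j = i" using ji by (metis atLeastLessThan_iff mod_eq_dvd_iff mod_pos_pos_trivial)
      then show "x = x'" by (simp add: x x')
    qed
  qed auto
  \<comment> \<open>Modulo \<open>v\<close> the factor \<open>Q\<close> is invertible, so the affine
    substitution is a bijection of residues and the plain collision count applies.\<close>
  have K2: "card ?K2 \<le> card ?K3"
  proof (rule card_inj_on_le[where f = "\<lambda>((j, l), (j', l')). ((?y j mod v, ?z l mod v), (?y j' mod v, ?z l' mod v))"])
    have key: "x = y" if "x \<in> {0..<v}" "y \<in> {0..<v}" "(w + Q * x) mod v = (w + Q * y) mod v" for x y w
    proof -
      have "v dvd Q * (x - y)" using that by (simp add: mod_eq_dvd_iff algebra_simps)
      then have "v dvd x - y" using uv by (simp add: coprime_dvd_mult_right_iff)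
      then show ?thesis using that by (metis atLeastLessThan_iff mod_eq_dvd_iff mod_pos_pos_trivial)
    qed
    show "inj_on (\<lambda>((j, l), (j', l')). ((?y j mod v, ?z l mod v), (?y j' mod v, ?z l' mod v))) ?K2"
    proof (rule inj_onI)
      fix x x' assume xx: "x \<in> ?K2" "x' \<in> ?K2"
        "(\<lambda>((j, l), (j', l')). ((?y j mod v, ?z l mod v), (?y j' mod v, ?z l' mod v))) x
          = (\<lambda>((j, l), (j', l')). ((?y j mod v, ?z l mod v), (?y j' mod v, ?z l' mod v))) x'"
      obtain j l j' l' where x: "x = ((j, l), (j', l'))" by (metis prod.exhaust)
      obtain i k i' k' where x': "x' = ((i, k), (i', k'))" by (metis prod.exhaust)
      have "j = i" "j' = i'" by (rule key[of _ _ y0]; use xx in \<open>simp add: x x'\<close>)+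
      moreover have "l = k" "l' = k'" by (rule key[of _ _ z0]; use xx in \<open>simp add: x x'\<close>)+
      ultimately show "x = x'" by (simp add: x x')
    qed
    show "(\<lambda>((j, l), (j', l')). ((?y j mod v, ?z l mod v), (?y j' mod v, ?z l' mod v))) ` ?K2 \<subseteq> ?K3"
    proof (rule image_subsetI)
      fix x assume xK: "x \<in> ?K2"
      obtain j l j' l' where x: "x = ((j, l), (j', l'))" by (metis prod.exhaust)
      from xK have D: "v dvd bqf c (?y j) (?z l) - bqf c (?y j') (?z l')" by (simp add: x)
      have "[bqf c (?y j mod v) (?z l mod v) - bqf c (?y j' mod v) (?z l' mod v) = bqf c (?y j) (?z l) - bqf c (?y j') (?z l')] (mod v)"
        by (intro cong_diff bqf_mod; simp only: cong_mod_left cong_refl)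
      with D have "v dvd bqf c (?y j mod v) (?z l mod v) - bqf c (?y j' mod v) (?z l' mod v)" by (metis cong_dvd_iff)
      then show "(\<lambda>((j, l), (j', l')). ((?y j mod v, ?z l mod v), (?y j' mod v, ?z l' mod v))) x \<in> ?K3"
        using uv by (simp add: x)
    qed
  qed (fact fK)
  have "real (card ?K) \<le> real (card ?K1) * real (card ?K2)"
    using K by (simp only: of_nat_mult[symmetric] of_nat_le_iff)
  also have "\<dots> \<le> real_of_int m ^ 3 * (real_of_int v ^ 3 * (\<Sum>d | d > 0 \<and> d dvd v. 1 / real_of_int d))"
  proof (rule mult_mono)
    have "real (card ?K1) \<le> real (card ({0..<m} \<times> ({0..<m} \<times> {0..<m})))" using K1 by (simp only: of_nat_le_iff)
    also have "\<dots> = real_of_int m ^ 3" using m by (simp add: card_cartesian_product power3_eq_cube)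
    finally show "real (card ?K1) \<le> real_of_int m ^ 3" .
    have "real (card ?K2) \<le> real (card ?K3)" using K2 by (simp only: of_nat_le_iff)
    also have "\<dots> \<le> real_of_int v ^ 3 * (\<Sum>d | d > 0 \<and> d dvd v. 1 / real_of_int d)"
      by (rule card_bqf_collisions_mod_le[OF uv(3) cv])
    finally show "real (card ?K2) \<le> real_of_int v ^ 3 * (\<Sum>d | d > 0 \<and> d dvd v. 1 / real_of_int d)" .
  qed (use m in auto)
  also have "\<dots> = real_of_int n ^ 3 * (\<Sum>d | d > 0 \<and> d dvd v. 1 / real_of_int d)"
    by (simp add: m power_mult_distrib)
  also have "\<dots> \<le> real_of_int n ^ 3 * (\<Sum>d | d > 0 \<and> d dvd a \<and> coprime d Q. 1 / real_of_int d)"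
  proof (intro mult_left_mono sum_mono2)
    show "finite {d. d > 0 \<and> d dvd a \<and> coprime d Q}"
      by (rule finite_subset[of _ "{0..a}"]) (use pos zdvd_imp_le in auto)
    show "{d. d > 0 \<and> d dvd v} \<subseteq> {d. d > 0 \<and> d dvd a \<and> coprime d Q}"
      using uv by (auto intro: coprime_divisors[OF _ dvd_refl])
    show "0 \<le> real_of_int n ^ 3" using pos by (simp add: n_def)
  qed auto
  finally show ?thesis .
qed

section \<open>Second moment of the representation numbers\<close>

lemma sum_inverse_le_sqrt: "(\<Sum>d\<in>{1..int n}. 1 / real_of_int d) \<le> 2 * sqrt (real n)"
proof (induction n)
  case (Suc n)
  have "{1..int (Suc n)} = insert (int (Suc n)) {1..int n}" by auto
  then have "(\<Sum>d\<in>{1..int (Suc n)}. 1 / real_of_int d) = 1 / real (Suc n) + (\<Sum>d\<in>{1..int n}. 1 / real_of_int d)" by simp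
  also have "\<dots> \<le> 1 / real (Suc n) + 2 * sqrt (real n)" using Suc by simp
  also have "\<dots> \<le> 2 * sqrt (real (Suc n))"
  proof -
    define s t where "s = sqrt (real (Suc n))" and "t = sqrt (real n)"
    have st: "t \<le> s" "s \<ge> 1" "t \<ge> 0" by (auto simp: s_def t_def)
    have "1 = (s - t) * (s + t)" by (simp add: s_def t_def algebra_simps)
    also have "\<dots> \<le> (s - t) * (2 * s)" using st by (intro mult_left_mono) auto
    finally have "1 \<le> (s - t) * (2 * s)" .
    also have "\<dots> = (s - t) * (2 * s) * 1" by simp
    also have "\<dots> \<le> (s - t) * (2 * s) * s" using st by (intro mult_left_mono) auto
    also have "\<dots> = 2 * (s - t) * (s * s)" by (simp add: algebra_simps)
    also have "s * s = real (Suc n)" by (simp add: s_def)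
    finally have "1 / real (Suc n) \<le> 2 * (s - t)" by (simp add: divide_simps del: of_nat_Suc)
    then show ?thesis by (simp add: s_def t_def)
  qed
  finally show ?case .
qed simp

lemma sum_inverse_squares_le:
  assumes "P \<ge> 1"
  shows "(\<Sum>d\<in>{P + 1..P + int n}. 1 / (real_of_int d)\<^sup>2) \<le> 1 / real_of_int P - 1 / real_of_int (P + int n)"
proof (induction n)
  case (Suc n)
  let ?m = "real_of_int (P + int n)"
  have m: "?m \<ge> 1" using assms by simp
  have "{P + 1..P + int (Suc n)} = insert (P + int (Suc n)) {P + 1..P + int n}" using assms by auto
  then have "(\<Sum>d\<in>{P + 1..P + int (Suc n)}. 1 / (real_of_int d)\<^sup>2) =
     1 / (?m + 1)\<^sup>2 + (\<Sum>d\<in>{P + 1..P + int n}. 1 / (real_of_int d)\<^sup>2)" by (simp add: add_ac)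
  also have "\<dots> \<le> 1 / (?m + 1)\<^sup>2 + (1 / real_of_int P - 1 / ?m)" using Suc by simp
  also have "1 / (?m + 1)\<^sup>2 \<le> 1 / ?m - 1 / (?m + 1)"
  proof -
    have "1 / (?m + 1)\<^sup>2 \<le> 1 / (?m * (?m + 1))"
      using m by (intro divide_left_mono) (auto simp: power2_eq_square)
    also have "\<dots> = 1 / ?m - 1 / (?m + 1)" using m by (simp add: field_simps)
    finally show ?thesis .
  qed
  finally show ?case by (simp add: add_ac)
qed simp

lemma card_int_interval_le:
  fixes u v :: real
  assumes "u \<le> v"
  shows "real (card {b::int. u \<le> b \<and> b \<le> v}) \<le> v - u + 1"
proof -
  have "{b::int. u \<le> b \<and> b \<le> v} = {\<lceil>u\<rceil>..\<lfloor>v\<rfloor>}" by (auto simp: ceiling_le_iff le_floor_iff)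
  then have "real (card {b::int. u \<le> b \<and> b \<le> v}) = real (nat (\<lfloor>v\<rfloor> - \<lceil>u\<rceil> + 1))" by simp
  also have "\<dots> \<le> v - u + 1" using assms by (cases "\<lfloor>v\<rfloor> - \<lceil>u\<rceil> + 1 \<ge> 0") (auto simp: of_nat_nat, linarith+)
  finally show ?thesis .
qed

text \<open>Writing \<open>a = d * b\<close> turns the sum into one of 1 / (d^2 b), with
  \<open>b\<close> between \<open>\<alpha> / d\<close> and \<open>\<beta> / d\<close>; there are at
  most (\<beta> - \<alpha>) / d + 1 such \<open>b\<close>. The divisor 1 contributes the main term,
  all others exceed \<open>P\<close> and add at most the fraction 1 / P of it. The summands + 1 from
  rounding produce the error, where 3 bounds 2 sqrt 2.\<close>

lemma sum_coprime_divisor_weights_le: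
  fixes \<alpha> \<beta> :: real and P Q :: int
  assumes \<alpha>: "0 < \<alpha>" "\<alpha> \<le> \<beta>" "\<beta> \<le> 2 * \<alpha>" and P: "P \<ge> 1" "\<And>d. d > 1 \<Longrightarrow> coprime d Q \<Longrightarrow> d > P"
  shows "(\<Sum>a::int | \<alpha> \<le> a \<and> a \<le> \<beta>. (\<Sum>d | d > 0 \<and> d dvd a \<and> coprime d Q. 1 / real_of_int d) / real_of_int a)
    \<le> (\<beta> / \<alpha> - 1) * (1 + 1 / P) + 3 / sqrt \<alpha>"
proof -
  let ?A = "{a::int. \<alpha> \<le> a \<and> a \<le> \<beta>}"
  let ?Dv = "\<lambda>a. {d. d > 0 \<and> d dvd a \<and> coprime d Q}"
  let ?D = "{d::int. d > 0 \<and> d \<le> \<beta> \<and> coprime d Q}"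
  let ?B = "\<lambda>d. {b::int. \<alpha> / real_of_int d \<le> b \<and> b \<le> \<beta> / real_of_int d}"
  have iv: "{b::int. u \<le> b \<and> b \<le> v} = {\<lceil>u\<rceil>..\<lfloor>v\<rfloor>}" for u v :: real by (auto simp: ceiling_le_iff le_floor_iff)
  have fA: "finite ?A" "finite (?B d)" for d unfolding iv by auto
  have fD: "finite ?D" by (rule finite_subset[of _ "{0..\<lfloor>\<beta>\<rfloor>}"]) (auto simp: le_floor_iff)
  have a0: "a > 0" if "a \<in> ?A" for a using that \<alpha> by auto
  have fDv: "finite (?Dv a)" if "a \<in> ?A" for a
    by (rule finite_subset[of _ "{0..a}"]) (use a0[OF that] zdvd_imp_le in auto)
  have "(\<Sum>a\<in>?A. (\<Sum>d\<in>?Dv a. 1 / real_of_int d) / real_of_int a) = (\<Sum>a\<in>?A. \<Sum>d\<in>?Dv a. 1 / (real_of_int d * real_of_int a))"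
    by (simp add: sum_divide_distrib)
  also have "\<dots> = (\<Sum>(a, d)\<in>Sigma ?A ?Dv. 1 / (real_of_int d * real_of_int a))"
    using fA fDv by (subst sum.Sigma) auto
  also have "\<dots> = (\<Sum>(d, b)\<in>Sigma ?D ?B. 1 / (real_of_int d ^ 2 * real_of_int b))"
  proof (rule sum.reindex_bij_witness[where j = "\<lambda>(a, d). (d, a div d)" and i = "\<lambda>(d, b). (d * b, d)"], goal_cases)
    case (1 x) then show ?case by auto
  next
    case (2 x)
    then obtain a d where x: "x = (a, d)" "\<alpha> \<le> a" "a \<le> \<beta>" "d > 0" "d dvd a" "coprime d Q" by auto
    then obtain b where b: "a = d * b" by auto
    have "d \<le> a" using x a0[of a] by (simp add: zdvd_imp_le)
    then have "real_of_int d \<le> \<beta>" using x by linarith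
    then show ?case using x b by (auto simp: field_simps)
  next
    case (3 x) then show ?case by auto
  next
    case (4 x) then show ?case by (auto simp: field_simps)
  next
    case (5 x) then show ?case by (auto simp: power2_eq_square)
  qed
  also have "\<dots> = (\<Sum>d\<in>?D. \<Sum>b\<in>?B d. 1 / (real_of_int d ^ 2 * real_of_int b))"
    using fD fA by (subst sum.Sigma) auto
  also have "\<dots> \<le> (\<Sum>d\<in>?D. (\<beta> / \<alpha> - 1) * (1 / real_of_int d ^ 2) + (1 / \<alpha>) * (1 / real_of_int d))"
  proof (rule sum_mono)
    fix d assume d: "d \<in> ?D"
    then have d0: "real_of_int d > 0" by simp
    have "(\<Sum>b\<in>?B d. 1 / (real_of_int d ^ 2 * real_of_int b)) \<le> (\<Sum>b\<in>?B d. 1 / (real_of_int d ^ 2 * (\<alpha> / real_of_int d)))"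
    proof (rule sum_mono)
      fix b assume "b \<in> ?B d"
      moreover have "\<alpha> / real_of_int d > 0" using d0 \<alpha> by simp
      ultimately show "1 / (real_of_int d ^ 2 * real_of_int b) \<le> 1 / (real_of_int d ^ 2 * (\<alpha> / real_of_int d))"
        using d0 by (intro divide_left_mono mult_left_mono mult_pos_pos zero_less_power) (auto intro: less_le_trans)
    qed
    also have "\<dots> = real (card (?B d)) * (1 / (real_of_int d * \<alpha>))"
      using d0 by (simp add: power2_eq_square)
    also have "\<dots> \<le> (\<beta> / real_of_int d - \<alpha> / real_of_int d + 1) * (1 / (real_of_int d * \<alpha>))"
      using d0 \<alpha> by (intro mult_right_mono card_int_interval_le divide_right_mono) auto
    also have "\<dots> = (\<beta> / \<alpha> - 1) * (1 / real_of_int d ^ 2) + (1 / \<alpha>) * (1 / real_of_int d)"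
      using d0 \<alpha> by (simp add: field_simps power2_eq_square)
    finally show "(\<Sum>b\<in>?B d. 1 / (real_of_int d ^ 2 * real_of_int b)) \<le> (\<beta> / \<alpha> - 1) * (1 / real_of_int d ^ 2) + (1 / \<alpha>) * (1 / real_of_int d)" .
  qed
  also have "\<dots> = (\<beta> / \<alpha> - 1) * (\<Sum>d\<in>?D. 1 / real_of_int d ^ 2) + (1 / \<alpha>) * (\<Sum>d\<in>?D. 1 / real_of_int d)"
    by (simp add: sum.distrib sum_distrib_left)
  also have "\<dots> \<le> (\<beta> / \<alpha> - 1) * (1 + 1 / P) + (1 / \<alpha>) * (3 * sqrt \<alpha>)"
  proof (rule add_mono; rule mult_left_mono)
    let ?M = "nat \<lfloor>\<beta>\<rfloor>"
    have M: "d \<in> {P + 1..P + int ?M}" if "d \<in> ?D - {1}" for d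
    proof -
      have "d > P" using that P(2)[of d] by auto
      moreover have "d \<le> \<lfloor>\<beta>\<rfloor>" using that by (auto simp: le_floor_iff)
      ultimately show ?thesis using P(1) \<alpha>(1,2) by simp
    qed
    have "(\<Sum>d\<in>?D. 1 / real_of_int d ^ 2) \<le> (\<Sum>d\<in>insert 1 {P + 1..P + int ?M}. 1 / real_of_int d ^ 2)"
    proof (rule sum_mono2)
      show "?D \<subseteq> insert 1 {P + 1..P + int ?M}" using M by blast
    qed auto
    also have "\<dots> = 1 + (\<Sum>d\<in>{P + 1..P + int ?M}. 1 / real_of_int d ^ 2)" using P by simp
    also have "\<dots> \<le> 1 + (1 / P - 1 / real_of_int (P + int ?M))"
      using sum_inverse_squares_le[OF P(1)] by (intro add_left_mono)
    also have "\<dots> \<le> 1 + 1 / P" using P by simp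
    finally show "(\<Sum>d\<in>?D. 1 / real_of_int d ^ 2) \<le> 1 + 1 / P" .
    have "(\<Sum>d\<in>?D. 1 / real_of_int d) \<le> (\<Sum>d\<in>{1..int ?M}. 1 / real_of_int d)"
      by (intro sum_mono2) (auto simp: le_floor_iff)
    also have "\<dots> \<le> 2 * sqrt (real ?M)" by (rule sum_inverse_le_sqrt)
    also have "\<dots> \<le> 2 * sqrt (2 * \<alpha>)" using \<alpha> by (intro mult_left_mono real_sqrt_le_mono) (auto, linarith)
    also have "\<dots> = (2 * sqrt 2) * sqrt \<alpha>" by (simp add: real_sqrt_mult)
    also have "\<dots> \<le> 3 * sqrt \<alpha>"
    proof (rule mult_right_mono)
      have "sqrt 2 \<le> 3 / 2" by (rule real_le_lsqrt) (auto simp: power2_eq_square)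
      then show "2 * sqrt 2 \<le> 3" by simp
    qed (use \<alpha> in auto)
    finally show "(\<Sum>d\<in>?D. 1 / real_of_int d) \<le> 3 * sqrt \<alpha>" .
  qed (use \<alpha> in \<open>auto simp: field_simps\<close>)
  also have "(1 / \<alpha>) * (3 * sqrt \<alpha>) = 3 / sqrt \<alpha>"
    using \<alpha> by (simp add: field_simps)
  finally show ?thesis .
qed

text \<open>Four times the form is \<open>(2y + z)\<^sup>2 + (4c - 1)z\<^sup>2\<close>; since \<open>y\<close> dominates \<open>z\<close>, close values force close \<open>y\<close>.\<close>

lemma bqf_diff_close:
  fixes j l j' l' Y Z c Q y0 z0 :: int and H :: real
  assumes Q: "Q > 0" "0 \<le> y0" "0 \<le> z0" "z0 < Q" "c \<ge> 1" and Y: "Y > 0" "Y \<le> j" "Y \<le> j'"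
    and Z: "0 \<le> l" "l < Z" "0 \<le> l'" "l' < Z"
    and H: "\<bar>real_of_int (bqf c (y0 + Q * j) (z0 + Q * l) - bqf c (y0 + Q * j') (z0 + Q * l'))\<bar> \<le> H"
  shows "\<bar>real_of_int (2 * (j - j') + (l - l'))\<bar> \<le> (H + c * Q^2 * Z^2) / Y"
proof -
  define s s' z z' where "s = 2 * (y0 + Q * j) + (z0 + Q * l)" and "s' = 2 * (y0 + Q * j') + (z0 + Q * l')"
    and "z = z0 + Q * l" and "z' = z0 + Q * l'"
  define e where "e = 2 * (j - j') + (l - l')"
  have ss: "s - s' = Q * e" by (simp add: s_def s'_def e_def algebra_simps)
  have "Q * Y \<le> Q * j" "Q * Y \<le> Q * j'" "0 \<le> Q * l" "0 \<le> Q * l'" using Q Y Z by (auto intro: mult_left_mono)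
  moreover have "4 * a \<le> 2 * (y0 + b) + (z0 + d) + (2 * (y0 + b') + (z0 + d'))"
    if "a \<le> b" "a \<le> b'" "0 \<le> d" "0 \<le> d'" for a b b' d d' using that Q by simp
  ultimately have s0: "s + s' \<ge> 4 * (Q * Y)" unfolding s_def s'_def by blast
  have zZ: "0 \<le> w" "w \<le> Q * Z" if "w = z \<or> w = z'" for w
  proof -
    have "Q * (l + 1) \<le> Q * Z" "Q * (l' + 1) \<le> Q * Z" using Q Z by (auto intro: mult_left_mono)
    then show "0 \<le> w" "w \<le> Q * Z" using that Q Z unfolding z_def z'_def by (auto simp: algebra_simps)
  qed
  have zz: "\<bar>z^2 - z'^2\<bar> \<le> (Q * Z)^2"
  proof -
    have "0 \<le> z^2" "z^2 \<le> (Q * Z)^2" "0 \<le> z'^2" "z'^2 \<le> (Q * Z)^2" using zZ by (auto intro: power_mono)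
    then show ?thesis by linarith
  qed
  let ?D = "bqf c (y0 + Q * j) (z0 + Q * l) - bqf c (y0 + Q * j') (z0 + Q * l')"
  have "4 * ?D = (s - s') * (s + s') + (4 * c - 1) * (z^2 - z'^2)"
    unfolding s_def s'_def z_def z'_def bqf_def by (simp add: power2_eq_square algebra_simps)
  then have "(s - s') * (s + s') = 4 * ?D - (4 * c - 1) * (z^2 - z'^2)" by simp
  then have "\<bar>(s - s') * (s + s')\<bar> \<le> \<bar>4 * ?D\<bar> + \<bar>(4 * c - 1) * (z^2 - z'^2)\<bar>"
    by (simp only: abs_triangle_ineq4)
  also have "\<dots> = 4 * \<bar>?D\<bar> + (4 * c - 1) * \<bar>z^2 - z'^2\<bar>"
  proof -
    have "\<bar>4 * c - 1\<bar> = 4 * c - 1" using Q by simp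
    then show ?thesis by (simp only: abs_mult abs_numeral)
  qed
  also have "\<dots> \<le> 4 * \<bar>?D\<bar> + 4 * c * (Q * Z)^2"
    using Q zz by (intro add_left_mono mult_mono) auto
  finally have "\<bar>s - s'\<bar> * \<bar>s + s'\<bar> \<le> 4 * \<bar>?D\<bar> + 4 * c * (Q * Z)^2"
    by (simp only: abs_mult)
  moreover have "0 \<le> Q * Y" using Q Y by simp
  ultimately have *: "\<bar>s - s'\<bar> * (s + s') \<le> 4 * \<bar>?D\<bar> + 4 * c * (Q * Z)^2"
    using s0 by simp
  have "4 * (\<bar>e\<bar> * Y) \<le> \<bar>e\<bar> * (4 * (Q * Y)) "
    using Q Y by (simp add: mult_left_mono)
  also have "\<dots> \<le> (Q * \<bar>e\<bar>) * (4 * (Q * Y))"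
    using Q Y mult_right_mono[of 1 Q "\<bar>e\<bar>"] by (intro mult_right_mono) auto
  also have "\<dots> \<le> (Q * \<bar>e\<bar>) * (s + s')"
    using Q by (intro mult_left_mono s0) auto
  also have "Q * \<bar>e\<bar> = \<bar>s - s'\<bar>" using ss Q by (simp add: abs_mult)
  also note *
  finally have "\<bar>e\<bar> * Y \<le> \<bar>?D\<bar> + c * (Q * Z)^2" by simp
  then have "real_of_int (\<bar>e\<bar> * Y) \<le> real_of_int (\<bar>?D\<bar> + c * (Q * Z)^2)" by (rule of_int_le_iff[THEN iffD2])
  then have "\<bar>real_of_int e\<bar> * Y \<le> H + c * Q^2 * Z^2"
    using H by (simp add: power_mult_distrib mult.assoc)
  then have "\<bar>real_of_int e\<bar> \<le> (H + c * Q^2 * Z^2) / Y" using Y by (simp add: pos_le_divide_eq)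
  then show ?thesis by (simp add: e_def)
qed

section \<open>Close and equal values in a thin box\<close>

lemma card_near_even_le:
  fixes g :: int and E :: real
  assumes "E \<ge> 0"
  shows "finite {f::int. \<bar>real_of_int (2 * f + g)\<bar> \<le> E}" "real (card {f::int. \<bar>real_of_int (2 * f + g)\<bar> \<le> E}) \<le> E + 1"
proof -
  have eq: "{f::int. \<bar>real_of_int (2 * f + g)\<bar> \<le> E} = {f::int. (- E - g) / 2 \<le> f \<and> f \<le> (E - g) / 2}"
    by (auto simp: abs_le_iff field_simps)
  have iv: "{b::int. u \<le> b \<and> b \<le> v} = {\<lceil>u\<rceil>..\<lfloor>v\<rfloor>}" for u v :: real by (auto simp: ceiling_le_iff le_floor_iff)
  show "finite {f::int. \<bar>real_of_int (2 * f + g)\<bar> \<le> E}" unfolding eq iv by simp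
  have "real (card {f::int. \<bar>real_of_int (2 * f + g)\<bar> \<le> E}) \<le> (E - g) / 2 - (- E - g) / 2 + 1"
    unfolding eq by (rule card_int_interval_le) (use assms in auto)
  then show "real (card {f::int. \<bar>real_of_int (2 * f + g)\<bar> \<le> E}) \<le> E + 1" by (simp add: field_simps)
qed

text \<open>With \<open>j\<close>, \<open>l\<close> and \<open>l'\<close> chosen freely,
  \<open>bqf_diff_close\<close> confines \<open>j - j'\<close> to an interval of length (H + c Q^2
  Z^2) / Y.\<close>

lemma card_bqf_near_le:
  fixes Y Y2 Z c Q y0 z0 :: int and H :: real
  assumes Q: "Q > 0" "0 \<le> y0" "0 \<le> z0" "z0 < Q" "c \<ge> 1" and Y: "Y > 0" "Y \<le> Y2" "Z \<ge> 0" "H \<ge> 0"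
  shows "real (card {((j, l), (j', l')) \<in> ({Y..<Y2} \<times> {0..<Z}) \<times> ({Y..<Y2} \<times> {0..<Z}).
      \<bar>real_of_int (bqf c (y0 + Q * j) (z0 + Q * l) - bqf c (y0 + Q * j') (z0 + Q * l'))\<bar> \<le> H})
    \<le> (real_of_int (Y2 - Y) * real_of_int Z^2) * ((H + c * Q^2 * Z^2) / Y + 1)" (is "real (card ?S) \<le> _")
proof -
  let ?E = "(H + c * Q^2 * Z^2) / real_of_int Y"
  have E: "?E \<ge> 0" using assms by simp
  let ?I = "{Y..<Y2} \<times> {0..<Z} \<times> {0..<Z}"
  let ?F = "\<lambda>(j, l, l'). {f::int. \<bar>real_of_int (2 * f + (l - l'))\<bar> \<le> ?E}"
  have fF: "finite (?F i)" and cF: "real (card (?F i)) \<le> ?E + 1" for i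
  proof -
    obtain j l l' where i: "i = (j, l, l')" by (metis prod.exhaust)
    show "finite (?F i)" "real (card (?F i)) \<le> ?E + 1" using card_near_even_le[OF E, of "l - l'"] by (simp_all add: i)
  qed
  have "card ?S \<le> card (Sigma ?I ?F)"
  proof (rule card_inj_on_le[where f = "\<lambda>((j, l), (j', l')). ((j, l, l'), j - j')"])
    show "inj_on (\<lambda>((j, l), (j', l')). ((j, l, l'), j - j')) ?S" by (auto simp: inj_on_def)
    show "(\<lambda>((j, l), (j', l')). ((j, l, l'), j - j')) ` ?S \<subseteq> Sigma ?I ?F"
    proof (rule image_subsetI)
      fix x assume xS: "x \<in> ?S"
      obtain j l j' l' where x: "x = ((j, l), (j', l'))" by (metis prod.exhaust)
      have "\<bar>real_of_int (2 * (j - j') + (l - l'))\<bar> \<le> ?E"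
        using bqf_diff_close[OF Q Y(1), of j j' l Z l' H] xS by (simp add: x)
      then show "(\<lambda>((j, l), (j', l')). ((j, l, l'), j - j')) x \<in> Sigma ?I ?F"
        using xS by (simp add: x)
    qed
    show "finite (Sigma ?I ?F)" by (rule finite_SigmaI[OF _ fF]) simp
  qed
  also have "\<dots> = (\<Sum>i\<in>?I. card (?F i))" by (rule card_SigmaI[OF _ ballI[OF fF]]) simp
  finally have "card ?S \<le> (\<Sum>i\<in>?I. card (?F i))" .
  then have "real (card ?S) \<le> (\<Sum>i\<in>?I. real (card (?F i)))" by (simp only: of_nat_sum[symmetric] of_nat_le_iff)
  also have "\<dots> \<le> (\<Sum>i\<in>?I. ?E + 1)"
    by (rule sum_mono) (rule cF)
  also have "\<dots> = (real_of_int (Y2 - Y) * real_of_int Z^2) * (?E + 1)"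
    using Y by (simp add: card_cartesian_product power2_eq_square)
  finally show ?thesis .
qed

text \<open>The case \<open>H = 0\<close> of \<open>card_bqf_near_le\<close> would be too weak,
  because this count is later multiplied by \<open>J\<close>. Here \<open>j\<close> is not free:
  given \<open>l\<close>, \<open>l'\<close> and \<open>j - j'\<close> with
  \<open>2 * (j - j') + (l - l') \<noteq> 0\<close>, equality of the values determines
  \<open>j + j'\<close>. If that number is 0, equality forces the two points to coincide.\<close>

lemma card_bqf_equal_le:
  fixes Y Y2 Z c Q y0 z0 :: int
  assumes Q: "Q > 0" "0 \<le> y0" "0 \<le> z0" "z0 < Q" "c \<ge> 1" and Y: "Y > 0" "Y \<le> Y2" "Z \<ge> 0"
  shows "real (card {((j, l), (j', l')) \<in> ({Y..<Y2} \<times> {0..<Z}) \<times> ({Y..<Y2} \<times> {0..<Z}).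
      bqf c (y0 + Q * j) (z0 + Q * l) = bqf c (y0 + Q * j') (z0 + Q * l')})
    \<le> real_of_int (Y2 - Y) * real_of_int Z + real_of_int Z^2 * (c * Q^2 * Z^2 / Y + 1)" (is "real (card ?S) \<le> _")
proof -
  let ?E = "(0 + c * Q^2 * Z^2) / real_of_int Y"
  have E: "?E \<ge> 0" using assms by simp
  let ?I = "{0..<Z} \<times> {0..<Z}"
  let ?F = "\<lambda>(l, l'). {f::int. \<bar>real_of_int (2 * f + (l - l'))\<bar> \<le> ?E}"
  let ?W = "{Y..<Y2} \<times> {0..<Z}"
  let ?S1 = "{((j, l), (j', l')) \<in> ?S. 2 * (j - j') + (l - l') \<noteq> 0}"
  have fS: "finite ?S" by (rule finite_subset[of _ "?W \<times> ?W"]) auto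
  have split: "4 * bqf c (y0 + Q * j) (z0 + Q * l) - 4 * bqf c (y0 + Q * j') (z0 + Q * l') =
      Q * (2 * (j - j') + (l - l')) * (4 * y0 + 2 * z0 + Q * (2 * (j + j') + (l + l'))) + (4 * c - 1) * ((z0 + Q * l)^2 - (z0 + Q * l')^2)" for j l j' l'
    by (simp add: bqf_def power2_eq_square algebra_simps)
  have diag: "?S \<subseteq> (\<lambda>w. (w, w)) ` ?W \<union> ?S1"
  proof
    fix x assume xS: "x \<in> ?S"
    obtain j l j' l' where x: "x = ((j, l), (j', l'))" by (metis prod.exhaust)
    show "x \<in> (\<lambda>w. (w, w)) ` ?W \<union> ?S1"
    proof (cases "2 * (j - j') + (l - l') = 0")
      case True
      with xS split[of j l j' l'] have "(4 * c - 1) * ((z0 + Q * l)^2 - (z0 + Q * l')^2) = 0" by (simp add: x)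
      then have "(z0 + Q * l)^2 = (z0 + Q * l')^2" using Q by simp
      moreover have "0 \<le> l" "0 \<le> l'" using xS by (simp_all add: x)
      then have "0 \<le> z0 + Q * l" "0 \<le> z0 + Q * l'" using Q by simp_all
      ultimately have "z0 + Q * l = z0 + Q * l'" by (rule power2_eq_imp_eq)
      then have "l = l'" using Q by simp
      with True xS show ?thesis by (auto simp: x)
    next
      case False
      then show ?thesis using xS by (simp add: x)
    qed
  qed
  have c1: "card ((\<lambda>w. (w, w)) ` ?W) = nat (Y2 - Y) * nat Z"
    by (subst card_image) (auto simp: inj_on_def card_cartesian_product)
  have fF: "finite (?F i)" and cF: "real (card (?F i)) \<le> ?E + 1" for i
  proof -
    obtain l l' where i: "i = (l, l')" by (metis prod.exhaust)
    show "finite (?F i)" "real (card (?F i)) \<le> ?E + 1" using card_near_even_le[OF E, of "l - l'"] by (simp_all add: i)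
  qed
  have "card ?S1 \<le> card (Sigma ?I ?F)"
  proof (rule card_inj_on_le[where f = "\<lambda>((j, l), (j', l')). ((l, l'), j - j')"])
    show "inj_on (\<lambda>((j, l), (j', l')). ((l, l'), j - j')) ?S1"
    proof (rule inj_onI)
      fix x x' assume xx: "x \<in> ?S1" "x' \<in> ?S1"
        "(\<lambda>((j, l), (j', l')). ((l, l'), j - j')) x = (\<lambda>((j, l), (j', l')). ((l, l'), j - j')) x'"
      obtain j l j' l' where x: "x = ((j, l), (j', l'))" by (metis prod.exhaust)
      obtain i k i' k' where x': "x' = ((i, k), (i', k'))" by (metis prod.exhaust)
      have kl: "k = l" "k' = l'" and eq: "j - j' = i - i'" using xx(3) by (simp_all add: x x')
      have e: "2 * (j - j') + (l - l') \<noteq> 0" using xx(1) by (simp add: x)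
      have e': "2 * (i - i') + (l - l') = 2 * (j - j') + (l - l')" using eq by simp
      have "Q * (2 * (j - j') + (l - l')) * (4 * y0 + 2 * z0 + Q * (2 * (j + j') + (l + l')))
         = Q * (2 * (j - j') + (l - l')) * (4 * y0 + 2 * z0 + Q * (2 * (i + i') + (l + l')))"
      proof -
        have "bqf c (y0 + Q * j) (z0 + Q * l) = bqf c (y0 + Q * j') (z0 + Q * l')"
          "bqf c (y0 + Q * i) (z0 + Q * l) = bqf c (y0 + Q * i') (z0 + Q * l')"
          using xx(1,2) by (simp_all add: x x' kl)
        then show ?thesis using split[of j l j' l'] split[of i l i' l'] unfolding e' by linarith
      qed
      then have "4 * y0 + 2 * z0 + Q * (2 * (j + j') + (l + l')) = 4 * y0 + 2 * z0 + Q * (2 * (i + i') + (l + l'))"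
        using e Q by (metis mult_cancel_left mult_eq_0_iff less_irrefl)
      then have "Q * (2 * (j + j') + (l + l')) = Q * (2 * (i + i') + (l + l'))" by linarith
      then have "2 * (j + j') + (l + l') = 2 * (i + i') + (l + l')" using Q by (metis mult_cancel_left less_irrefl)
      with eq show "x = x'" by (simp add: x x' kl)
    qed
    show "(\<lambda>((j, l), (j', l')). ((l, l'), j - j')) ` ?S1 \<subseteq> Sigma ?I ?F"
    proof (rule image_subsetI)
      fix x assume xS: "x \<in> ?S1"
      obtain j l j' l' where x: "x = ((j, l), (j', l'))" by (metis prod.exhaust)
      have "\<bar>real_of_int (2 * (j - j') + (l - l'))\<bar> \<le> ?E"
        using bqf_diff_close[OF Q Y(1), of j j' l Z l' 0] xS by (simp add: x)
      then show "(\<lambda>((j, l), (j', l')). ((l, l'), j - j')) x \<in> Sigma ?I ?F"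
        using xS by (simp add: x)
    qed
    show "finite (Sigma ?I ?F)" by (rule finite_SigmaI[OF _ fF]) simp
  qed
  also have "\<dots> = (\<Sum>i\<in>?I. card (?F i))" by (rule card_SigmaI[OF _ ballI[OF fF]]) simp
  finally have "card ?S1 \<le> (\<Sum>i\<in>?I. card (?F i))" .
  then have "real (card ?S1) \<le> (\<Sum>i\<in>?I. real (card (?F i)))" by (simp only: of_nat_sum[symmetric] of_nat_le_iff)
  also have "\<dots> \<le> (\<Sum>i\<in>?I. ?E + 1)"
    by (rule sum_mono) (rule cF)
  also have "\<dots> = real_of_int Z^2 * (c * Q^2 * Z^2 / Y + 1)"
    using Y by (simp add: card_cartesian_product power2_eq_square)
  finally have c2: "real (card ?S1) \<le> real_of_int Z^2 * (c * Q^2 * Z^2 / Y + 1)" .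
  have "card ?S \<le> card ((\<lambda>w. (w, w)) ` ?W \<union> ?S1)"
    by (rule card_mono[OF _ diag]) (rule finite_UnI, simp, rule finite_subset[OF _ fS], auto)
  also have "\<dots> \<le> card ((\<lambda>w. (w, w)) ` ?W) + card ?S1" by (rule card_Un_le)
  finally have "real (card ?S) \<le> real (card ((\<lambda>w. (w, w)) ` ?W)) + real (card ?S1)" by linarith
  also have "real (card ((\<lambda>w. (w, w)) ` ?W)) = real_of_int (Y2 - Y) * real_of_int Z" unfolding c1 using Y by simp
  finally show ?thesis using c2 by linarith
qed

lemma bqf_increment_bounds:
  fixes y z s t m c :: int
  assumes "0 \<le> y" "0 \<le> z" "0 \<le> s" "s \<le> m" "0 \<le> t" "t \<le> m" "0 \<le> c"
  shows "0 \<le> bqf c (y + s) (z + t) - bqf c y z"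
    and "bqf c (y + s) (z + t) - bqf c y z \<le> m * (3 * y + (1 + 2 * c) * z + (2 + c) * m)"
proof -
  have nn: "0 \<le> (2 * s + t) * y" "0 \<le> (s + 2 * c * t) * z" "0 \<le> s * s" "0 \<le> s * t" "0 \<le> c * t * t"
    using assms by (auto intro!: mult_nonneg_nonneg add_nonneg_nonneg)
  then show "0 \<le> bqf c (y + s) (z + t) - bqf c y z"
    unfolding bqf_shift by (simp add: bqf_def)
  have eq: "bqf c (y + s) (z + t) - bqf c y z = (2 * s + t) * y + (s + 2 * c * t) * z + (s * s + s * t + c * t * t)"
    unfolding bqf_shift by (simp add: bqf_def)
  have ct: "c * t \<le> c * m" using assms by (simp add: mult_left_mono)
  have "(2 * s + t) * y \<le> (3 * m) * y" using assms by (intro mult_right_mono) auto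
  moreover have "(s + 2 * c * t) * z \<le> (m + 2 * c * m) * z" using assms ct by (intro mult_right_mono) auto
  moreover have "s * s \<le> m * m" "s * t \<le> m * m" using assms by (auto intro: mult_mono)
  moreover have "c * t * t \<le> c * m * m" using assms ct by (intro mult_mono) auto
  ultimately have "bqf c (y + s) (z + t) - bqf c y z \<le> (3 * m) * y + (m + 2 * c * m) * z + (m * m + m * m + c * m * m)"
    unfolding eq by linarith
  also have "\<dots> = m * (3 * y + (1 + 2 * c) * z + (2 + c) * m)" by (simp add: algebra_simps)
  finally show "bqf c (y + s) (z + t) - bqf c y z \<le> m * (3 * y + (1 + 2 * c) * z + (2 + c) * m)" .
qed

definition coprime_divisor_sum :: "int \<Rightarrow> int \<Rightarrow> real" where
  "coprime_divisor_sum Q a = (\<Sum>d | d > 0 \<and> d dvd a \<and> coprime d Q. 1 / real_of_int d)"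

lemma coprime_divisor_sum_nonneg: "coprime_divisor_sum Q a \<ge> 0"
  unfolding coprime_divisor_sum_def by (rule sum_nonneg) auto

lemma coprime_divisor_sum_le:
  assumes "a > 0"
  shows "coprime_divisor_sum Q a \<le> real_of_int a"
proof -
  have sub: "{d. d > 0 \<and> d dvd a \<and> coprime d Q} \<subseteq> {1..a}" using assms zdvd_imp_le by auto
  have "coprime_divisor_sum Q a \<le> (\<Sum>d | d > 0 \<and> d dvd a \<and> coprime d Q. 1)"
    unfolding coprime_divisor_sum_def by (rule sum_mono) auto
  also have "\<dots> \<le> real (card {1..a})" using sub by (simp add: card_mono del: card_atLeastAtMost_int)
  finally show ?thesis using assms by simp
qed

text \<open>
  \<open>rad\<close> and \<open>unit\<close> make the form equidistributed modulo powers of the primes dividing \<open>Q\<close>; the remaining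
  primes exceed \<open>P\<close>, so that their contribution to the second moment is a factor close to 1.
\<close>

locale shifted_form =
  fixes k c Q x0 y0 z0 P :: int
  assumes k: "k \<ge> 1" and c: "c \<ge> 1" and Q: "Q > 0"
    and x0: "0 \<le> x0" "x0 < Q" and y0: "0 \<le> y0" "y0 < Q" and z0: "0 \<le> z0" "z0 < Q"
    and rad: "\<And>p. prime p \<Longrightarrow> p dvd 2 * k * (4 * c - 1) \<Longrightarrow> p dvd Q"
    and unit: "coprime (2 * y0 + z0) Q"
    and P: "P \<ge> 1" "\<And>d. d > 1 \<Longrightarrow> coprime d Q \<Longrightarrow> d > P"
begin

definition g :: "int \<times> int \<Rightarrow> int" where
  "g = (\<lambda>(j, l). bqf c (y0 + Q * j) (z0 + Q * l))"

definition D :: "(int \<times> int) \<times> (int \<times> int) \<Rightarrow> int" where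
  "D = (\<lambda>(w, w'). g w - g w')"

definition F :: "int \<times> (int \<times> int) \<Rightarrow> int" where
  "F = (\<lambda>(i, w). k * (x0 + Q * i)^2 + g w)"

text \<open>The summand \<open>9 + 3 * c\<close> bounds the growth of \<open>g\<close> under a shift
  by less than a period, see \<open>g_increment\<close>; one further \<open>Q * Y\<close> absorbs
  the last \<open>a\<close> in the upper bound on \<open>D\<close> in \<open>G\<close>.\<close>

definition C1 :: int where "C1 = Q * (10 + 3 * c)"

definition W :: "int \<Rightarrow> int \<Rightarrow> (int \<times> int) set" where
  "W Y Z = {Y..<2 * Y} \<times> {0..<Z}"

definition Box :: "int \<Rightarrow> int \<Rightarrow> int \<Rightarrow> (int \<times> int) set" where
  "Box Y Z T = {Y..<2 * Y + T} \<times> {0..<Z + T}"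

text \<open>
  Contains the pairs \<open>(w, w')\<close> with \<open>F (i, w) = F (i + a, w')\<close>, \<open>R \<le> i\<close>: the divisibility and the bounds
  express that the difference quotient determines such an \<open>i\<close>.
\<close>

definition G :: "int \<Rightarrow> int \<Rightarrow> int \<Rightarrow> int \<Rightarrow> int \<Rightarrow> ((int \<times> int) \<times> (int \<times> int)) set" where
  "G R J Y Z a = {\<tau> \<in> W Y Z \<times> W Y Z. Q * (2 * k * Q * a) dvd D \<tau> - k * Q * a * (2 * x0 + Q * a) \<and>
     2 * k * Q^2 * a * R \<le> D \<tau> \<and> D \<tau> \<le> k * Q^2 * a * (2 * (R + J) + a)}"

text \<open>In a collision, \<open>D / a\<close> is about \<open>2 * k * Q^2 * i\<close>. With
  \<open>hi\<close> this gives its range for \<open>i\<close> between \<open>R\<close> and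
  \<open>R + J\<close>, widened by the error from shifting both points by less than a
  period.\<close>

definition lo :: "int \<Rightarrow> int \<Rightarrow> int" where "lo R Y = 2 * k * Q^2 * (R - C1 * Y)"
definition hi :: "int \<Rightarrow> int \<Rightarrow> int \<Rightarrow> int" where "hi R J Y = 2 * k * Q^2 * (R + J + C1 * Y)"

lemma finite_W: "finite (W Y Z)" by (simp add: W_def)
lemma finite_Box: "finite (Box Y Z T)" by (simp add: Box_def)
lemma finite_G: "finite (G R J Y Z a)"
  by (rule finite_subset[of _ "W Y Z \<times> W Y Z"]) (auto simp: G_def finite_W)

lemma g_increment:
  assumes "(j, l) \<in> W Y Z" "Z \<le> Y" "n \<le> Y" "0 \<le> h" "h < n" "0 \<le> h'" "h' < n"
  shows "0 \<le> g (j + h, l + h') - g (j, l)" "g (j + h, l + h') - g (j, l) \<le> Q * n * (Q * Y * (9 + 3 * c))"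
proof -
  have jl: "Y \<le> j" "j < 2 * Y" "0 \<le> l" "l < Z" using assms by (auto simp: W_def)
  have y: "0 \<le> y0 + Q * j" "y0 + Q * j \<le> 2 * (Q * Y)"
  proof -
    have "Q * (j + 1) \<le> Q * (2 * Y)" using jl Q by (intro mult_left_mono) auto
    then show "y0 + Q * j \<le> 2 * (Q * Y)" using y0 by (simp add: algebra_simps)
    show "0 \<le> y0 + Q * j" using y0 Q jl by simp
  qed
  have z: "0 \<le> z0 + Q * l" "z0 + Q * l \<le> Q * Y"
  proof -
    have "Q * (l + 1) \<le> Q * Y" using jl Q assms by (intro mult_left_mono) auto
    then show "z0 + Q * l \<le> Q * Y" using z0 by (simp add: algebra_simps)
    show "0 \<le> z0 + Q * l" using z0 Q jl by simp
  qed
  have m: "Q * h \<le> Q * n" "Q * h' \<le> Q * n" "Q * n \<le> Q * Y" "0 \<le> Q * h" "0 \<le> Q * h'"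
    using assms Q by (auto intro: mult_left_mono)
  have eq: "g (j + h, l + h') - g (j, l) = bqf c ((y0 + Q * j) + Q * h) ((z0 + Q * l) + Q * h') - bqf c (y0 + Q * j) (z0 + Q * l)"
    by (simp add: g_def algebra_simps)
  have inc: "0 \<le> g (j + h, l + h') - g (j, l)"
    "g (j + h, l + h') - g (j, l) \<le> Q * n * (3 * (y0 + Q * j) + (1 + 2 * c) * (z0 + Q * l) + (2 + c) * (Q * n))"
    unfolding eq using bqf_increment_bounds[OF y(1) z(1) m(4) m(1) m(5) m(2)] c by auto
  show "0 \<le> g (j + h, l + h') - g (j, l)" by fact
  have "3 * (y0 + Q * j) + (1 + 2 * c) * (z0 + Q * l) + (2 + c) * (Q * n)
      \<le> 3 * (2 * (Q * Y)) + (1 + 2 * c) * (Q * Y) + (2 + c) * (Q * Y)"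
    using y z m c assms Q by (intro add_mono mult_left_mono) auto
  also have "\<dots> = Q * Y * (9 + 3 * c)" by (simp add: algebra_simps)
  finally have "Q * n * (3 * (y0 + Q * j) + (1 + 2 * c) * (z0 + Q * l) + (2 + c) * (Q * n)) \<le> Q * n * (Q * Y * (9 + 3 * c))"
    using Q assms by (intro mult_left_mono) auto
  with inc show "g (j + h, l + h') - g (j, l) \<le> Q * n * (Q * Y * (9 + 3 * c))" by linarith
qed

text \<open>Shifts by less than the period \<open>2 * k * Q * a\<close> destroy the congruence in
  \<open>G\<close> but keep the size condition up to the margin in \<open>lo\<close> and
  \<open>hi\<close>. So \<open>G\<close> is bounded by the proportion of admissible residues times
  the number of pairs of the right size in the slightly larger box.\<close>

lemma card_G_le:
  assumes a: "a \<ge> 1" "a \<le> Y" and n: "2 * k * Q * a \<le> T" "T \<le> Y" and Z: "0 \<le> Z" "Z \<le> Y"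
  shows "real (card (G R J Y Z a)) \<le> coprime_divisor_sum Q a / (2 * k * Q * a) *
    real (card {\<tau> \<in> Box Y Z T \<times> Box Y Z T. lo R Y * a \<le> D \<tau> \<and> D \<tau> \<le> hi R J Y * a})"
proof -
  define n where "n = 2 * k * Q * a"
  define t where "t = k * Q * a * (2 * x0 + Q * a)"
  let ?S = "{\<tau> \<in> Box Y Z T \<times> Box Y Z T. lo R Y * a \<le> D \<tau> \<and> D \<tau> \<le> hi R J Y * a}"
  let ?K = "{((j, l), (j', l')) \<in> ({0..<n} \<times> {0..<n}) \<times> ({0..<n} \<times> {0..<n}).
      Q * n dvd bqf c (y0 + Q * j) (z0 + Q * l) - bqf c (y0 + Q * j') (z0 + Q * l') - t}"
  have n0: "n > 0" using k Q a by (simp add: n_def)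
  have nY: "n \<le> T" "n \<le> Y" using assms by (auto simp: n_def)
  have K: "real (card ?K) \<le> real_of_int n ^ 3 * coprime_divisor_sum Q a"
    unfolding n_def coprime_divisor_sum_def
    by (rule card_bqf_cong_period_le) (use a k Q rad unit in \<open>auto simp: t_def\<close>)
  have "card (G R J Y Z a) * nat n ^ 4 \<le> card ?K * card ?S"
  proof (rule card_mult_period_le)
    fix j l j' l' assume \<tau>: "((j, l), (j', l')) \<in> G R J Y Z a"
    then have w: "(j, l) \<in> W Y Z" "(j', l') \<in> W Y Z" by (auto simp: G_def)
    show "((j mod n, l mod n), (j' mod n, l' mod n)) \<in> ?K"
    proof -
      have "Q * n dvd g (j, l) - g (j', l') - t" using \<tau> by (simp add: G_def n_def t_def D_def)
      moreover have "[bqf c (y0 + Q * (j mod n)) (z0 + Q * (l mod n)) - bqf c (y0 + Q * (j' mod n)) (z0 + Q * (l' mod n)) - t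
          = g (j, l) - g (j', l') - t] (mod (Q * n))"
        unfolding g_def by (simp only: prod.case) (intro cong_diff bqf_residue_cong cong_refl)
      ultimately have "Q * n dvd bqf c (y0 + Q * (j mod n)) (z0 + Q * (l mod n)) - bqf c (y0 + Q * (j' mod n)) (z0 + Q * (l' mod n)) - t"
        by (metis cong_dvd_iff)
      then show ?thesis using n0 by simp
    qed
    fix h1 h2 h3 h4 assume h: "h1 \<in> {0..<n}" "h2 \<in> {0..<n}" "h3 \<in> {0..<n}" "h4 \<in> {0..<n}"
    have b1: "0 \<le> g (j + h1, l + h2) - g (j, l)" "g (j + h1, l + h2) - g (j, l) \<le> Q * n * (Q * Y * (9 + 3 * c))"
      and b2: "0 \<le> g (j' + h3, l' + h4) - g (j', l')" "g (j' + h3, l' + h4) - g (j', l') \<le> Q * n * (Q * Y * (9 + 3 * c))"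
      using g_increment[OF w(1) Z(2) nY(2), of h1 h2] g_increment[OF w(2) Z(2) nY(2), of h3 h4] h by auto
    let ?d = "D ((j + h1, l + h2), (j' + h3, l' + h4))"
    define e where "e = Q * n * (Q * Y * (9 + 3 * c))"
    have dd: "D ((j, l), (j', l')) - e \<le> ?d" "?d \<le> D ((j, l), (j', l')) + e"
      using b1 b2 by (simp_all add: D_def e_def)
    have w2: "2 * k * Q^2 * a * R \<le> D ((j, l), (j', l'))" "D ((j, l), (j', l')) \<le> k * Q^2 * a * (2 * (R + J) + a)"
      using \<tau> by (auto simp: G_def)
    have e: "e = 2 * k * Q^2 * a * (Q * Y * (9 + 3 * c))"
      by (simp add: e_def n_def power2_eq_square algebra_simps)
    have Qa: "Q * Y * (9 + 3 * c) + a \<le> C1 * Y" "Q * Y * (9 + 3 * c) \<le> C1 * Y"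
    proof -
      have "a \<le> Q * Y" using a Q by (smt (verit) mult_le_cancel_right1)
      moreover have "C1 * Y = Q * Y * (9 + 3 * c) + Q * Y" by (simp add: C1_def algebra_simps)
      ultimately show "Q * Y * (9 + 3 * c) + a \<le> C1 * Y" "Q * Y * (9 + 3 * c) \<le> C1 * Y" using a by auto
    qed
    have pos: "0 \<le> 2 * k * Q^2 * a" using k a by simp
    have "lo R Y * a = 2 * k * Q^2 * a * R - 2 * k * Q^2 * a * (C1 * Y)" by (simp add: lo_def algebra_simps)
    also have "\<dots> \<le> 2 * k * Q^2 * a * R - e" unfolding e using mult_left_mono[OF Qa(2) pos] by simp
    finally have 1: "lo R Y * a \<le> ?d" using dd w2 by linarith
    have "k * Q^2 * a * (2 * (R + J) + a) + e \<le> 2 * k * Q^2 * a * (R + J) + 2 * k * Q^2 * a * (Q * Y * (9 + 3 * c) + a)"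
      unfolding e using k a by (simp add: algebra_simps)
    also have "\<dots> \<le> 2 * k * Q^2 * a * (R + J) + 2 * k * Q^2 * a * (C1 * Y)"
      using mult_left_mono[OF Qa(1) pos] by simp
    also have "\<dots> = hi R J Y * a" by (simp add: hi_def algebra_simps)
    finally have 2: "?d \<le> hi R J Y * a" using dd w2 by linarith
    show "((j + h1, l + h2), (j' + h3, l' + h4)) \<in> ?S"
      using 1 2 h w nY by (auto simp: Box_def W_def)
  next
    show "finite ?S" by (rule finite_subset[of _ "Box Y Z T \<times> Box Y Z T"]) (auto simp: finite_Box)
    show "finite ?K" by (rule finite_subset[of _ "({0..<n} \<times> {0..<n}) \<times> ({0..<n} \<times> {0..<n})"]) auto
  qed (fact n0)
  then have "real (card (G R J Y Z a) * nat n ^ 4) \<le> real (card ?K * card ?S)" by (simp only: of_nat_le_iff)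
  then have "real (card (G R J Y Z a)) * real_of_int n ^ 4 \<le> real (card ?K) * real (card ?S)"
    using n0 by simp
  also have "\<dots> \<le> (real_of_int n ^ 3 * coprime_divisor_sum Q a) * real (card ?S)"
    using K by (intro mult_right_mono) auto
  finally have "real_of_int n ^ 3 * (real (card (G R J Y Z a)) * real_of_int n) \<le> real_of_int n ^ 3 * (coprime_divisor_sum Q a * real (card ?S))"
    by (simp add: power4_eq_xxxx power3_eq_cube algebra_simps)
  then have "real (card (G R J Y Z a)) * real_of_int n \<le> coprime_divisor_sum Q a * real (card ?S)"
    using n0 by simp
  then have "real (card (G R J Y Z a)) \<le> coprime_divisor_sum Q a * real (card ?S) / real_of_int n"
    using n0 by (simp add: pos_le_divide_eq)
  then show ?thesis by (simp add: n_def)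
qed

end

section \<open>From collisions to a sum over pairs of points\<close>

context shifted_form
begin

definition Idx :: "int \<Rightarrow> int \<Rightarrow> int \<Rightarrow> int \<Rightarrow> (int \<times> (int \<times> int)) set" where
  "Idx R J Y Z = {R..<R + J} \<times> W Y Z"

lemma g_bounds:
  assumes "w \<in> W Y Z" "Z \<le> Y"
  shows "0 \<le> g w" "g w \<le> Q^2 * ((6 + c) * Y^2)"
proof -
  obtain j l where w: "w = (j, l)" by (metis prod.exhaust)
  have jl: "Y \<le> j" "j < 2 * Y" "0 \<le> l" "l < Z" using assms by (auto simp: W_def w)
  have Y: "Y \<ge> 0" using jl by simp
  have y: "0 \<le> y0 + Q * j" "y0 + Q * j \<le> 2 * (Q * Y)"
  proof -
    have "Q * (j + 1) \<le> Q * (2 * Y)" using jl Q by (intro mult_left_mono) auto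
    then show "y0 + Q * j \<le> 2 * (Q * Y)" using y0 by (simp add: algebra_simps)
    show "0 \<le> y0 + Q * j" using y0 Q jl by simp
  qed
  have z: "0 \<le> z0 + Q * l" "z0 + Q * l \<le> Q * Y"
  proof -
    have "Q * (l + 1) \<le> Q * Y" using jl Q assms by (intro mult_left_mono) auto
    then show "z0 + Q * l \<le> Q * Y" using z0 by (simp add: algebra_simps)
    show "0 \<le> z0 + Q * l" using z0 Q jl by simp
  qed
  show "0 \<le> g w" using y z c by (simp add: g_def w bqf_def)
  have "g w \<le> (2 * (Q * Y)) * (2 * (Q * Y)) + (2 * (Q * Y)) * (Q * Y) + c * (Q * Y) * (Q * Y)"
    unfolding g_def w bqf_def prod.case
    using y z c Q Y by (intro add_mono mult_mono) auto
  also have "\<dots> = Q^2 * ((6 + c) * Y^2)" by (simp add: power2_eq_square algebra_simps)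
  finally show "g w \<le> Q^2 * ((6 + c) * Y^2)" .
qed

lemma F_mod: "[F (i, w) = k * x0^2 + bqf c y0 z0] (mod Q)"
proof -
  obtain j l where w: "w = (j, l)" by (metis prod.exhaust)
  have *: "[u + Q * v = u] (mod Q)" for u v by (simp add: cong_iff_dvd_diff)
  show ?thesis unfolding F_def g_def w prod.case
    by (intro cong_add cong_mult cong_pow cong_refl bqf_mod *)
qed

text \<open>Equality of the values makes \<open>D\<close> equal to \<open>k\<close> times a
  difference of two squares, which contains the factor \<open>a = i' - i\<close>. Since
  \<open>D\<close> is at most of order Q^2 Y^2 while the squared numbers are at least
  \<open>Q * R\<close>, the difference \<open>a\<close> is O(Y^2 / R).\<close>

lemma collision_in_G:
  assumes R: "R \<ge> 1" and Z: "Z \<le> Y" and i: "i \<in> {R..<R + J}" "i' \<in> {R..<R + J}" "i < i'"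
    and w: "w \<in> W Y Z" "w' \<in> W Y Z" and eq: "F (i, w) = F (i', w')"
  shows "(w, w') \<in> G R J Y Z (i' - i)" "i' - i \<in> {1..((6 + c) * Y^2) div R}"
    "D (w, w') = k * Q * (i' - i) * (2 * (x0 + Q * i) + Q * (i' - i))"
proof -
  define a where "a = i' - i"
  have a: "a \<ge> 1" "i' = i + a" using i by (auto simp: a_def)
  show DD: "D (w, w') = k * Q * (i' - i) * (2 * (x0 + Q * i) + Q * (i' - i))"
    using eq by (simp add: D_def F_def power2_eq_square algebra_simps)
  have D: "D (w, w') = k * Q * a * (2 * (x0 + Q * i) + Q * a)" using DD by (simp add: a_def)
  have d: "Q * (2 * k * Q * a) dvd D (w, w') - k * Q * a * (2 * x0 + Q * a)"
    unfolding D by (rule dvdI[of _ _ i]) (simp add: algebra_simps)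
  have kQa: "0 \<le> k * Q * a" using k Q a by simp
  have "2 * (Q * R) + 0 \<le> 2 * (x0 + Q * i) + Q * a"
    using i x0 Q a by (intro add_mono mult_left_mono) (auto simp: add_increasing)
  from mult_left_mono[OF this kQa] have 1: "2 * k * Q^2 * a * R \<le> D (w, w')"
    unfolding D by (simp add: power2_eq_square algebra_simps)
  have "x0 + Q * i \<le> Q * (R + J)"
  proof -
    have "Q * (i + 1) \<le> Q * (R + J)" using i Q by (intro mult_left_mono) auto
    then show ?thesis using x0 by (simp add: algebra_simps)
  qed
  then have "2 * (x0 + Q * i) + Q * a \<le> Q * (2 * (R + J) + a)" by (simp add: algebra_simps)
  from mult_left_mono[OF this kQa] have 2: "D (w, w') \<le> k * Q^2 * a * (2 * (R + J) + a)"
    unfolding D by (simp add: power2_eq_square algebra_simps)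
  show "(w, w') \<in> G R J Y Z (i' - i)"
    using d 1 2 w unfolding G_def a_def by simp
  have "Q^2 * (a * R) \<le> 2 * k * Q^2 * a * R"
  proof -
    have "(Q^2 * (a * R)) * 1 \<le> (Q^2 * (a * R)) * (2 * k)" using k a R by (intro mult_left_mono) auto
    then show ?thesis by (simp add: algebra_simps)
  qed
  also note 1
  also have "D (w, w') \<le> Q^2 * ((6 + c) * Y^2)"
    using g_bounds[OF w(1) Z] g_bounds[OF w(2) Z] by (simp add: D_def)
  finally have "a * R \<le> (6 + c) * Y^2" using Q by simp
  then have "a \<le> ((6 + c) * Y^2) div R" using zdiv_mono1[of "a * R" "(6 + c) * Y^2" R] R by simp
  then show "i' - i \<in> {1..((6 + c) * Y^2) div R}" using a(1) unfolding a_def by simp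
qed

text \<open>Collisions with equal \<open>i\<close> are collisions of \<open>g\<close>. The others
  form two symmetric halves, and in each of them \<open>a\<close> and \<open>(w, w')\<close>
  determine \<open>i\<close>.\<close>

lemma card_collisions_le:
  assumes R: "R \<ge> 1" and Z: "Z \<le> Y" and J: "J \<ge> 0"
  shows "card {(u, u') \<in> Idx R J Y Z \<times> Idx R J Y Z. F u = F u'}
    \<le> nat J * card {(w, w') \<in> W Y Z \<times> W Y Z. g w = g w'} + 2 * (\<Sum>a\<in>{1..((6 + c) * Y^2) div R}. card (G R J Y Z a))"
proof -
  let ?A = "{1..((6 + c) * Y^2) div R}"
  let ?E = "{(u, u') \<in> Idx R J Y Z \<times> Idx R J Y Z. F u = F u'}"
  let ?Eq = "{(u, u') \<in> ?E. fst u = fst u'}"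
  let ?E1 = "{(u, u') \<in> ?E. fst u < fst u'}"
  let ?E2 = "{(u, u') \<in> ?E. fst u' < fst u}"
  have fin: "finite (Idx R J Y Z \<times> Idx R J Y Z)" by (simp add: Idx_def finite_W)
  have fE: "finite ?Eq" "finite ?E1" "finite ?E2" by (rule finite_subset[OF _ fin]; auto)+
  have "?E \<subseteq> ?Eq \<union> (?E1 \<union> ?E2)" by auto
  then have "card ?E \<le> card (?Eq \<union> (?E1 \<union> ?E2))" using fE by (intro card_mono) auto
  also have "\<dots> \<le> card ?Eq + (card ?E1 + card ?E2)"
    by (meson add_left_mono card_Un_le order_trans)
  finally have E: "card ?E \<le> card ?Eq + (card ?E1 + card ?E2)" .
  have "card ?E2 \<le> card ?E1"
    by (rule card_inj_on_le[where f = "\<lambda>(u, u'). (u', u)"]) (use fE in \<open>auto simp: inj_on_def\<close>)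
  moreover have "card ?E1 \<le> card (Sigma ?A (G R J Y Z))"
  proof (rule card_inj_on_le[where f = "\<lambda>((i, w), (i', w')). (i' - i, (w, w'))"])
    show "finite (Sigma ?A (G R J Y Z))" by (rule finite_SigmaI) (auto simp: finite_G)
    show "(\<lambda>((i, w), (i', w')). (i' - i, (w, w'))) ` ?E1 \<subseteq> Sigma ?A (G R J Y Z)"
    proof (rule image_subsetI)
      fix x assume x: "x \<in> ?E1"
      obtain i w i' w' where xe: "x = ((i, w), (i', w'))" by (metis prod.exhaust)
      have "i \<in> {R..<R + J}" "i' \<in> {R..<R + J}" "i < i'" "w \<in> W Y Z" "w' \<in> W Y Z" "F (i, w) = F (i', w')"
        using x by (auto simp: xe Idx_def)
      from collision_in_G(1,2)[OF R Z this] have "(w, w') \<in> G R J Y Z (i' - i)" "i' - i \<in> ?A" .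
      then show "(\<lambda>((i, w), (i', w')). (i' - i, (w, w'))) x \<in> Sigma ?A (G R J Y Z)" by (simp add: xe)
    qed
    show "inj_on (\<lambda>((i, w), (i', w')). (i' - i, (w, w'))) ?E1"
    proof (rule inj_onI)
      fix x x' assume xx: "x \<in> ?E1" "x' \<in> ?E1"
        "(\<lambda>((i, w), (i', w')). (i' - i, (w, w'))) x = (\<lambda>((i, w), (i', w')). (i' - i, (w, w'))) x'"
      obtain i w i' w' where xe: "x = ((i, w), (i', w'))" by (metis prod.exhaust)
      obtain m v m' v' where xe': "x' = ((m, v), (m', v'))" by (metis prod.exhaust)
      have vw: "v = w" "v' = w'" "m' - m = i' - i" using xx(3) by (simp_all add: xe xe')
      have e1: "D (w, w') = k * Q * (i' - i) * (2 * (x0 + Q * i) + Q * (i' - i))"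
        by (rule collision_in_G(3)[OF R Z]) (use xx(1) in \<open>auto simp: xe Idx_def\<close>)
      have e2: "D (v, v') = k * Q * (m' - m) * (2 * (x0 + Q * m) + Q * (m' - m))"
        by (rule collision_in_G(3)[OF R Z]) (use xx(2) in \<open>auto simp: xe' Idx_def\<close>)
      have "(k * Q * (i' - i)) * (2 * (x0 + Q * i) + Q * (i' - i)) = (k * Q * (i' - i)) * (2 * (x0 + Q * m) + Q * (i' - i))"
        by (rule trans[OF e1[symmetric] e2[unfolded vw]])
      moreover have "i < i'" using xx(1) by (auto simp: xe)
      then have "k * Q * (i' - i) \<noteq> 0" using k Q by auto
      ultimately have "2 * (x0 + Q * i) + Q * (i' - i) = 2 * (x0 + Q * m) + Q * (i' - i)"
        by (metis mult_cancel_left)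
      then have "i = m" using Q by simp
      then show "x = x'" using vw by (simp add: xe xe')
    qed
  qed
  moreover have "card (Sigma ?A (G R J Y Z)) = (\<Sum>a\<in>?A. card (G R J Y Z a))"
    by (rule card_SigmaI) (auto simp: finite_G)
  moreover have "card ?Eq \<le> card ({R..<R + J} \<times> {(w, w') \<in> W Y Z \<times> W Y Z. g w = g w'})"
  proof (rule card_inj_on_le[where f = "\<lambda>((i, w), (i', w')). (i, (w, w'))"])
    show "inj_on (\<lambda>((i, w), (i', w')). (i, (w, w'))) ?Eq" by (auto simp: inj_on_def)
    show "(\<lambda>((i, w), (i', w')). (i, (w, w'))) ` ?Eq \<subseteq> {R..<R + J} \<times> {(w, w') \<in> W Y Z \<times> W Y Z. g w = g w'}"
      by (auto simp: Idx_def F_def)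
    show "finite ({R..<R + J} \<times> {(w, w') \<in> W Y Z \<times> W Y Z. g w = g w'})"
      by (rule finite_cartesian_product[OF _ finite_subset[of _ "W Y Z \<times> W Y Z"]]) (auto simp: finite_W)
  qed
  ultimately show ?thesis using E by (simp add: card_cartesian_product)
qed

text \<open>The total weight of the differences \<open>a\<close> for which a pair with
  \<open>D = d\<close> has the right size. Summing over \<open>a\<close> first reduces the collision
  count to pointwise bounds on this function.\<close>

definition \<Phi> :: "int \<Rightarrow> int \<Rightarrow> int \<Rightarrow> int \<Rightarrow> int \<Rightarrow> real" where
  "\<Phi> R J Y A d = (\<Sum>a | a \<in> {1..A} \<and> lo R Y * a \<le> d \<and> d \<le> hi R J Y * a. coprime_divisor_sum Q a / a)"

lemma sum_card_G_le:
  assumes A: "0 \<le> A" "A \<le> Y" and T: "2 * k * Q * A \<le> T" "T \<le> Y" and Z: "0 \<le> Z" "Z \<le> Y"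
  shows "(\<Sum>a\<in>{1..A}. real (card (G R J Y Z a))) \<le> (\<Sum>\<tau>\<in>Box Y Z T \<times> Box Y Z T. \<Phi> R J Y A (D \<tau>)) / (2 * k * Q)"
proof -
  let ?B = "Box Y Z T \<times> Box Y Z T"
  let ?c = "\<lambda>a \<tau>. lo R Y * a \<le> D \<tau> \<and> D \<tau> \<le> hi R J Y * a"
  have fB: "finite ?B" by (simp add: finite_Box)
  have "(\<Sum>a\<in>{1..A}. real (card (G R J Y Z a))) \<le> (\<Sum>a\<in>{1..A}. \<Sum>\<tau>\<in>?B. if ?c a \<tau> then coprime_divisor_sum Q a / a / (2 * k * Q) else 0)"
  proof (rule sum_mono)
    fix a assume a: "a \<in> {1..A}"
    have "2 * k * Q * a \<le> 2 * k * Q * A" using a k Q by (intro mult_left_mono) auto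
    then have "real (card (G R J Y Z a)) \<le> coprime_divisor_sum Q a / (2 * k * Q * a) * real (card {\<tau> \<in> ?B. ?c a \<tau>})"
      using a A T Z by (intro card_G_le) auto
    also have "real (card {\<tau> \<in> ?B. ?c a \<tau>}) = (\<Sum>\<tau>\<in>?B. if ?c a \<tau> then 1 else 0)"
      using fB by (simp add: sum.If_cases Int_def)
    also have "coprime_divisor_sum Q a / (2 * k * Q * a) * (\<Sum>\<tau>\<in>?B. if ?c a \<tau> then 1 else 0) =
        (\<Sum>\<tau>\<in>?B. if ?c a \<tau> then coprime_divisor_sum Q a / a / (2 * k * Q) else 0)"
      unfolding sum_distrib_left by (rule sum.cong) (auto simp: field_simps)
    finally show "real (card (G R J Y Z a)) \<le> (\<Sum>\<tau>\<in>?B. if ?c a \<tau> then coprime_divisor_sum Q a / a / (2 * k * Q) else 0)" .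
  qed
  also have "\<dots> = (\<Sum>\<tau>\<in>?B. \<Sum>a\<in>{1..A}. if ?c a \<tau> then coprime_divisor_sum Q a / a / (2 * k * Q) else 0)"
    by (rule sum.swap)
  also have "\<dots> = (\<Sum>\<tau>\<in>?B. \<Phi> R J Y A (D \<tau>) / (2 * k * Q))"
  proof (rule sum.cong)
    fix \<tau>
    have "(\<Sum>a\<in>{1..A}. if ?c a \<tau> then coprime_divisor_sum Q a / a / (2 * k * Q) else 0) = (\<Sum>a | a \<in> {1..A} \<and> ?c a \<tau>. coprime_divisor_sum Q a / a / (2 * k * Q))"
      by (subst sum.inter_filter[symmetric]) auto
    then show "(\<Sum>a\<in>{1..A}. if ?c a \<tau> then coprime_divisor_sum Q a / a / (2 * k * Q) else 0) = \<Phi> R J Y A (D \<tau>) / (2 * k * Q)"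
      by (simp add: \<Phi>_def sum_divide_distrib)
  qed simp
  finally show ?thesis by (simp add: sum_divide_distrib)
qed

lemma \<Phi>_nonpos:
  assumes "lo R Y > 0" "d \<le> 0"
  shows "\<Phi> R J Y A d = 0"
proof -
  have "lo R Y * a > d" if "a \<ge> 1" for a using assms that by (smt (verit) mult_pos_pos)
  then have eq: "{a. a \<in> {1..A} \<and> lo R Y * a \<le> d \<and> d \<le> hi R J Y * a} = {}" by (auto simp: not_le)
  show ?thesis unfolding \<Phi>_def by (simp only: eq sum.empty)
qed

text \<open>The admissible \<open>a\<close> lie between \<open>d / hi\<close> and
  \<open>d / lo\<close>. If \<open>d\<close> is large, this interval begins above
  \<open>\<alpha>\<close> and the divisor weights average out; if not, at most
  \<open>2 * \<alpha>\<close> values of \<open>a\<close> remain, each of weight at most 1.\<close>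

lemma \<Phi>_le:
  fixes \<alpha> :: real
  assumes lo: "lo R Y > 0" "lo R Y \<le> hi R J Y" "hi R J Y \<le> 2 * lo R Y" and d: "d > 0" and \<alpha>: "\<alpha> > 0"
  shows "real_of_int d \<ge> \<alpha> * hi R J Y \<Longrightarrow>
      \<Phi> R J Y A d \<le> (real_of_int (hi R J Y) / lo R Y - 1) * (1 + 1 / P) + 3 / sqrt \<alpha>"
    and "real_of_int d < \<alpha> * hi R J Y \<Longrightarrow> \<Phi> R J Y A d \<le> 2 * \<alpha>"
proof -
  let ?S = "{a. a \<in> {1..A} \<and> lo R Y * a \<le> d \<and> d \<le> hi R J Y * a}"
  define l h where "l = real_of_int (lo R Y)" and "h = real_of_int (hi R J Y)"
  have lh: "l > 0" "l \<le> h" "h \<le> 2 * l" using lo by (simp_all add: l_def h_def)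
  let ?I = "{a::int. d / h \<le> a \<and> a \<le> d / l}"
  have iv: "?I = {\<lceil>d / h\<rceil>..\<lfloor>d / l\<rfloor>}" by (auto simp: ceiling_le_iff le_floor_iff)
  have S: "?S \<subseteq> ?I"
  proof (clarsimp, safe)
    fix a assume "lo R Y * a \<le> d" "d \<le> hi R J Y * a"
    then have "l * a \<le> d" "d \<le> h * a" unfolding l_def h_def by (metis of_int_le_iff of_int_mult)+
    then show "d / h \<le> a" "a \<le> d / l" using lh by (auto simp: field_simps)
  qed
  {
    assume "real_of_int d \<ge> \<alpha> * hi R J Y"
    then have al: "\<alpha> \<le> d / h" using lh by (simp add: pos_le_divide_eq h_def)
    have I0: "a > 0" if "a \<in> ?I" for a
    proof -
      have "0 < d / h" using d lh by simp
      also have "d / h \<le> a" using that by simp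
      finally show ?thesis by simp
    qed
    have "\<Phi> R J Y A d \<le> (\<Sum>a\<in>?I. coprime_divisor_sum Q a / a)"
      unfolding \<Phi>_def
    proof (rule sum_mono2)
      show "finite ?I" unfolding iv by simp
      fix a assume "a \<in> ?I - ?S"
      then show "0 \<le> coprime_divisor_sum Q a / a" using I0[of a] coprime_divisor_sum_nonneg by simp
    qed (fact S)
    also have "\<dots> \<le> (d / l / (d / h) - 1) * (1 + 1 / P) + 3 / sqrt (d / h)"
      unfolding coprime_divisor_sum_def
    proof (rule sum_coprime_divisor_weights_le[OF _ _ _ P])
      show "0 < d / h" "d / h \<le> d / l" "d / l \<le> 2 * (d / h)" using lh d by (auto simp: field_simps)
    qed auto
    also have "d / l / (d / h) = h / l" using d lh by (simp add: field_simps)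
    also have "3 / sqrt (d / h) \<le> 3 / sqrt \<alpha>"
      using al \<alpha> by (intro divide_left_mono mult_pos_pos) auto
    finally show "\<Phi> R J Y A d \<le> (real_of_int (hi R J Y) / lo R Y - 1) * (1 + 1 / P) + 3 / sqrt \<alpha>"
      by (simp add: l_def h_def)
  }
  {
    assume "real_of_int d < \<alpha> * hi R J Y"
    then have "d / l \<le> 2 * \<alpha>"
    proof -
      have "d \<le> \<alpha> * h" using \<open>real_of_int d < \<alpha> * hi R J Y\<close> by (simp add: h_def)
      also have "\<dots> \<le> \<alpha> * (2 * l)" using lh \<alpha> by (intro mult_left_mono) auto
      finally show ?thesis using lh by (simp add: field_simps)
    qed
    then have S2: "?S \<subseteq> {1..\<lfloor>2 * \<alpha>\<rfloor>}" using S by (auto simp: le_floor_iff subset_iff intro: order_trans)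
    have "\<Phi> R J Y A d \<le> (\<Sum>a\<in>?S. 1)"
      unfolding \<Phi>_def using coprime_divisor_sum_le by (intro sum_mono) auto
    also have "\<dots> \<le> real (card {1..\<lfloor>2 * \<alpha>\<rfloor>})" using S2 by (simp add: card_mono del: card_atLeastAtMost_int)
    also have "\<dots> \<le> 2 * \<alpha>" using \<alpha> by (simp add: of_nat_nat)
    finally show "\<Phi> R J Y A d \<le> 2 * \<alpha>" .
  }
qed

text \<open>Only pairs with \<open>D > 0\<close> contribute, and exchanging the two points shows
  that they are at most half of all pairs. This half compensates the factor 2 in
  \<open>card_collisions_le\<close>, without which the moment would be twice too large.\<close>

lemma sum_\<Phi>_le:
  fixes \<alpha> :: real
  assumes lo: "lo R Y > 0" "lo R Y \<le> hi R J Y" "hi R J Y \<le> 2 * lo R Y" and \<alpha>: "\<alpha> > 0"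
  shows "(\<Sum>\<tau>\<in>Box Y Z T \<times> Box Y Z T. \<Phi> R J Y A (D \<tau>)) \<le>
    real (card (Box Y Z T))^2 / 2 * ((real_of_int (hi R J Y) / lo R Y - 1) * (1 + 1 / P) + 3 / sqrt \<alpha>)
    + 2 * \<alpha> * real (card {\<tau> \<in> Box Y Z T \<times> Box Y Z T. \<bar>real_of_int (D \<tau>)\<bar> \<le> \<alpha> * hi R J Y})"
proof -
  let ?B = "Box Y Z T \<times> Box Y Z T"
  let ?M = "(real_of_int (hi R J Y) / lo R Y - 1) * (1 + 1 / P) + 3 / sqrt \<alpha>"
  let ?pos = "{\<tau> \<in> ?B. D \<tau> > 0}" and ?near = "{\<tau> \<in> ?B. \<bar>real_of_int (D \<tau>)\<bar> \<le> \<alpha> * hi R J Y}"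
  have fB: "finite ?B" by (simp add: finite_Box)
  have M: "?M \<ge> 0" using lo P \<alpha> by (intro add_nonneg_nonneg mult_nonneg_nonneg) (auto simp: field_simps)
  have "(\<Sum>\<tau>\<in>?B. \<Phi> R J Y A (D \<tau>)) \<le> (\<Sum>\<tau>\<in>?B. (if D \<tau> > 0 then ?M else 0) + (if \<bar>real_of_int (D \<tau>)\<bar> \<le> \<alpha> * hi R J Y then 2 * \<alpha> else 0))"
  proof (rule sum_mono)
    fix \<tau> assume "\<tau> \<in> ?B"
    consider "D \<tau> \<le> 0" | "D \<tau> > 0" "real_of_int (D \<tau>) \<ge> \<alpha> * hi R J Y" | "D \<tau> > 0" "real_of_int (D \<tau>) < \<alpha> * hi R J Y" by linarith
    then show "\<Phi> R J Y A (D \<tau>) \<le> (if D \<tau> > 0 then ?M else 0) + (if \<bar>real_of_int (D \<tau>)\<bar> \<le> \<alpha> * hi R J Y then 2 * \<alpha> else 0)"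
    proof cases
      case 1
      then show ?thesis using \<Phi>_nonpos[OF lo(1), of "D \<tau>"] \<alpha> by simp
    next
      case 2
      then show ?thesis using \<Phi>_le(1)[OF lo 2(1) \<alpha> 2(2), of A] \<alpha> by simp
    next
      case 3
      then show ?thesis using \<Phi>_le(2)[OF lo 3(1) \<alpha> 3(2), of A] M by simp
    qed
  qed
  also have "\<dots> = real (card ?pos) * ?M + real (card ?near) * (2 * \<alpha>)"
    using fB by (simp add: sum.distrib sum.If_cases Int_def)
  finally have S: "(\<Sum>\<tau>\<in>?B. \<Phi> R J Y A (D \<tau>)) \<le> real (card ?pos) * ?M + real (card ?near) * (2 * \<alpha>)" .
  have "real (card ?pos) \<le> real (card (Box Y Z T))^2 / 2"
  proof -
    let ?neg = "{\<tau> \<in> ?B. D \<tau> < 0}"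
    have "card ?pos \<le> card ?neg"
      by (rule card_inj_on_le[where f = "\<lambda>(w, w'). (w', w)"]) (use fB in \<open>auto simp: inj_on_def D_def\<close>)
    moreover have "card ?pos + card ?neg \<le> card ?B"
    proof -
      have "card ?pos + card ?neg = card (?pos \<union> ?neg)" using fB by (subst card_Un_disjoint) auto
      also have "\<dots> \<le> card ?B" using fB by (intro card_mono) auto
      finally show ?thesis .
    qed
    ultimately have "2 * card ?pos \<le> card ?B" by linarith
    then have "real (2 * card ?pos) \<le> real (card ?B)" by (simp only: of_nat_le_iff)
    then show ?thesis by (simp add: card_cartesian_product power2_eq_square)
  qed
  from order_trans[OF S add_right_mono[OF mult_right_mono[OF this M]]] show ?thesis
    unfolding mult.commute[of "real (card ?near)" "2 * \<alpha>"] .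
qed

end

section \<open>Omitted values in a window\<close>

context shifted_form
begin

text \<open>The three contributions are the collisions with equal \<open>i\<close>, the main term,
  and the pairs with small \<open>D\<close>. The bound \<open>A\<close> for the differences is kept
  as a parameter so that \<open>T\<close>, the longest period of shifts, becomes a fixed multiple of
  it.\<close>

lemma card_collisions_explicit_le:
  fixes \<alpha> :: real
  assumes R: "R \<ge> 1" and J: "J \<ge> 0" and Y: "Y \<ge> 1" and Z: "0 \<le> Z" "Z \<le> Y"
    and A: "0 \<le> A" "((6 + c) * Y^2) div R \<le> A" "A \<le> Y" and T: "T = 2 * k * Q * A" "T \<le> Y"
    and lo: "lo R Y > 0" "lo R Y \<le> hi R J Y" "hi R J Y \<le> 2 * lo R Y" and \<alpha>: "\<alpha> > 0"
  shows "real (card {(u, u') \<in> Idx R J Y Z \<times> Idx R J Y Z. F u = F u'}) \<le>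
    real_of_int J * (real_of_int Y * Z + real_of_int Z^2 * (real_of_int c * Q^2 * Z^2 / Y + 1)) +
    1 / (k * Q) * (((real_of_int Y + T) * (real_of_int Z + T))^2 / 2 * ((real_of_int (hi R J Y) / lo R Y - 1) * (1 + 1 / P) + 3 / sqrt \<alpha>)
      + 2 * \<alpha> * ((real_of_int Y + T) * (real_of_int Z + T)^2 * ((\<alpha> * hi R J Y + real_of_int c * Q^2 * (real_of_int Z + T)^2) / Y + 1)))"
proof -
  have T0: "T \<ge> 0" using T k Q A by simp
  have e: "2 * (X / (2 * k * Q)) = 1 / (k * Q) * X" for X :: real by simp
  have "card {(w, w') \<in> W Y Z \<times> W Y Z. g w = g w'} =
    card {((j, l), (j', l')) \<in> ({Y..<2 * Y} \<times> {0..<Z}) \<times> ({Y..<2 * Y} \<times> {0..<Z}).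
      bqf c (y0 + Q * j) (z0 + Q * l) = bqf c (y0 + Q * j') (z0 + Q * l')}"
    by (rule arg_cong[where f = card]) (auto simp: W_def g_def)
  also have "real \<dots> \<le> real_of_int (2 * Y - Y) * Z + real_of_int Z^2 * (real_of_int c * Q^2 * Z^2 / Y + 1)"
    using card_bqf_equal_le[of Q y0 z0 c Y "2 * Y" Z] Q y0 z0 c Y Z by simp
  finally have C0: "real (card {(w, w') \<in> W Y Z \<times> W Y Z. g w = g w'}) \<le> real_of_int Y * Z + real_of_int Z^2 * (real_of_int c * Q^2 * Z^2 / Y + 1)"
    by simp
  have cB: "real (card (Box Y Z T)) = (real_of_int Y + T) * (real_of_int Z + T)"
    using Y Z T0 by (simp add: Box_def card_cartesian_product)
  have "card {\<tau> \<in> Box Y Z T \<times> Box Y Z T. \<bar>real_of_int (D \<tau>)\<bar> \<le> \<alpha> * hi R J Y} =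
    card {((j, l), (j', l')) \<in> ({Y..<2 * Y + T} \<times> {0..<Z + T}) \<times> ({Y..<2 * Y + T} \<times> {0..<Z + T}).
      \<bar>real_of_int (bqf c (y0 + Q * j) (z0 + Q * l) - bqf c (y0 + Q * j') (z0 + Q * l'))\<bar> \<le> \<alpha> * hi R J Y}"
    by (rule arg_cong[where f = card]) (auto simp: Box_def D_def g_def)
  also have "real \<dots> \<le> (real_of_int (2 * Y + T - Y) * real_of_int (Z + T)^2) * ((\<alpha> * hi R J Y + real_of_int c * Q^2 * real_of_int (Z + T)^2) / Y + 1)"
    using card_bqf_near_le[of Q y0 z0 c Y "2 * Y + T" "Z + T" "\<alpha> * hi R J Y"] Q y0 z0 c Y Z T0 lo \<alpha> by simp
  finally have near: "real (card {\<tau> \<in> Box Y Z T \<times> Box Y Z T. \<bar>real_of_int (D \<tau>)\<bar> \<le> \<alpha> * hi R J Y}) \<le>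
      (real_of_int Y + T) * (real_of_int Z + T)^2 * ((\<alpha> * hi R J Y + real_of_int c * Q^2 * (real_of_int Z + T)^2) / Y + 1)"
    by simp
  have "(\<Sum>a\<in>{1..((6 + c) * Y^2) div R}. card (G R J Y Z a)) \<le> (\<Sum>a\<in>{1..A}. card (G R J Y Z a))"
    using A by (intro sum_mono2) auto
  then have "real (\<Sum>a\<in>{1..((6 + c) * Y^2) div R}. card (G R J Y Z a)) \<le> (\<Sum>a\<in>{1..A}. real (card (G R J Y Z a)))"
    by (simp only: of_nat_sum[symmetric] of_nat_le_iff)
  also have "\<dots> \<le> (\<Sum>\<tau>\<in>Box Y Z T \<times> Box Y Z T. \<Phi> R J Y A (D \<tau>)) / (2 * k * Q)"
    by (rule sum_card_G_le) (use A T Z in auto)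
  also have "\<dots> \<le> (real (card (Box Y Z T))^2 / 2 * ((real_of_int (hi R J Y) / lo R Y - 1) * (1 + 1 / P) + 3 / sqrt \<alpha>)
      + 2 * \<alpha> * real (card {\<tau> \<in> Box Y Z T \<times> Box Y Z T. \<bar>real_of_int (D \<tau>)\<bar> \<le> \<alpha> * hi R J Y})) / (2 * k * Q)"
    using k Q by (intro divide_right_mono sum_\<Phi>_le lo \<alpha>) auto
  also have "\<dots> \<le> (((real_of_int Y + T) * (real_of_int Z + T))^2 / 2 * ((real_of_int (hi R J Y) / lo R Y - 1) * (1 + 1 / P) + 3 / sqrt \<alpha>)
      + 2 * \<alpha> * ((real_of_int Y + T) * (real_of_int Z + T)^2 * ((\<alpha> * hi R J Y + real_of_int c * Q^2 * (real_of_int Z + T)^2) / Y + 1))) / (2 * k * Q)"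
    unfolding cB using k Q \<alpha> by (intro divide_right_mono add_left_mono mult_left_mono near) auto
  finally have S: "real (\<Sum>a\<in>{1..((6 + c) * Y^2) div R}. card (G R J Y Z a)) \<le> \<dots>" .
  have "real (card {(u, u') \<in> Idx R J Y Z \<times> Idx R J Y Z. F u = F u'}) \<le>
     real (nat J * card {(w, w') \<in> W Y Z \<times> W Y Z. g w = g w'} + 2 * (\<Sum>a\<in>{1..((6 + c) * Y^2) div R}. card (G R J Y Z a)))"
    using card_collisions_le[OF R Z(2) J] by (simp only: of_nat_le_iff)
  also have "\<dots> = real_of_int J * real (card {(w, w') \<in> W Y Z \<times> W Y Z. g w = g w'}) + 2 * real (\<Sum>a\<in>{1..((6 + c) * Y^2) div R}. card (G R J Y Z a))"
    using J by simp
  also have "\<dots> \<le> real_of_int J * (real_of_int Y * Z + real_of_int Z^2 * (real_of_int c * Q^2 * Z^2 / Y + 1)) +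
    2 * ((((real_of_int Y + T) * (real_of_int Z + T))^2 / 2 * ((real_of_int (hi R J Y) / lo R Y - 1) * (1 + 1 / P) + 3 / sqrt \<alpha>)
      + 2 * \<alpha> * ((real_of_int Y + T) * (real_of_int Z + T)^2 * ((\<alpha> * hi R J Y + real_of_int c * Q^2 * (real_of_int Z + T)^2) / Y + 1))) / (2 * k * Q))"
    using J by (intro add_mono mult_left_mono C0 S) auto
  finally show ?thesis by (simp only: e of_int_power)
qed

text \<open>Only representations in the fixed class of \<open>(x0, y0, z0)\<close> count, so a
  representation outside this exceptional set also carries every congruence condition imposed on the
  variables modulo divisors of \<open>Q\<close>.\<close>

definition Exc :: "int set" where
  "Exc = {N. [N = k * x0^2 + bqf c y0 z0] (mod Q) \<and>
     \<not> (\<exists>x y z. [x = x0] (mod Q) \<and> [y = y0] (mod Q) \<and> [z = z0] (mod Q) \<and> N = k * x^2 + bqf c y z)}"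

lemma card_residue_class_le:
  fixes q N0 a b :: int
  assumes "q > 0" "a \<le> b"
  shows "real (card {N \<in> {a..b}. [N = N0] (mod q)}) \<le> (real_of_int b - a) / q + 1"
proof -
  have "card {N \<in> {a..b}. [N = N0] (mod q)} \<le> card {m::int. (real_of_int a - N0) / q \<le> m \<and> m \<le> (real_of_int b - N0) / q}"
  proof (rule card_inj_on_le[where f = "\<lambda>N. (N - N0) div q"])
    have d: "N - N0 = q * ((N - N0) div q)" if "[N = N0] (mod q)" for N
      using that by (simp add: cong_iff_dvd_diff)
    show "inj_on (\<lambda>N. (N - N0) div q) {N \<in> {a..b}. [N = N0] (mod q)}"
      by (rule inj_onI) (metis (mono_tags, lifting) d diff_add_cancel mem_Collect_eq)
    show "(\<lambda>N. (N - N0) div q) ` {N \<in> {a..b}. [N = N0] (mod q)} \<subseteq> {m::int. (real_of_int a - N0) / q \<le> m \<and> m \<le> (real_of_int b - N0) / q}"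
    proof (rule image_subsetI)
      fix N assume N: "N \<in> {N \<in> {a..b}. [N = N0] (mod q)}"
      then have "real_of_int N - N0 = q * real_of_int ((N - N0) div q)" using d[of N] by (metis (mono_tags, lifting) mem_Collect_eq of_int_diff of_int_mult)
      then have "real_of_int ((N - N0) div q) = (real_of_int N - N0) / q" using assms by (simp add: field_simps)
      then show "(N - N0) div q \<in> {m::int. (real_of_int a - N0) / q \<le> m \<and> m \<le> (real_of_int b - N0) / q}"
        using N assms by (simp add: divide_right_mono)
    qed
    have "{m::int. (real_of_int a - N0) / q \<le> m \<and> m \<le> (real_of_int b - N0) / q} = {\<lceil>(real_of_int a - N0) / q\<rceil>..\<lfloor>(real_of_int b - N0) / q\<rfloor>}"
      by (auto simp: ceiling_le_iff le_floor_iff)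
    then show "finite {m::int. (real_of_int a - N0) / q \<le> m \<and> m \<le> (real_of_int b - N0) / q}" by simp
  qed
  then have "real (card {N \<in> {a..b}. [N = N0] (mod q)}) \<le> real (card {m::int. (real_of_int a - N0) / q \<le> m \<and> m \<le> (real_of_int b - N0) / q})" by simp
  also have "\<dots> \<le> (real_of_int b - N0) / q - (real_of_int a - N0) / q + 1"
    using assms by (intro card_int_interval_le divide_right_mono) auto
  also have "\<dots> = (real_of_int b - a) / q + 1" by (simp add: diff_divide_distrib)
  finally show ?thesis .
qed

text \<open>All values on \<open>Idx\<close> lie in one class modulo \<open>Q\<close> and in the
  window, up to an overshoot of order Y^2 due to the binary part. \<open>NB\<close> bounds the
  number of candidates in the lengthened window, and the Cauchy-Schwarz inequality bounds the number
  of values attained from below.\<close>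

lemma card_Exc_window_le:
  fixes E NB :: real
  assumes R: "R \<ge> 0" and J: "J \<ge> 0" and Y: "Y \<ge> 0" and Z: "0 \<le> Z" "Z \<le> Y"
    and E: "real (card {(u, u') \<in> Idx R J Y Z \<times> Idx R J Y Z. F u = F u'}) \<le> E" "E > 0"
  defines "NB \<equiv> k * Q * ((real_of_int R + J)^2 - real_of_int R^2) + Q * ((6 + c) * real_of_int Y^2) + 1"
  shows "real (card (Exc \<inter> {k * Q^2 * R^2..k * Q^2 * (R + J)^2})) \<le> NB - (real_of_int J * Y * Z)^2 / E"
proof -
  let ?I = "Idx R J Y Z"
  define a b where "a = k * Q^2 * R^2" and "b = k * Q^2 * (R + J)^2 + Q^2 * ((6 + c) * Y^2)"
  let ?V = "{N \<in> {a..b}. [N = k * x0^2 + bqf c y0 z0] (mod Q)}"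
  have fI: "finite ?I" by (simp add: Idx_def finite_W)
  have fV: "finite ?V" by (rule finite_subset[of _ "{a..b}"]) auto
  have img: "F ` ?I \<subseteq> ?V"
  proof (rule image_subsetI)
    fix u assume u: "u \<in> ?I"
    obtain i w where ue: "u = (i, w)" by (metis prod.exhaust)
    have i: "R \<le> i" "i < R + J" and w: "w \<in> W Y Z" using u by (auto simp: ue Idx_def)
    have x: "Q * R \<le> x0 + Q * i" "x0 + Q * i \<le> Q * (R + J)"
    proof -
      have "Q * R \<le> Q * i" "Q * (i + 1) \<le> Q * (R + J)" using i Q by (auto intro: mult_left_mono)
      then show "Q * R \<le> x0 + Q * i" using x0 by linarith
      show "x0 + Q * i \<le> Q * (R + J)" using \<open>Q * (i + 1) \<le> Q * (R + J)\<close> x0 by (simp add: algebra_simps)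
    qed
    have "0 \<le> Q * R" using Q R by simp
    then have "(Q * R)^2 \<le> (x0 + Q * i)^2" "(x0 + Q * i)^2 \<le> (Q * (R + J))^2"
      using x by (auto intro: power_mono)
    then have "k * (Q * R)^2 \<le> k * (x0 + Q * i)^2" "k * (x0 + Q * i)^2 \<le> k * (Q * (R + J))^2"
      using k by (auto intro: mult_left_mono)
    then have "a \<le> F u" "F u \<le> b" unfolding a_def b_def F_def ue
      using g_bounds[OF w Z(2)] by (auto simp: power_mult_distrib mult.assoc)
    then show "F u \<in> ?V" using F_mod[of i w] by (simp add: ue)
  qed
  have ab: "a \<le> b"
  proof -
    have "R^2 \<le> (R + J)^2" using R J by (intro power_mono) auto
    then have "k * Q^2 * R^2 \<le> k * Q^2 * (R + J)^2" using k by (intro mult_left_mono) auto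
    then show ?thesis unfolding a_def b_def using c by (simp add: add_increasing2)
  qed
  have "Exc \<inter> {k * Q^2 * R^2..k * Q^2 * (R + J)^2} \<subseteq> ?V - F ` ?I"
  proof
    fix N assume N: "N \<in> Exc \<inter> {k * Q^2 * R^2..k * Q^2 * (R + J)^2}"
    have "0 \<le> Q^2 * ((6 + c) * Y^2)" using c by simp
    then have "N \<in> ?V" using N by (auto simp: Exc_def a_def b_def)
    moreover have "N \<notin> F ` ?I"
    proof
      assume "N \<in> F ` ?I"
      then obtain i j l where "N = F (i, (j, l))" by auto
      moreover have "[x0 + Q * i = x0] (mod Q)" "[y0 + Q * j = y0] (mod Q)" "[z0 + Q * l = z0] (mod Q)"
        by (simp_all add: cong_iff_dvd_diff)
      ultimately show False using N unfolding Exc_def F_def g_def by auto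
    qed
    ultimately show "N \<in> ?V - F ` ?I" by simp
  qed
  then have "card (Exc \<inter> {k * Q^2 * R^2..k * Q^2 * (R + J)^2}) \<le> card (?V - F ` ?I)"
    by (rule card_mono[OF finite_Diff[OF fV]])
  also have "\<dots> = card ?V - card (F ` ?I)" using img fI by (intro card_Diff_subset) auto
  finally have 1: "real (card (Exc \<inter> {k * Q^2 * R^2..k * Q^2 * (R + J)^2})) \<le> real (card ?V) - real (card (F ` ?I))"
    using card_mono[OF fV img] by linarith
  have 2: "real (card ?V) \<le> NB"
  proof -
    have "real (card ?V) \<le> (real_of_int b - a) / Q + 1" by (rule card_residue_class_le[OF Q ab])
    also have "\<dots> = NB" using Q unfolding NB_def a_def b_def by (simp add: field_simps power2_eq_square)
    finally show ?thesis .
  qed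
  have 3: "(real_of_int J * Y * Z)^2 / E \<le> real (card (F ` ?I))"
  proof -
    have "card ?I = nat J * (nat Y * nat Z)" by (simp add: Idx_def W_def card_cartesian_product)
    then have cI: "real (card ?I) = real_of_int J * Y * Z" using J Y Z by simp
    have "real ((card ?I)^2) \<le> real (card (F ` ?I) * card {(u, u') \<in> ?I \<times> ?I. F u = F u'})"
      using card_squared_le_collisions[OF fI, of F] by (simp only: of_nat_le_iff)
    also have "\<dots> \<le> real (card (F ` ?I)) * E" unfolding of_nat_mult by (intro mult_left_mono E) auto
    finally have "(real_of_int J * Y * Z)^2 \<le> real (card (F ` ?I)) * E" by (simp add: cI)
    then show ?thesis using E by (simp add: pos_divide_le_eq)
  qed
  from 1 2 3 show ?thesis by linarith
qed

end

text \<open>A limit of 1 would mean that collisions are as rare as for values spread evenly over the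
  class. The main term has order B^32, while collisions with equal \<open>i\<close> contribute B^31
  and pairs with small \<open>D\<close> only B^27. The excess over 1 comes from the relative length
  of the window (\<open>h\<close>), from divisors coprime to \<open>Q\<close> (\<open>P\<close>) and
  from the threshold for small differences (\<open>\<alpha>\<close>).\<close>

lemma moment_ratio_tendsto:
  fixes k Q c h t C P \<alpha> :: real
  assumes "k > 0" "Q > 0" "h > 0" "\<alpha> > 0"
  defines "NB \<equiv> \<lambda>B. k * Q * ((h * B^15 + B^15)^2 - (h * B^15)^2) + Q * ((6 + c) * (B^10)^2) + 1"
  defines "hi \<equiv> \<lambda>B. 2 * k * Q^2 * (h * B^15 + B^15 + C * B^10)"
  defines "lo \<equiv> \<lambda>B. 2 * k * Q^2 * (h * B^15 - C * B^10)"
  defines "E \<equiv> \<lambda>B. B^15 * (B^10 * B^6 + (B^6)^2 * (c * Q^2 * (B^6)^2 / B^10 + 1)) +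
    1 / (k * Q) * (((B^10 + t * B^5) * (B^6 + t * B^5))^2 / 2 * ((hi B / lo B - 1) * (1 + 1 / P) + 3 / sqrt \<alpha>)
      + 2 * \<alpha> * ((B^10 + t * B^5) * (B^6 + t * B^5)^2 * ((\<alpha> * hi B + c * Q^2 * (B^6 + t * B^5)^2) / B^10 + 1)))"
  shows "((\<lambda>B. NB B * E B / (B^15 * B^10 * B^6)^2) \<longlongrightarrow> (2 * h + 1) / 2 * ((1 + 1 / P) / h + 3 / sqrt \<alpha>)) at_top"
    and "((\<lambda>B. NB B / B^30) \<longlongrightarrow> k * Q * (2 * h + 1)) at_top"
proof -
  have n1: "((\<lambda>B::real. (k * Q * ((h * B^15 + B^15)^2 - (h * B^15)^2) + Q * ((6 + c) * (B^10)^2) + 1) / B^30) \<longlongrightarrow> k * Q * (2 * h + 1)) at_top"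
  proof -
    have "((\<lambda>B::real. k * Q * (2 * h + 1) + Q * (6 + c) * (1 / B^10) + 1 / B^30) \<longlongrightarrow> k * Q * (2 * h + 1) + Q * (6 + c) * 0 + 0) at_top"
      by (intro tendsto_intros; real_asymp)
    moreover have "\<forall>\<^sub>F B::real in at_top. k * Q * (2 * h + 1) + Q * (6 + c) * (1 / B^10) + 1 / B^30 = (k * Q * ((h * B^15 + B^15)^2 - (h * B^15)^2) + Q * ((6 + c) * (B^10)^2) + 1) / B^30"
      using eventually_gt_at_top[of 0]
    proof eventually_elim
      case (elim B)
      have p: "(B^15)^2 = B^30" "(B^10)^2 = B^20" by (simp_all add: power_mult[symmetric])
      have d: "B^20 / B^30 = 1 / B^10" using elim by (simp add: field_simps flip: power_add)
      have "k * Q * ((h * B^15 + B^15)^2 - (h * B^15)^2) = k * Q * (2 * h + 1) * (B^15)^2" by (simp add: power2_eq_square algebra_simps)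
      then have num: "k * Q * ((h * B^15 + B^15)^2 - (h * B^15)^2) + Q * ((6 + c) * (B^10)^2) + 1 = k * Q * (2 * h + 1) * B^30 + Q * (6 + c) * B^20 + 1"
        unfolding p by (simp only: mult.assoc)
      have q: "(k * Q * (2 * h + 1) * B^30 + Q * (6 + c) * B^20 + 1) / B^30 = k * Q * (2 * h + 1) + Q * (6 + c) * (B^20 / B^30) + 1 / B^30"
        using elim by (simp add: add_divide_distrib)
      show ?case unfolding num q d ..
    qed
    ultimately show ?thesis by (auto intro: Lim_transform_eventually)
  qed
  then show N: "((\<lambda>B. NB B / B^30) \<longlongrightarrow> k * Q * (2 * h + 1)) at_top" unfolding NB_def .
  have hl: "((\<lambda>B. hi B / lo B) \<longlongrightarrow> (h + 1) / h) at_top"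
  proof -
    have "((\<lambda>B::real. (h + 1 + C * (1 / B^5)) / (h - C * (1 / B^5))) \<longlongrightarrow> (h + 1 + C * 0) / (h - C * 0)) at_top"
      by (intro tendsto_intros; (real_asymp | use assms in simp))
    moreover have "\<forall>\<^sub>F B::real in at_top. (h + 1 + C * (1 / B^5)) / (h - C * (1 / B^5)) = hi B / lo B"
      using eventually_gt_at_top[of 0]
    proof eventually_elim
      case (elim B)
      have "hi B = (2 * k * Q^2 * B^15) * (h + 1 + C * (1 / B^5))" "lo B = (2 * k * Q^2 * B^15) * (h - C * (1 / B^5))"
      proof -
        have "B^15 * (1 / B^5) = B^10" using elim by (simp add: field_simps flip: power_add)
        moreover have "B^15 * (h + 1 + C * X) = h * B^15 + B^15 + C * (B^15 * X)" "B^15 * (h - C * X) = h * B^15 - C * (B^15 * X)" for X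
          by (simp_all add: algebra_simps)
        ultimately have "B^15 * (h + 1 + C * (1 / B^5)) = h * B^15 + B^15 + C * B^10" "B^15 * (h - C * (1 / B^5)) = h * B^15 - C * B^10"
          by (simp_all only:)
        then show "hi B = (2 * k * Q^2 * B^15) * (h + 1 + C * (1 / B^5))" "lo B = (2 * k * Q^2 * B^15) * (h - C * (1 / B^5))"
          unfolding hi_def lo_def by (simp_all add: mult.assoc)
      qed
      then show ?case using elim assms by simp
    qed
    ultimately show ?thesis by (auto intro: Lim_transform_eventually)
  qed
  have bx: "((\<lambda>B::real. ((B^10 + t * B^5) * (B^6 + t * B^5))^2 / B^32) \<longlongrightarrow> 1) at_top" by real_asymp
  have t1: "((\<lambda>B::real. B^15 * (B^10 * B^6 + (B^6)^2 * (c * Q^2 * (B^6)^2 / B^10 + 1)) / B^32) \<longlongrightarrow> 0) at_top" by real_asymp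
  have t2: "((\<lambda>B::real. (B^10 + t * B^5) * (B^6 + t * B^5)^2 * ((\<alpha> * (2 * k * Q^2 * (h * B^15 + B^15 + C * B^10)) + c * Q^2 * (B^6 + t * B^5)^2) / B^10 + 1) / B^32) \<longlongrightarrow> 0) at_top"
    by real_asymp
  have "((\<lambda>B. E B / B^32) \<longlongrightarrow> 0 + 1 / (k * Q) * (1 / 2 * (((h + 1) / h - 1) * (1 + 1 / P) + 3 / sqrt \<alpha>) + 2 * \<alpha> * 0)) at_top"
  proof -
    have eq: "E B / B^32 = B^15 * (B^10 * B^6 + (B^6)^2 * (c * Q^2 * (B^6)^2 / B^10 + 1)) / B^32 +
      1 / (k * Q) * ((((B^10 + t * B^5) * (B^6 + t * B^5))^2 / B^32) / 2 * ((hi B / lo B - 1) * (1 + 1 / P) + 3 / sqrt \<alpha>)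
      + 2 * \<alpha> * ((B^10 + t * B^5) * (B^6 + t * B^5)^2 * ((\<alpha> * (2 * k * Q^2 * (h * B^15 + B^15 + C * B^10)) + c * Q^2 * (B^6 + t * B^5)^2) / B^10 + 1) / B^32))" for B
    proof -
      have "(X + Y * (A / 2 * M + G * W)) / V = X / V + Y * ((A / V) / 2 * M + G * (W / V))" for X Y A M G W V :: real
        by (simp add: add_divide_distrib algebra_simps)
      then show ?thesis unfolding E_def hi_def by (simp only:)
    qed
    have M: "((\<lambda>B. (hi B / lo B - 1) * (1 + 1 / P) + 3 / sqrt \<alpha>) \<longlongrightarrow> ((h + 1) / h - 1) * (1 + 1 / P) + 3 / sqrt \<alpha>) at_top"
      by (rule tendsto_add[OF tendsto_mult[OF tendsto_diff[OF hl tendsto_const] tendsto_const] tendsto_const])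
    show ?thesis unfolding eq
      by (rule tendsto_add[OF t1 tendsto_mult[OF tendsto_const tendsto_add[OF tendsto_mult[OF tendsto_divide[OF bx tendsto_const] M] tendsto_mult[OF tendsto_const t2]]]]) simp
  qed
  from tendsto_mult[OF N this] have "((\<lambda>B. NB B / B^30 * (E B / B^32)) \<longlongrightarrow> k * Q * (2 * h + 1) * (1 / (k * Q) * (1 / 2 * (((h + 1) / h - 1) * (1 + 1 / P) + 3 / sqrt \<alpha>)))) at_top"
    by simp
  moreover have "k * Q * (2 * h + 1) * (1 / (k * Q) * (1 / 2 * (((h + 1) / h - 1) * (1 + 1 / P) + 3 / sqrt \<alpha>))) = (2 * h + 1) / 2 * ((1 + 1 / P) / h + 3 / sqrt \<alpha>)"
  proof -
    have "(h + 1) / h - 1 = 1 / h" using assms by (simp add: field_simps)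
    then show ?thesis using assms by simp
  qed
  moreover have "NB B / B^30 * (E B / B^32) = NB B * E B / (B^15 * B^10 * B^6)^2" for B
    by (simp flip: power_add power_mult)
  ultimately show "((\<lambda>B. NB B * E B / (B^15 * B^10 * B^6)^2) \<longlongrightarrow> (2 * h + 1) / 2 * ((1 + 1 / P) / h + 3 / sqrt \<alpha>)) at_top"
    by (simp only:)
qed

context shifted_form
begin

lemma card_Exc_window_eventually_le:
  fixes h :: nat and \<epsilon> \<alpha> :: real
  assumes h: "h \<ge> 2" and \<epsilon>: "\<epsilon> > 0" and \<alpha>: "\<alpha> > 0"
    and lim: "(2 * real h + 1) / 2 * ((1 + 1 / P) / real h + 3 / sqrt \<alpha>) < 1 + \<epsilon>"
  shows "\<forall>\<^sub>F B::nat in sequentially.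
    real (card (Exc \<inter> {k * Q^2 * (int h * int B^15)^2..k * Q^2 * (int (h + 1) * int B^15)^2}))
      \<le> \<epsilon> * (k * Q * (2 * real h + 2)) * real B^30"
proof -
  define t where "t = 2 * k * Q * (6 + c)"
  define NB where "NB = (\<lambda>B::real. k * Q * ((real h * B^15 + B^15)^2 - (real h * B^15)^2) + Q * ((6 + c) * (B^10)^2) + 1)"
  define hi' where "hi' = (\<lambda>B::real. 2 * k * Q^2 * (real h * B^15 + B^15 + C1 * B^10))"
  define lo' where "lo' = (\<lambda>B::real. 2 * k * Q^2 * (real h * B^15 - C1 * B^10))"
  define E where "E = (\<lambda>B::real. B^15 * (B^10 * B^6 + (B^6)^2 * (c * Q^2 * (B^6)^2 / B^10 + 1)) +
    1 / (k * Q) * (((B^10 + t * B^5) * (B^6 + t * B^5))^2 / 2 * ((hi' B / lo' B - 1) * (1 + 1 / P) + 3 / sqrt \<alpha>)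
      + 2 * \<alpha> * ((B^10 + t * B^5) * (B^6 + t * B^5)^2 * ((\<alpha> * hi' B + c * Q^2 * (B^6 + t * B^5)^2) / B^10 + 1))))"
  have "((\<lambda>B. NB B * E B / (B^15 * B^10 * B^6)^2) \<longlongrightarrow> (2 * real h + 1) / 2 * ((1 + 1 / P) / real h + 3 / sqrt \<alpha>)) at_top"
    and N: "((\<lambda>B. NB B / B^30) \<longlongrightarrow> k * Q * (2 * real h + 1)) at_top"
    using moment_ratio_tendsto(1)[where k = "real_of_int k" and Q = "real_of_int Q" and h = "real h" and \<alpha> = \<alpha> and c = "real_of_int c" and t = "real_of_int t" and P = "real_of_int P" and C = "real_of_int C1"]
      moment_ratio_tendsto(2)[where k = "real_of_int k" and Q = "real_of_int Q" and h = "real h" and \<alpha> = \<alpha> and c = "real_of_int c"] k Q h \<alpha>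
    unfolding NB_def E_def hi'_def lo'_def by (simp_all add: mult.assoc)
  from filterlim_compose[OF this(1) filterlim_real_sequentially] filterlim_compose[OF N filterlim_real_sequentially]
  have r1: "((\<lambda>B. NB (real B) * E (real B) / (real B^15 * real B^10 * real B^6)^2) \<longlongrightarrow> (2 * real h + 1) / 2 * ((1 + 1 / P) / real h + 3 / sqrt \<alpha>)) sequentially"
    and r2: "((\<lambda>B. NB (real B) / real B^30) \<longlongrightarrow> k * Q * (2 * real h + 1)) sequentially"
    by this+
  have e1: "\<forall>\<^sub>F B in sequentially. NB (real B) * E (real B) / (real B^15 * real B^10 * real B^6)^2 < 1 + \<epsilon>"
    using order_tendstoD(2)[OF r1 lim] .
  have "k * Q * (2 * real h + 1) < k * Q * (2 * real h + 2)"
    using k Q by (intro mult_strict_left_mono) auto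
  then have e2: "\<forall>\<^sub>F B in sequentially. NB (real B) / real B^30 < k * Q * (2 * real h + 2)"
    by (rule order_tendstoD(2)[OF r2])
  have e3: "\<forall>\<^sub>F B::nat in sequentially. int B \<ge> 1 + (6 + c) + t + 3 * C1"
    using eventually_ge_at_top[of "nat (1 + (6 + c) + t + 3 * C1)"] by eventually_elim simp
  show ?thesis using e1 e2 e3
  proof eventually_elim
    case (elim B)
    define b where "b = int B"
    have C1: "C1 \<ge> 1" using Q c mult_mono[of 1 Q 1 "10 + 3 * c"] by (simp add: C1_def)
    have t0: "t \<ge> 0" using k Q c by (simp add: t_def)
    have b: "b \<ge> 1" "b \<ge> 6 + c" "b \<ge> t" "b \<ge> 1 + 3 * C1" using elim(3) C1 t0 c by (auto simp: b_def)
    have b5: "b \<le> b^5" using b power_increasing[of 1 5 b] by simp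
    have sp: "b^10 = b^5 * b^5" "b^15 = b^5 * b^10" by (simp_all flip: power_add)
    \<comment> \<open>The exponents meet three demands. \<open>Y * Z\<close> exceeds the order of
      \<open>R\<close>, so that values are attained many times on average. The differences, and with
      them \<open>T\<close>, have order Y^2 / R, which is below \<open>Z\<close>, so shifts barely
      enlarge the box. Finally Z^4 / Y is below \<open>Y * Z\<close>, so coincidences of
      \<open>g\<close> are mostly diagonal.\<close>
    define R J Y Z A T where "R = int h * b^15" and "J = b^15" and "Y = b^10" and "Z = b^6" and "A = (6 + c) * b^5" and "T = t * b^5"
    have R: "R \<ge> 1" unfolding R_def using mult_mono[of 1 "int h" 1 "b^15"] h one_le_power[of b 15] b by simp
    have J: "J \<ge> 0" and Y: "Y \<ge> 1" and Z: "0 \<le> Z" "Z \<le> Y" using b by (auto simp: J_def Y_def Z_def power_increasing)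
    have A1: "0 \<le> A" "A \<le> Y" "T \<le> Y"
    proof -
      show "0 \<le> A" using b c by (simp add: A_def)
      show "A \<le> Y" "T \<le> Y" unfolding A_def Y_def T_def sp(1) using b b5 by (intro mult_right_mono; simp)+
    qed
    have A2: "((6 + c) * Y^2) div R \<le> A"
    proof -
      have "(6 + c) * Y^2 = A * b^15" by (simp add: A_def Y_def power_mult[symmetric] mult.assoc flip: power_add)
      also have "\<dots> \<le> A * R" unfolding R_def using h b A1 by (intro mult_left_mono) (auto simp: mult_le_cancel_right1)
      finally have "((6 + c) * Y^2) div R \<le> (A * R) div R" using R by (intro zdiv_mono1) auto
      then show ?thesis using R by simp
    qed
    have T: "T = 2 * k * Q * A" by (simp add: T_def A_def t_def)
    have CY: "(1 + 3 * C1) * Y \<le> b^15"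
    proof -
      have "(1 + 3 * C1) * Y \<le> b^5 * Y" using b b5 Y by (intro mult_right_mono) auto
      then show ?thesis by (simp only: sp(2) Y_def)
    qed
    have hb: "2 * b^15 \<le> R" unfolding R_def using h b by (intro mult_right_mono) auto
    have "b^15 > 0" using b by simp
    have CY0: "C1 * Y > 0" using C1 Y by simp
    have r1: "R - C1 * Y > 0" using CY hb CY0 Y by (simp add: algebra_simps)
    have r2: "R - C1 * Y \<le> R + J + C1 * Y" using CY0 J by linarith
    have r3: "R + J + C1 * Y \<le> 2 * (R - C1 * Y)" using CY hb Y by (simp add: J_def algebra_simps)
    have kQ: "0 < 2 * k * Q^2" using k Q by simp
    have lo: "lo R Y > 0" "lo R Y \<le> hi R J Y" "hi R J Y \<le> 2 * lo R Y"
    proof -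
      show "lo R Y > 0" unfolding lo_def by (rule mult_pos_pos[OF kQ r1])
      show "lo R Y \<le> hi R J Y" unfolding lo_def hi_def using kQ by (intro mult_left_mono r2) simp
      have e: "2 * (2 * k * Q^2 * (R - C1 * Y)) = 2 * k * Q^2 * (2 * (R - C1 * Y))" by (simp only: ac_simps)
      show "hi R J Y \<le> 2 * lo R Y" unfolding lo_def hi_def e using kQ by (intro mult_left_mono r3) simp
    qed
    have loR: "real_of_int (lo R Y) = lo' (real B)" "real_of_int (hi R J Y) = hi' (real B)"
      by (simp_all add: lo_def hi_def lo'_def hi'_def R_def J_def Y_def b_def)
    have Ev: "real (card {(u, u') \<in> Idx R J Y Z \<times> Idx R J Y Z. F u = F u'}) \<le> E (real B)"
      using card_collisions_explicit_le[OF R J Y Z A1(1) A2 A1(2) T A1(3) lo \<alpha>]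
      unfolding E_def loR[symmetric] by (simp add: J_def Y_def Z_def T_def b_def)
    have E0: "E (real B) > 0"
    proof -
      have rB: "real B > 0" using b by (simp add: b_def)
      have M: "1 \<le> hi' (real B) / lo' (real B)" unfolding loR[symmetric] using lo by simp
      have hi0: "hi' (real B) \<ge> 0" unfolding loR[symmetric] using lo by simp
      show ?thesis unfolding E_def using rB M hi0 k Q c \<alpha> t0 P(1)
        by (intro add_pos_nonneg mult_pos_pos mult_nonneg_nonneg add_nonneg_nonneg divide_nonneg_nonneg zero_le_power) auto
    qed
    have w: "k * Q^2 * R^2 = k * Q^2 * (int h * int B^15)^2" "k * Q^2 * (R + J)^2 = k * Q^2 * (int (h + 1) * int B^15)^2"
      by (simp_all add: R_def J_def b_def algebra_simps)
    have i1: "real (card (Exc \<inter> {k * Q^2 * R^2..k * Q^2 * (R + J)^2})) \<le> NB (real B) - (real B^15 * real B^10 * real B^6)^2 / E (real B)"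
    proof -
      have "R \<ge> 0" "Y \<ge> 0" using R Y by auto
      from card_Exc_window_le[OF this(1) J this(2) Z Ev E0] show ?thesis
        by (simp add: NB_def R_def J_def Y_def Z_def b_def)
    qed
    \<comment> \<open>At least \<open>V / E\<close> of at most \<open>NB\<close> candidates are
      attained; since \<open>NB * E < (1 + \<epsilon>) * V\<close>, the omitted ones are at most the
      fraction \<open>\<epsilon>\<close> of \<open>NB\<close>.\<close>
    have i2: "NB (real B) - (real B^15 * real B^10 * real B^6)^2 / E (real B) \<le> \<epsilon> * (k * Q * (2 * real h + 2)) * real B^30"
    proof -
      define V where "V = (real B^15 * real B^10 * real B^6)^2"
      have rB: "real B > 0" using b by (simp add: b_def)
      have V: "V > 0" using rB by (simp add: V_def)
      have nb: "NB (real B) \<le> (k * Q * (2 * real h + 2)) * real B^30"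
        using elim(2) rB by (simp add: pos_divide_less_eq)
      have "NB (real B) * E (real B) < (1 + \<epsilon>) * V" using elim(1) V unfolding V_def[symmetric] by (simp add: pos_divide_less_eq)
      then have v: "NB (real B) / (1 + \<epsilon>) \<le> V / E (real B)" using E0 \<epsilon> by (simp add: field_simps)
      have "0 \<le> NB (real B)"
      proof -
        have "(real h * real B^15)^2 \<le> (real h * real B^15 + real B^15)^2" by (intro power_mono) auto
        then show ?thesis unfolding NB_def using k Q c by (intro add_nonneg_nonneg mult_nonneg_nonneg) auto
      qed
      have "NB (real B) - V / E (real B) \<le> NB (real B) - NB (real B) / (1 + \<epsilon>)" using v by simp
      also have "\<dots> = \<epsilon> * NB (real B) / (1 + \<epsilon>)" using \<epsilon> by (simp add: field_simps)
      also have "\<dots> \<le> \<epsilon> * NB (real B) / 1" using \<epsilon> \<open>0 \<le> NB (real B)\<close> by (intro divide_left_mono) auto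
      also have "\<dots> \<le> \<epsilon> * ((k * Q * (2 * real h + 2)) * real B^30)" using nb \<epsilon> by simp
      finally show ?thesis by (simp add: V_def mult.assoc)
    qed
    show ?case unfolding w[symmetric] by (rule order_trans[OF i1 i2])
  qed
qed

end

text \<open>\<open>S B\<close> is the upper end of the window with parameter \<open>B\<close>. For
  given \<open>X\<close> the first window reaching \<open>X\<close> is used; below it, up to
  \<open>X'\<close>, the induction hypothesis applies. Since
  \<open>X' \<le> (1 - \<tau>) * X\<close> and the window itself costs at most
  \<open>\<kappa>0 * \<tau> * X\<close>, the constant \<open>\<kappa>0\<close> reproduces
  itself.\<close>

lemma card_eventually_le_of_windows:
  fixes E :: "int set" and L :: int and h :: nat and \<delta> \<kappa> :: real
  assumes L: "L > 0" and h: "h \<ge> 1" and \<delta>: "\<delta> > 0" and \<kappa>: "\<kappa> > 2 * \<delta> / (real h + 1)"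
    and ev: "\<forall>\<^sub>F B::nat in sequentially.
      real (card (E \<inter> {L * (int h * int B^15)^2..L * (int (h + 1) * int B^15)^2})) \<le> \<delta> * L * real B^30"
  shows "\<forall>\<^sub>F X::nat in sequentially. real (card (E \<inter> {1..int X})) \<le> \<kappa> * real X"
proof -
  define \<tau> where "\<tau> = 1 / (real h + 1)"
  define \<kappa>0 where "\<kappa>0 = 2 * \<delta> / (real h + 1)"
  have \<tau>: "0 < \<tau>" "\<tau> \<le> 1" using h by (auto simp: \<tau>_def)
  define S where "S = (\<lambda>B::nat. L * int (h + 1)^2 * int B^30)"
  have "((\<lambda>B::real. B^30 / (B - 1)^30) \<longlongrightarrow> 1) at_top" by real_asymp
  then have "((\<lambda>B::nat. real B^30 / (real B - 1)^30) \<longlongrightarrow> 1) sequentially"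
    by (rule filterlim_compose[OF _ filterlim_real_sequentially])
  then have "\<forall>\<^sub>F B::nat in sequentially. real B^30 / (real B - 1)^30 < 1 + \<tau>"
    by (rule order_tendstoD(2)) (use \<tau> in simp)
  then have "\<forall>\<^sub>F B::nat in sequentially. real B^30 \<le> (1 + \<tau>) * (real B - 1)^30"
    using eventually_gt_at_top[of 1]
  proof eventually_elim
    case (elim B)
    then have "(real B - 1)^30 > 0" by simp
    then show ?case using elim(1) by (simp add: pos_divide_less_eq)
  qed
  then obtain b0 where b0: "\<And>B. B \<ge> b0 \<Longrightarrow> real B^30 \<le> (1 + \<tau>) * (real B - 1)^30"
      "\<And>B. B \<ge> b0 \<Longrightarrow> real (card (E \<inter> {L * (int h * int B^15)^2..L * (int (h + 1) * int B^15)^2})) \<le> \<delta> * L * real B^30"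
    using eventually_conj[OF _ ev] unfolding eventually_sequentially by (metis (mono_tags, lifting))
  have Smono: "S a \<le> S b" if "a \<le> b" for a b
    unfolding S_def using that L by (intro mult_left_mono power_mono) auto
  have main: "real (card (E \<inter> {1..int X})) \<le> real_of_int (S b0) + \<kappa>0 * real X" for X
  proof (induction X rule: less_induct)
    case (less X)
    show ?case
    proof (cases "int X \<le> S b0")
      case True
      have "card (E \<inter> {1..int X}) \<le> card {1..int X}" by (intro card_mono) auto
      then have "real (card (E \<inter> {1..int X})) \<le> real X" by simp
      also have "\<dots> \<le> real_of_int (S b0)" using True by linarith
      also have "\<dots> \<le> real_of_int (S b0) + \<kappa>0 * real X" using \<delta> by (simp add: \<kappa>0_def)
      finally show ?thesis .
    next
      case False
      have "int X \<le> S X"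
      proof -
        have "int X \<le> int X^30" by (cases "X = 0") (use power_increasing[of 1 30 "int X"] in auto)
        also have "\<dots> \<le> (L * int (h + 1)^2) * int X^30"
        proof -
          have "1 * 1 \<le> L * int (h + 1)^2" using L by (intro mult_mono) auto
          then show ?thesis using mult_right_mono[of 1 "L * int (h + 1)^2" "int X^30"] by simp
        qed
        finally show ?thesis by (simp add: S_def)
      qed
      define B where "B = (LEAST B. int X \<le> S B)"
      have B: "int X \<le> S B" unfolding B_def by (rule LeastI) fact
      have Bb: "B > b0"
      proof (rule ccontr)
        assume "\<not> B > b0"
        then have "S B \<le> S b0" by (intro Smono) simp
        with False B show False by linarith
      qed
      have "\<not> int X \<le> S (B - 1)" using not_less_Least[of "B - 1" "\<lambda>B. int X \<le> S B"] Bb by (simp add: B_def)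
      then have SX: "real_of_int (S (B - 1)) < real X" by linarith
      define G where "G = real_of_int L * real B^30"
      have G: "G * (real h + 1)^2 \<le> (1 + \<tau>) * real X"
      proof -
        have "G * (real h + 1)^2 \<le> real_of_int L * ((1 + \<tau>) * (real B - 1)^30) * (real h + 1)^2"
          unfolding G_def using b0(1)[of B] Bb L by (intro mult_right_mono mult_left_mono) auto
        also have "\<dots> = (1 + \<tau>) * real_of_int (S (B - 1))" using Bb by (simp add: S_def of_nat_diff algebra_simps)
        also have "\<dots> \<le> (1 + \<tau>) * real X" using SX \<tau> by (intro mult_left_mono) auto
        finally show ?thesis .
      qed
      define X' where "X' = nat (L * (int h * int B^15)^2)"
      have X'i: "int X' = L * (int h * int B^15)^2" using L by (simp add: X'_def)
      have "(int B^15)^2 = int B^30" by (simp add: power_mult[symmetric])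
      then have X'r: "real X' = G * real h^2" and top: "L * (int (h + 1) * int B^15)^2 = S B"
      proof -
        have "real X' = real_of_int (int X')" by simp
        also have "\<dots> = real_of_int L * (real h * real B^15)^2" unfolding X'i by simp
        also have "\<dots> = G * real h^2" by (simp add: G_def power_mult_distrib power_mult[symmetric])
        finally show "real X' = G * real h^2" .
        show "L * (int (h + 1) * int B^15)^2 = S B" by (simp only: S_def power_mult_distrib \<open>(int B^15)^2 = int B^30\<close> mult.assoc)
      qed
      have hh: "real h / (real h + 1) = 1 - \<tau>" using h by (simp add: \<tau>_def field_simps)
      \<comment> \<open>The window may overshoot \<open>X\<close> by the factor
        \<open>1 + \<tau>\<close>; its lower end is smaller than its upper end by
        \<open>(1 - \<tau>)^2\<close>, and \<open>(1 + \<tau>) * (1 - \<tau>) \<le> 1\<close>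
        absorbs the overshoot.\<close>
      have X'X: "real X' \<le> (1 - \<tau>) * real X"
      proof -
        have "real X' = (G * (real h + 1)^2) * (real h / (real h + 1))^2" using h by (simp add: X'r power_divide)
        also have "\<dots> \<le> ((1 + \<tau>) * real X) * (1 - \<tau>)^2" unfolding hh by (intro mult_right_mono G) auto
        also have "\<dots> = (1 - \<tau>) * real X * (1 - \<tau>^2)" by (simp add: power2_eq_square algebra_simps)
        also have "\<dots> \<le> (1 - \<tau>) * real X * 1" using \<tau> by (intro mult_left_mono mult_nonneg_nonneg) auto
        finally show ?thesis by simp
      qed
      have X0: "real X > 0" using False L by (cases X) (auto simp: S_def)
      have "(1 - \<tau>) * real X < 1 * real X" using X0 \<tau> by (intro mult_strict_right_mono) auto
      then have "real X' < real X" using X'X by linarith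
      then have IH: "real (card (E \<inter> {1..int X'})) \<le> real_of_int (S b0) + \<kappa>0 * real X'" by (intro less.IH) simp
      have "E \<inter> {1..int X} \<subseteq> (E \<inter> {1..int X'}) \<union> (E \<inter> {L * (int h * int B^15)^2..L * (int (h + 1) * int B^15)^2})"
        unfolding top X'i[symmetric] using B by auto
      then have "card (E \<inter> {1..int X}) \<le> card ((E \<inter> {1..int X'}) \<union> (E \<inter> {L * (int h * int B^15)^2..L * (int (h + 1) * int B^15)^2}))"
        by (intro card_mono) auto
      also have "\<dots> \<le> card (E \<inter> {1..int X'}) + card (E \<inter> {L * (int h * int B^15)^2..L * (int (h + 1) * int B^15)^2})" by (rule card_Un_le)
      finally have "real (card (E \<inter> {1..int X})) \<le> real (card (E \<inter> {1..int X'})) + real (card (E \<inter> {L * (int h * int B^15)^2..L * (int (h + 1) * int B^15)^2}))" by linarith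
      also have "\<dots> \<le> (real_of_int (S b0) + \<kappa>0 * real X') + \<delta> * G"
        using IH b0(2)[of B] Bb by (simp add: G_def mult.assoc)
      also have "\<dots> \<le> (real_of_int (S b0) + \<kappa>0 * ((1 - \<tau>) * real X)) + \<kappa>0 * \<tau> * real X"
      proof (rule add_mono)
        show "real_of_int (S b0) + \<kappa>0 * real X' \<le> real_of_int (S b0) + \<kappa>0 * ((1 - \<tau>) * real X)"
          using X'X \<delta> by (intro add_left_mono mult_left_mono) (auto simp: \<kappa>0_def)
        have "(1 + \<tau>) * real X \<le> 2 * real X" using \<tau> by (intro mult_right_mono) auto
        then have "G * (real h + 1)^2 \<le> 2 * real X" using G by linarith
        then have "\<delta> * G * (real h + 1)^2 \<le> \<delta> * (2 * real X)" using \<delta> by (simp add: mult.assoc)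
        then have "\<delta> * G \<le> \<delta> * (2 * real X) / (real h + 1)^2" by (simp add: pos_le_divide_eq)
        also have "\<dots> = \<kappa>0 * \<tau> * real X" by (simp add: \<kappa>0_def \<tau>_def power2_eq_square)
        finally show "\<delta> * G \<le> \<kappa>0 * \<tau> * real X" .
      qed
      also have "\<dots> = real_of_int (S b0) + \<kappa>0 * real X" by (simp add: algebra_simps)
      finally show ?thesis .
    qed
  qed
  have "\<kappa> - \<kappa>0 > 0" using \<kappa> by (simp add: \<kappa>0_def)
  then have "\<forall>\<^sub>F X::nat in sequentially. real X \<ge> real_of_int (S b0) / (\<kappa> - \<kappa>0)"
    using filterlim_real_sequentially by (simp add: filterlim_at_top)
  then show ?thesis
  proof eventually_elim
    case (elim X)
    then have "real_of_int (S b0) \<le> (\<kappa> - \<kappa>0) * real X" using \<open>\<kappa> - \<kappa>0 > 0\<close> by (simp add: field_simps)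
    then show ?case using main[of X] by (simp add: algebra_simps)
  qed
qed

text \<open>\<open>P\<close> has to be fixed before \<open>Q\<close>, because \<open>Q\<close> will
  be built from all primes up to \<open>P\<close>. The factor 1 / Q reflects that the exceptional
  set lives in a single class modulo \<open>Q\<close>; summation over all classes then returns
  \<open>\<epsilon>\<close>.\<close>

lemma exceptional_set_sparse:
  fixes \<epsilon> :: real and k c :: int
  assumes \<epsilon>: "\<epsilon> > 0" and "k \<ge> 1" "c \<ge> 1"
  shows "\<exists>P\<ge>1. \<forall>Q x0 y0 z0. shifted_form k c Q x0 y0 z0 P \<longrightarrow>
    (\<forall>\<^sub>F X::nat in sequentially. real (card (shifted_form.Exc k c Q x0 y0 z0 \<inter> {1..int X})) \<le> \<epsilon> / Q * real X)"
proof -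
  \<comment> \<open>With \<open>P = h\<close> and \<open>3 / sqrt \<alpha> = 1 / h^2\<close> the
    moment ratio is 1 + (5/2 + 1/h) / h, which is below \<open>1 + \<epsilon> / 8\<close> once
    \<open>h > 32 / \<epsilon>\<close>. Gluing the windows costs a factor 4 and leaves
    \<open>\<epsilon> / 2\<close>, strictly below \<open>\<epsilon>\<close>.\<close>
  obtain h :: nat where h: "real h > 32 / \<epsilon> + 2" using reals_Archimedean2 by blast
  have "32 / \<epsilon> > 0" using \<epsilon> by simp
  then have "real h > real 2" using h unfolding of_nat_numeral by linarith
  then have "h > 2" by (simp only: of_nat_less_iff)
  then have h2: "h \<ge> 2" by simp
  define \<alpha> where "\<alpha> = (3 * real h^2)^2"
  have hp: "real h > 0" using h2 by simp
  have \<alpha>: "\<alpha> > 0" "sqrt \<alpha> = 3 * real h^2"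
    unfolding \<alpha>_def real_sqrt_abs using hp by simp_all
  have lim: "(2 * real h + 1) / 2 * ((1 + 1 / real_of_int (int h)) / real h + 3 / sqrt \<alpha>) < 1 + \<epsilon> / 8"
  proof -
    have "(2 * real h + 1) / 2 * ((1 + 1 / real_of_int (int h)) / real h + 3 / sqrt \<alpha>) = 1 + (5 / 2 + 1 / real h) / real h"
      unfolding \<alpha>(2) using hp by (simp add: field_simps power2_eq_square)
    also have "\<dots> \<le> 1 + 4 / real h"
      using h2 by (intro add_left_mono divide_right_mono) (auto simp: field_simps)
    also have "4 / real h < \<epsilon> / 8"
    proof -
      have "32 / \<epsilon> < real h" using h by simp
      then show ?thesis using \<epsilon> hp by (simp add: field_simps)
    qed
    finally show ?thesis by simp
  qed
  show ?thesis
  proof (rule exI[of _ "int h"], intro conjI allI impI)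
    show "int h \<ge> 1" using h2 by simp
    fix Q x0 y0 z0 assume sf: "shifted_form k c Q x0 y0 z0 (int h)"
    interpret shifted_form k c Q x0 y0 z0 "int h" by fact
    show "\<forall>\<^sub>F X::nat in sequentially. real (card (Exc \<inter> {1..int X})) \<le> \<epsilon> / Q * real X"
    proof (rule card_eventually_le_of_windows[where L = "k * Q^2" and h = h and \<delta> = "\<epsilon> / 8 * (2 * real h + 2) / Q"])
      show "k * Q^2 > 0" using k Q by simp
      show "h \<ge> 1" using h2 by simp
      show "0 < \<epsilon> / 8 * (2 * real h + 2) / Q" using \<epsilon> Q hp by simp
      show "2 * (\<epsilon> / 8 * (2 * real h + 2) / Q) / (real h + 1) < \<epsilon> / Q"
      proof -
        have "2 * (\<epsilon> / 8 * (2 * real h + 2) / Q) / (real h + 1) = \<epsilon> / Q / 2"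
        proof -
          have "2 * (\<epsilon> / 8 * (2 * r) / Q) / r = \<epsilon> / Q / 2" if "r > 0" for r :: real using that Q by simp
          from this[of "real h + 1"] show ?thesis by (simp add: algebra_simps)
        qed
        also have "\<dots> < \<epsilon> / Q"
        proof -
          have "\<epsilon> / Q > 0" using \<epsilon> Q by simp
          moreover have "x / 2 < x" if "x > 0" for x :: real using that by simp
          ultimately show ?thesis by blast
        qed
        finally show ?thesis .
      qed
      have "\<epsilon> / 8 > 0" using \<epsilon> by simp
      from card_Exc_window_eventually_le[OF h2 this \<alpha>(1) lim]
      show "\<forall>\<^sub>F B::nat in sequentially. real (card (Exc \<inter> {k * Q^2 * (int h * int B^15)^2..k * Q^2 * (int (h + 1) * int B^15)^2}))
          \<le> \<epsilon> / 8 * (2 * real h + 2) / Q * (k * Q^2) * real B^30"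
      proof eventually_elim
        case (elim B)
        have "\<epsilon> / 8 * (k * Q * (2 * real h + 2)) * real B^30 = \<epsilon> / 8 * (2 * real h + 2) / Q * (k * Q^2) * real B^30"
          using Q by (simp add: power2_eq_square)
        from elim this show ?case by (rule ord_le_eq_trans)
      qed
    qed
  qed
qed

section \<open>Almost all locally represented integers\<close>

definition null_set :: "int set \<Rightarrow> bool" where
  "null_set E \<longleftrightarrow> (\<forall>\<epsilon>>0. \<forall>\<^sub>F X::nat in sequentially. real (card (E \<inter> {1..int X})) \<le> \<epsilon> * real X)"

lemma null_set_mono:
  assumes "null_set E" "E' \<inter> {1..} \<subseteq> E"
  shows "null_set E'"
  unfolding null_set_def
proof (intro allI impI)
  fix \<epsilon> :: real assume "\<epsilon> > 0"
  then have "\<forall>\<^sub>F X::nat in sequentially. real (card (E \<inter> {1..int X})) \<le> \<epsilon> * real X" using assms by (simp add: null_set_def)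
  then show "\<forall>\<^sub>F X::nat in sequentially. real (card (E' \<inter> {1..int X})) \<le> \<epsilon> * real X"
  proof eventually_elim
    case (elim X)
    have "card (E' \<inter> {1..int X}) \<le> card (E \<inter> {1..int X})" using assms(2) by (intro card_mono) auto
    with elim show ?case by linarith
  qed
qed

lemma null_set_empty: "null_set {}"
  unfolding null_set_def by (auto intro!: always_eventually)

lemma null_set_Un:
  assumes "null_set A" "null_set B"
  shows "null_set (A \<union> B)"
  unfolding null_set_def
proof (intro allI impI)
  fix \<epsilon> :: real assume "\<epsilon> > 0"
  then have "\<epsilon> / 2 > 0" by simp
  then have "\<forall>\<^sub>F X::nat in sequentially. real (card (A \<inter> {1..int X})) \<le> \<epsilon> / 2 * real X"
    "\<forall>\<^sub>F X::nat in sequentially. real (card (B \<inter> {1..int X})) \<le> \<epsilon> / 2 * real X"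
    using assms unfolding null_set_def by blast+
  then show "\<forall>\<^sub>F X::nat in sequentially. real (card ((A \<union> B) \<inter> {1..int X})) \<le> \<epsilon> * real X"
  proof eventually_elim
    case (elim X)
    have "card ((A \<union> B) \<inter> {1..int X}) \<le> card (A \<inter> {1..int X}) + card (B \<inter> {1..int X})"
      by (metis Int_Un_distrib2 card_Un_le)
    then have "real (card ((A \<union> B) \<inter> {1..int X})) \<le> real (card (A \<inter> {1..int X})) + real (card (B \<inter> {1..int X}))" by linarith
    also have "\<dots> \<le> \<epsilon> / 2 * real X + \<epsilon> / 2 * real X" using elim by (rule add_mono)
    also have "\<dots> = \<epsilon> * real X" by simp
    finally show ?case .
  qed
qed

lemma null_set_UN:
  assumes "finite I" "\<And>i. i \<in> I \<Longrightarrow> null_set (A i)"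
  shows "null_set (\<Union>i\<in>I. A i)"
  using assms by (induction I rule: finite_induct) (auto intro: null_set_empty null_set_Un)

text \<open>Any map that does not decrease positive elements preserves nullity; this covers dilations and translations.\<close>

lemma null_set_image:
  assumes "null_set E" "\<And>e. e \<in> E \<Longrightarrow> 1 \<le> f e \<Longrightarrow> 1 \<le> e \<and> e \<le> f e"
  shows "null_set (f ` E)"
  unfolding null_set_def
proof (intro allI impI)
  fix \<epsilon> :: real assume "\<epsilon> > 0"
  then have "\<forall>\<^sub>F X::nat in sequentially. real (card (E \<inter> {1..int X})) \<le> \<epsilon> * real X" using assms by (simp add: null_set_def)
  then show "\<forall>\<^sub>F X::nat in sequentially. real (card (f ` E \<inter> {1..int X})) \<le> \<epsilon> * real X"
  proof eventually_elim
    case (elim X)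
    have "f ` E \<inter> {1..int X} \<subseteq> f ` (E \<inter> {1..int X})" using assms(2) by fastforce
    then have "card (f ` E \<inter> {1..int X}) \<le> card (f ` (E \<inter> {1..int X}))" by (intro card_mono) auto
    also have "\<dots> \<le> card (E \<inter> {1..int X})" by (rule card_image_le) auto
    finally show ?case using elim by linarith
  qed
qed

section \<open>Gluing local solutions\<close>

lemma chinese_remainder_primes_int:
  fixes S :: "int set"
  assumes "finite S" "\<And>p. p \<in> S \<Longrightarrow> prime p"
  shows "\<exists>x. \<forall>p\<in>S. [x = f p] (mod p)"
  using assms
proof (induction S rule: finite_induct)
  case (insert p S)
  then obtain x where x: "\<forall>q\<in>S. [x = f q] (mod q)" by auto
  have "coprime p (\<Prod>S)"
  proof (rule prod_coprime_right)
    fix q assume "q \<in> S"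
    then show "coprime p q" using insert by (metis insertCI primes_coprime)
  qed
  then obtain y where y: "[y = f p] (mod p)" "[y = x] (mod \<Prod>S)"
    using binary_chinese_remainder_int by blast
  have "[y = f q] (mod q)" if "q \<in> S" for q
  proof -
    have "q dvd \<Prod>S" using dvd_prodI[of S q "\<lambda>x. x"] insert(1) that by simp
    then have "[y = x] (mod q)" using y(2) by (rule cong_dvd_modulus[rotated])
    with x that show ?thesis by (metis cong_trans)
  qed
  with y(1) show ?case by auto
qed simp

lemma prod_primes_dvd:
  fixes S :: "int set"
  assumes "finite S" "\<And>p. p \<in> S \<Longrightarrow> prime p" "\<And>p. p \<in> S \<Longrightarrow> p dvd n"
  shows "\<Prod>S dvd n"
  using assms
proof (induction S rule: finite_induct)
  case (insert p S)
  have "coprime p (\<Prod>S)"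
  proof (rule prod_coprime_right)
    fix q assume "q \<in> S"
    then show "coprime p q" using insert by (metis insertCI primes_coprime)
  qed
  with insert show ?case by (simp add: divides_mult)
qed simp

text \<open>Solvability is asked only modulo primes: \<open>2 * y + z\<close>, the derivative in
  \<open>y\<close>, is a unit there, and powers of the primes are covered by equidistribution within
  the class modulo \<open>Q\<close>. Each \<open>\<epsilon>\<close> gets its own squarefree modulus
  \<open>Q\<close>, and each residue modulo \<open>Q\<close> its own base point; the linear
  condition is imposed on the base point and inherited by its whole class.\<close>

lemma almost_all_represented:
  fixes k c \<alpha> \<beta> \<gamma> :: int and G A :: "int set"
  assumes kc: "k \<ge> 1" "c \<ge> 1" and A: "finite A" "\<And>p. p \<in> A \<Longrightarrow> prime p"
    and loc: "\<And>N p. N \<in> G \<Longrightarrow> prime p \<Longrightarrow> \<exists>x y z. [k * x^2 + bqf c y z = N] (mod p) \<and> \<not> p dvd 2 * y + z \<and>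
      (p \<in> A \<longrightarrow> p dvd \<alpha> * x + \<beta> * y + \<gamma> * z)"
  shows "null_set {N \<in> G. \<not> (\<exists>x y z. N = k * x^2 + bqf c y z \<and> \<Prod>A dvd \<alpha> * x + \<beta> * y + \<gamma> * z)}"
  unfolding null_set_def
proof (intro allI impI)
  let ?bad = "{N \<in> G. \<not> (\<exists>x y z. N = k * x^2 + bqf c y z \<and> \<Prod>A dvd \<alpha> * x + \<beta> * y + \<gamma> * z)}"
  fix \<epsilon> :: real assume \<epsilon>: "\<epsilon> > 0"
  obtain P where P: "P \<ge> 1" "\<And>Q x0 y0 z0. shifted_form k c Q x0 y0 z0 P \<Longrightarrow>
    \<forall>\<^sub>F X::nat in sequentially. real (card (shifted_form.Exc k c Q x0 y0 z0 \<inter> {1..int X})) \<le> \<epsilon> / Q * real X"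
    using exceptional_set_sparse[OF \<epsilon> kc] by blast
  \<comment> \<open>Large enough for \<open>Q\<close> to contain all primes up to \<open>P\<close>,
    all primes dividing \<open>2 * k * (4 * c - 1)\<close> and all primes of
    \<open>A\<close>.\<close>
  define B where "B = P + 2 * k * (4 * c - 1) + (\<Sum>A)"
  define S where "S = {p. prime p \<and> p \<le> B}"
  define Q where "Q = \<Prod>S"
  have fS: "finite S" unfolding S_def by (rule finite_subset[of _ "{0..B}"]) (auto simp: prime_ge_0_int)
  have primeS: "prime p" if "p \<in> S" for p using that by (simp add: S_def)
  have Q0: "Q > 0" unfolding Q_def using primeS by (intro prod_pos) (auto dest: prime_gt_0_int)
  have dvdQ: "p dvd Q" if "p \<in> S" for p unfolding Q_def using fS that by (rule dvd_prodI)
  have A0: "p \<ge> 0" if "p \<in> A" for p using A(2)[OF that] prime_ge_0_int by blast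
  have "0 < k * (4 * c - 1)" using kc by simp
  then have B: "P \<le> B" "2 * k * (4 * c - 1) \<le> B" "\<Sum>A \<le> B" using P(1) sum_nonneg[of A "\<lambda>x. x"] A0 by (auto simp: B_def)
  have AS: "A \<subseteq> S"
  proof
    fix p assume p: "p \<in> A"
    have "p \<le> \<Sum>A" using member_le_sum[of p A "\<lambda>x. x"] p A A0 by simp
    then show "p \<in> S" using A p B by (simp add: S_def)
  qed
  let ?bad' = "\<lambda>r. {N \<in> ?bad. N mod Q = r}"
  have res: "\<forall>\<^sub>F X::nat in sequentially. real (card (?bad' r \<inter> {1..int X})) \<le> \<epsilon> / Q * real X" for r
  proof (cases "\<exists>N\<in>G. N mod Q = r")
    case False
    then have "?bad' r = {}" by auto
    then have "card (?bad' r \<inter> {1..int X}) = 0" for X by (simp only: Int_empty_left card.empty)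
    then show ?thesis using \<epsilon> Q0 by (intro always_eventually allI) simp
  next
    case True
    \<comment> \<open>A single element of \<open>G\<close> in the class supplies the base point for
      all elements of that class.\<close>
    then obtain M where M: "M \<in> G" "M mod Q = r" by blast
    have "\<forall>p. \<exists>x y z. prime p \<longrightarrow> [k * x^2 + bqf c y z = M] (mod p) \<and> \<not> p dvd 2 * y + z \<and> (p \<in> A \<longrightarrow> p dvd \<alpha> * x + \<beta> * y + \<gamma> * z)"
      using loc[OF M(1)] by blast
    then obtain fx fy fz where f: "\<And>p. prime p \<Longrightarrow> [k * (fx p)^2 + bqf c (fy p) (fz p) = M] (mod p)"
      "\<And>p. prime p \<Longrightarrow> \<not> p dvd 2 * fy p + fz p" "\<And>p. prime p \<Longrightarrow> p \<in> A \<Longrightarrow> p dvd \<alpha> * fx p + \<beta> * fy p + \<gamma> * fz p"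
      by metis
    have crt: "\<exists>x\<in>{0..<Q}. \<forall>p\<in>S. [x = g p] (mod p)" for g
    proof -
      obtain x where x: "\<forall>p\<in>S. [x = g p] (mod p)" using chinese_remainder_primes_int[OF fS primeS] by blast
      have "[x mod Q = g p] (mod p)" if "p \<in> S" for p
      proof -
        have "[x mod Q = x] (mod Q)" by simp
        then have "[x mod Q = x] (mod p)" using dvdQ[OF that] by (rule cong_dvd_modulus)
        with x that show ?thesis by (metis cong_trans)
      qed
      then show ?thesis using Q0 by (intro bexI[of _ "x mod Q"]) auto
    qed
    from crt[of fx] obtain x0 where x0: "x0 \<in> {0..<Q}" "\<And>p. p \<in> S \<Longrightarrow> [x0 = fx p] (mod p)" by blast
    from crt[of fy] obtain y0 where y0: "y0 \<in> {0..<Q}" "\<And>p. p \<in> S \<Longrightarrow> [y0 = fy p] (mod p)" by blast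
    from crt[of fz] obtain z0 where z0: "z0 \<in> {0..<Q}" "\<And>p. p \<in> S \<Longrightarrow> [z0 = fz p] (mod p)" by blast
    have lin: "[a * x0 + b * y0 + d * z0 = a * fx p + b * fy p + d * fz p] (mod p)" if "p \<in> S" for p a b d
      using x0(2)[OF that] y0(2)[OF that] z0(2)[OF that] by (intro cong_add cong_mult cong_refl)
    have "shifted_form k c Q x0 y0 z0 P"
    proof
      fix p assume p: "prime p" "p dvd 2 * k * (4 * c - 1)"
      then have "p \<le> 2 * k * (4 * c - 1)" using kc by (intro zdvd_imp_le) auto
      then show "p dvd Q" using p B by (intro dvdQ) (simp add: S_def)
    next
      show "coprime (2 * y0 + z0) Q" unfolding Q_def
      proof (rule prod_coprime_right)
        fix p assume p: "p \<in> S"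
        have "[2 * y0 + z0 = 2 * fy p + fz p] (mod p)" using lin[OF p, of 0 2 1] by simp
        then have "\<not> p dvd 2 * y0 + z0" using f(2)[OF primeS[OF p]] by (metis cong_dvd_iff)
        then show "coprime (2 * y0 + z0) p" using primeS[OF p] by (metis coprime_commute prime_imp_coprime)
      qed
    next
      fix d :: int assume d: "d > 1" "coprime d Q"
      show "d > P"
      proof (rule ccontr)
        assume "\<not> d > P"
        obtain p where p: "prime p" "p dvd d" using prime_divisor_exists[of d] d(1) by auto
        have "p \<le> d" using p d by (intro zdvd_imp_le) auto
        then have "p dvd Q" using \<open>\<not> d > P\<close> B p by (intro dvdQ) (simp add: S_def)
        then show False using d p by (metis coprime_common_divisor not_prime_unit)
      qed
    qed (use kc Q0 x0 y0 z0 P in auto)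
    then interpret sf: shifted_form k c Q x0 y0 z0 P .
    have N0: "[k * x0^2 + bqf c y0 z0 = M] (mod Q)"
    proof -
      have "p dvd k * x0^2 + bqf c y0 z0 - M" if "p \<in> S" for p
      proof -
        have "[k * x0^2 + bqf c y0 z0 = k * (fx p)^2 + bqf c (fy p) (fz p)] (mod p)"
          using x0(2)[OF that] y0(2)[OF that] z0(2)[OF that] by (intro cong_add cong_mult cong_refl cong_pow bqf_mod)
        also have "[k * (fx p)^2 + bqf c (fy p) (fz p) = M] (mod p)" by (rule f(1)[OF primeS[OF that]])
        finally show ?thesis by (simp add: cong_iff_dvd_diff)
      qed
      then show ?thesis unfolding Q_def cong_iff_dvd_diff by (intro prod_primes_dvd fS primeS)
    qed
    have "?bad' r \<subseteq> sf.Exc"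
    proof
      fix N assume N: "N \<in> ?bad' r"
      have "[N = M] (mod Q)" using N M by (auto simp: unique_euclidean_semiring_class.cong_def)
      then have 1: "[N = k * x0^2 + bqf c y0 z0] (mod Q)" using N0 by (metis cong_sym cong_trans)
      have 2: "\<not> (\<exists>x y z. [x = x0] (mod Q) \<and> [y = y0] (mod Q) \<and> [z = z0] (mod Q) \<and> N = k * x^2 + bqf c y z)"
      proof clarify
        fix x y z assume c: "[x = x0] (mod Q)" "[y = y0] (mod Q)" "[z = z0] (mod Q)" and Nv: "N = k * x^2 + bqf c y z"
        have "\<Prod>A dvd \<alpha> * x + \<beta> * y + \<gamma> * z"
        proof (rule prod_primes_dvd[OF A])
          fix p assume p: "p \<in> A"
          then have pS: "p \<in> S" using AS by auto
          have "[\<alpha> * x + \<beta> * y + \<gamma> * z = \<alpha> * x0 + \<beta> * y0 + \<gamma> * z0] (mod Q)" using c by (intro cong_add cong_mult cong_refl)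
          then have "[\<alpha> * x + \<beta> * y + \<gamma> * z = \<alpha> * x0 + \<beta> * y0 + \<gamma> * z0] (mod p)" using dvdQ[OF pS] by (rule cong_dvd_modulus)
          also note lin[OF pS, of \<alpha> \<beta> \<gamma>]
          finally show "p dvd \<alpha> * x + \<beta> * y + \<gamma> * z" using f(3)[OF primeS[OF pS] p] by (metis cong_dvd_iff)
        qed
        with Nv N show False by blast
      qed
      from 1 2 show "N \<in> sf.Exc" unfolding sf.Exc_def by simp
    qed
    then have le: "card (?bad' r \<inter> {1..int X}) \<le> card (sf.Exc \<inter> {1..int X})" for X by (intro card_mono) auto
    have "\<forall>\<^sub>F X::nat in sequentially. real (card (sf.Exc \<inter> {1..int X})) \<le> \<epsilon> / Q * real X"
      by (rule P(2)[OF sf.shifted_form_axioms])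
    then show ?thesis
    proof eventually_elim
      case (elim X)
      have "real (card (?bad' r \<inter> {1..int X})) \<le> real (card (sf.Exc \<inter> {1..int X}))"
        using le by (simp only: of_nat_le_iff)
      with elim show ?case by (rule order_trans[rotated])
    qed
  qed
  have "\<forall>\<^sub>F X::nat in sequentially. \<forall>r\<in>{0..<Q}. real (card (?bad' r \<inter> {1..int X})) \<le> \<epsilon> / Q * real X"
    using res by (intro eventually_ball_finite) auto
  then show "\<forall>\<^sub>F X::nat in sequentially. real (card (?bad \<inter> {1..int X})) \<le> \<epsilon> * real X"
  proof eventually_elim
    case (elim X)
    have "?bad \<inter> {1..int X} \<subseteq> (\<Union>r\<in>{0..<Q}. ?bad' r \<inter> {1..int X})" using Q0 by auto
    then have "card (?bad \<inter> {1..int X}) \<le> card (\<Union>r\<in>{0..<Q}. ?bad' r \<inter> {1..int X})" by (intro card_mono) auto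
    also have "\<dots> \<le> (\<Sum>r\<in>{0..<Q}. card (?bad' r \<inter> {1..int X}))" by (rule card_UN_le) simp
    finally have "real (card (?bad \<inter> {1..int X})) \<le> (\<Sum>r\<in>{0..<Q}. real (card (?bad' r \<inter> {1..int X})))"
      by (simp only: of_nat_sum[symmetric] of_nat_le_iff)
    also have "\<dots> \<le> (\<Sum>r\<in>{0..<Q}. \<epsilon> / Q * real X)" using elim by (intro sum_mono) blast
    also have "\<dots> = \<epsilon> * real X" using Q0 by simp
    finally show ?case .
  qed
qed

section \<open>Quadratic forms modulo primes\<close>

text \<open>Pigeonhole: \<open>\<alpha> * x^2\<close> and \<open>t - \<beta> * z^2\<close> each take
  (p + 1) / 2 residues modulo \<open>p\<close>, so they share one.\<close>

lemma diagonal_form_universal_mod_prime: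
  fixes p \<alpha> \<beta> t :: int
  assumes p: "prime p" "odd p" and "\<not> p dvd \<alpha>" "\<not> p dvd \<beta>"
  shows "\<exists>x z. [\<alpha> * x^2 + \<beta> * z^2 = t] (mod p)"
proof -
  obtain m where m: "p = 2 * m + 1" using p by (elim oddE)
  have m0: "m \<ge> 0" using prime_gt_0_int[OF p(1)] m by simp
  have inj: "inj_on (\<lambda>x. (a * x^2 + b) mod p) {0..m}" if "\<not> p dvd a" for a b
  proof (rule inj_onI)
    fix x y assume xy: "x \<in> {0..m}" "y \<in> {0..m}" "(a * x^2 + b) mod p = (a * y^2 + b) mod p"
    then have "p dvd (a * x^2 + b) - (a * y^2 + b)" by (simp add: mod_eq_dvd_iff)
    then have "p dvd a * ((x - y) * (x + y))" by (simp add: power2_eq_square algebra_simps)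
    then have "p dvd x - y \<or> p dvd x + y" using p(1) that by (simp add: prime_dvd_mult_iff)
    then show "x = y"
    proof
      assume "p dvd x - y"
      then have "x mod p = y mod p" by (simp add: mod_eq_dvd_iff)
      then show ?thesis using xy m m0 by simp
    next
      assume "p dvd x + y"
      then have "x + y = 0" using xy m zdvd_imp_le[of p "x + y"] by fastforce
      then show ?thesis using xy by simp
    qed
  qed
  let ?A = "(\<lambda>x. (\<alpha> * x^2 + 0) mod p) ` {0..m}" and ?B = "(\<lambda>x. ((- \<beta>) * x^2 + t) mod p) ` {0..m}"
  have cA: "card ?A = nat (m + 1)" using inj[OF assms(3), of 0] by (subst card_image) auto
  have cB: "card ?B = nat (m + 1)" using inj[of "- \<beta>" t] assms(4) by (subst card_image) auto
  have "?A \<inter> ?B \<noteq> {}"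
  proof
    assume "?A \<inter> ?B = {}"
    then have "card (?A \<union> ?B) = nat (m + 1) + nat (m + 1)" using cA cB by (subst card_Un_disjoint) auto
    moreover have "?A \<union> ?B \<subseteq> {0..<p}" using prime_gt_0_int[OF p(1)] by auto
    then have "card (?A \<union> ?B) \<le> nat p" using card_mono[of "{0..<p}" "?A \<union> ?B"] by simp
    ultimately show False using m m0 by simp
  qed
  then obtain x z where "(\<alpha> * x^2 + 0) mod p = ((- \<beta>) * z^2 + t) mod p" by blast
  then have "p dvd (\<alpha> * x^2 + 0) - ((- \<beta>) * z^2 + t)" by (simp only: mod_eq_dvd_iff)
  then have "[\<alpha> * x^2 + \<beta> * z^2 = t] (mod p)" by (simp add: cong_iff_dvd_diff algebra_simps)
  then show ?thesis by blast
qed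

lemma inverse_mod_prime:
  fixes p a :: int
  assumes "prime p" "\<not> p dvd a"
  shows "\<exists>b. [a * b = 1] (mod p)"
proof -
  have "coprime a p" using assms by (metis coprime_commute prime_imp_coprime)
  then show ?thesis by (rule cong_solve_coprime_int)
qed

lemma solve_linear_mod_prime:
  fixes p a t :: int
  assumes "prime p" "\<not> p dvd a"
  shows "\<exists>b. [a * b = t] (mod p)"
proof -
  obtain b where "[a * b = 1] (mod p)" using inverse_mod_prime[OF assms] by blast
  from cong_scalar_right[OF this, of t] have "[a * (b * t) = t] (mod p)" by (simp add: mult.assoc)
  then show ?thesis by blast
qed

text \<open>If \<open>z\<close> were invertible, \<open>- w\<close> would be the square of
  \<open>s / z\<close>.\<close>

lemma anisotropic_mod_prime:
  fixes p w z s :: int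
  assumes p: "prime p" and w: "\<not> QuadRes p (- w)" and d: "p dvd w * z^2 + s^2"
  shows "p dvd z \<and> p dvd s"
proof (cases "p dvd z")
  case True
  then have "p dvd w * z^2" by (simp add: power2_eq_square)
  then have "p dvd s^2" using d by (simp add: dvd_add_right_iff)
  then show ?thesis using True p prime_dvd_power by blast
next
  case False
  obtain b where b: "[z * b = 1] (mod p)" using inverse_mod_prime[OF p False] by blast
  have "[s^2 = - w * z^2] (mod p)" using d by (simp add: cong_iff_dvd_diff algebra_simps)
  from cong_scalar_right[OF this, of "b^2"] have "[(s * b)^2 = - w * (z * b)^2] (mod p)"
    by (simp add: power_mult_distrib mult.assoc)
  also have "[- w * (z * b)^2 = - w * 1^2] (mod p)" using b by (intro cong_mult cong_pow cong_refl)
  finally have "QuadRes p (- w)" unfolding QuadRes_def by auto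
  then show ?thesis using w by simp
qed

text \<open>The form is the norm of s + z sqrt(-w). A representation with a vanishing coordinate is
  multiplied by the element (1 + sqrt(-w))^2 / (1 + w) of norm 1, up to sign, which makes both
  coordinates nonzero; \<open>v\<close> is the inverse of \<open>w + 1\<close>, a unit because
  \<open>- w\<close> is a nonresidue and so differs from 1.\<close>

lemma anisotropic_values_mod_prime:
  fixes p w n :: int
  assumes p: "prime p" "odd p" and w: "\<not> QuadRes p (- w)" and n: "\<not> p dvd n"
  shows "\<exists>z s. [w * z^2 + s^2 = n] (mod p) \<and> \<not> p dvd s" "\<exists>z s. [w * z^2 + s^2 = n] (mod p) \<and> \<not> p dvd z"
proof -
  have w0: "\<not> p dvd w"
  proof
    assume "p dvd w"
    then have "[0^2 = - w] (mod p)" by (simp add: cong_iff_dvd_diff)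
    then show False using w unfolding QuadRes_def by blast
  qed
  have w1: "\<not> p dvd w + 1"
  proof
    assume "p dvd w + 1"
    then have "[1^2 = - w] (mod p)" by (simp add: cong_iff_dvd_diff add.commute)
    then show False using w unfolding QuadRes_def by blast
  qed
  have two: "\<not> p dvd 2" using p by (metis dvd_refl prime_int_numeral_eq primes_dvd_imp_eq two_is_prime_nat even_numeral)
  obtain v where v: "[(w + 1) * v = 1] (mod p)" using inverse_mod_prime[OF p(1) w1] by blast
  have v0: "\<not> p dvd v"
  proof
    assume "p dvd v"
    then have "[(w + 1) * v = 0] (mod p)" by (simp add: cong_iff_dvd_diff)
    with v have "[1 = 0] (mod p)" by (metis cong_sym cong_trans)
    then have "p dvd 1" by (simp only: cong_iff_dvd_diff diff_0_right)
    then show False using p(1) not_prime_unit by blast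
  qed
  have "\<not> p dvd 1" using p(1) not_prime_unit by blast
  then obtain z s where zs: "[w * z^2 + s^2 = n] (mod p)"
    using diagonal_form_universal_mod_prime[OF p w0, of 1 n] by auto
  have resc: "[((w + 1) * v)^2 * n = 1^2 * n] (mod p)" using v by (intro cong_mult cong_pow cong_refl)
  show "\<exists>z s. [w * z^2 + s^2 = n] (mod p) \<and> \<not> p dvd s"
  proof (cases "p dvd s")
    case False
    then show ?thesis using zs by blast
  next
    case True
    have z: "[w * z^2 = n] (mod p)"
    proof -
      have "[w * z^2 + s^2 = w * z^2 + 0] (mod p)" using True by (simp add: cong_iff_dvd_diff power2_eq_square)
      with zs show ?thesis by (metis add.right_neutral cong_sym cong_trans)
    qed
    then have z0: "\<not> p dvd z" using n by (metis cong_dvd_iff dvd_mult dvd_power zero_less_numeral dvd_trans)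
    let ?z = "(w - 1) * v * z" and ?s = "2 * w * v * z"
    have "w * ?z^2 + ?s^2 = ((w + 1) * v)^2 * (w * z^2)" by (simp add: power2_eq_square algebra_simps)
    also have "[((w + 1) * v)^2 * (w * z^2) = ((w + 1) * v)^2 * n] (mod p)" using z by (rule cong_scalar_left)
    also note resc
    finally have "[w * ?z^2 + ?s^2 = n] (mod p)" by simp
    moreover have "\<not> p dvd ?s" using two w0 v0 z0 p(1) by (simp add: prime_dvd_mult_iff)
    ultimately show ?thesis by blast
  qed
  show "\<exists>z s. [w * z^2 + s^2 = n] (mod p) \<and> \<not> p dvd z"
  proof (cases "p dvd z")
    case False
    then show ?thesis using zs by blast
  next
    case True
    have s: "[s^2 = n] (mod p)"
    proof -
      have "[w * z^2 + s^2 = 0 + s^2] (mod p)" using True by (simp add: cong_iff_dvd_diff power2_eq_square)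
      with zs show ?thesis by (metis add.left_neutral cong_sym cong_trans)
    qed
    then have s0: "\<not> p dvd s" using n by (metis cong_dvd_iff dvd_power zero_less_numeral dvd_trans)
    let ?s = "(1 - w) * v * s" and ?z = "2 * v * s"
    have "w * ?z^2 + ?s^2 = ((w + 1) * v)^2 * (s^2)" by (simp add: power2_eq_square algebra_simps)
    also have "[((w + 1) * v)^2 * s^2 = ((w + 1) * v)^2 * n] (mod p)" using s by (rule cong_scalar_left)
    also note resc
    finally have "[w * ?z^2 + ?s^2 = n] (mod p)" by simp
    moreover have "\<not> p dvd ?z" using two v0 s0 p(1) by (simp add: prime_dvd_mult_iff)
    ultimately show ?thesis by blast
  qed
qed

lemma quadratic_nonresidue_exists:
  fixes p :: int
  assumes p: "prime p" "odd p"
  shows "\<exists>a. \<not> QuadRes p a"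
proof (rule ccontr)
  assume "\<not> ?thesis"
  then have all: "QuadRes p a" for a by blast
  obtain m where m: "p = 2 * m + 1" using p by (elim oddE)
  have p2: "p > 2" using p prime_ge_2_int[of p] by (cases "p = 2") auto
  have "{0..<p} \<subseteq> (\<lambda>x. x^2 mod p) ` {0..m}"
  proof
    fix a assume a: "a \<in> {0..<p}"
    obtain y where y: "[y^2 = a] (mod p)" using all[of a] unfolding QuadRes_def by blast
    define r where "r = y mod p"
    have r: "0 \<le> r" "r < p" using p2 by (auto simp: r_def)
    have ra: "r^2 mod p = a" using y a by (simp add: r_def power_mod unique_euclidean_semiring_class.cong_def)
    show "a \<in> (\<lambda>x. x^2 mod p) ` {0..m}"
    proof (cases "r \<le> m")
      case True
      then show ?thesis using r ra by auto
    next
      case False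
      have "(p - r)^2 mod p = r^2 mod p"
      proof -
        have "(p - r)^2 - r^2 = p * (p - 2 * r)" by (simp add: power2_eq_square algebra_simps)
        then show ?thesis by (simp add: mod_eq_dvd_iff)
      qed
      then show ?thesis using r ra m False by (intro image_eqI[of _ _ "p - r"]) auto
    qed
  qed
  then have "card {0..<p} \<le> card ((\<lambda>x. x^2 mod p) ` {0..m})" by (intro card_mono) auto
  also have "\<dots> \<le> card {0..m}" by (rule card_image_le) simp
  finally show False using m p2 by simp
qed

lemma QuadRes_cong:
  assumes "[a = b] (mod p)" "QuadRes p a"
  shows "QuadRes p b"
  using assms unfolding QuadRes_def by (metis cong_trans)

text \<open>If no \<open>\<lambda>\<^sup>2 + q\<close> were a nonresidue, the squares would be closed under adding \<open>q\<close>.\<close>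

lemma square_plus_nonresidue_exists:
  fixes p q :: int
  assumes p: "prime p" "odd p" and q: "\<not> p dvd q"
  shows "\<exists>l. \<not> QuadRes p (l^2 + q)"
proof (rule ccontr)
  assume "\<not> ?thesis"
  then have all: "QuadRes p (l^2 + q)" for l by blast
  have step: "QuadRes p (a + q)" if "QuadRes p a" for a
  proof -
    obtain y where "[y^2 = a] (mod p)" using \<open>QuadRes p a\<close> unfolding QuadRes_def by blast
    then have "[y^2 + q = a + q] (mod p)" by (intro cong_add cong_refl)
    then show ?thesis by (rule QuadRes_cong[OF _ all])
  qed
  have iter: "QuadRes p (int n * q)" for n
  proof (induction n)
    case 0
    show ?case unfolding QuadRes_def by (intro exI[of _ 0]) simp
  next
    case (Suc n)
    then show ?case using step[of "int n * q"] by (simp add: algebra_simps)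
  qed
  obtain a where a: "\<not> QuadRes p a" using quadratic_nonresidue_exists[OF p] by blast
  obtain b where b: "[q * b = a] (mod p)" using solve_linear_mod_prime[OF p(1) q] by blast
  have p0: "p > 0" using p(1) prime_gt_0_int by blast
  have "[int (nat (b mod p)) * q = b * q] (mod p)" using p0 by (intro cong_mult cong_refl) simp
  also have "[b * q = a] (mod p)" using b by (simp add: mult.commute)
  finally show False using a QuadRes_cong[OF _ iter] by blast
qed

text \<open>If -1 is a square, the sign is harmless and (2l)^2 + q has to be a nonresidue. Otherwise
  it suffices that (2l)^2 + q be a nonzero square, and the identity ((q - 1) / 2)^2 + q = ((q + 1) /
  2)^2 provides one; this is where \<open>q + 1\<close> must be a unit.\<close>

lemma anisotropic_plane_exists:
  fixes p q :: int
  assumes p: "prime p" "odd p" and q: "\<not> p dvd q" "\<not> p dvd q + 1"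
  shows "\<exists>l. \<not> QuadRes p (- (4 * l^2 + q))"
proof -
  have two: "\<not> p dvd 2" using p by (metis dvd_refl prime_int_numeral_eq primes_dvd_imp_eq two_is_prime_nat even_numeral)
  obtain h where h: "[2 * h = 1] (mod p)" using inverse_mod_prime[OF p(1) two] by blast
  have half: "[4 * (h * m)^2 + q = m^2 + q] (mod p)" for m
  proof -
    have "[(2 * h)^2 * m^2 + q = 1^2 * m^2 + q] (mod p)" using h by (intro cong_add cong_mult cong_pow cong_refl)
    then show ?thesis by (simp add: power_mult_distrib mult.assoc)
  qed
  show ?thesis
  proof (cases "QuadRes p (- 1)")
    case True
    then obtain i where i: "[i^2 = - 1] (mod p)" unfolding QuadRes_def by blast
    obtain m where m: "\<not> QuadRes p (m^2 + q)" using square_plus_nonresidue_exists[OF p q(1)] by blast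
    have "\<not> QuadRes p (- (4 * (h * m)^2 + q))"
    proof
      assume "QuadRes p (- (4 * (h * m)^2 + q))"
      then obtain y where "[y^2 = - (4 * (h * m)^2 + q)] (mod p)" unfolding QuadRes_def by blast
      also have "[- (4 * (h * m)^2 + q) = - (m^2 + q)] (mod p)" using half by (simp only: cong_minus_minus_iff)
      finally have "[i^2 * y^2 = - 1 * (- (m^2 + q))] (mod p)" using i by (intro cong_mult)
      then have "[(i * y)^2 = m^2 + q] (mod p)" by (simp add: power_mult_distrib add.commute)
      then show False using m unfolding QuadRes_def by blast
    qed
    then show ?thesis by blast
  next
    case False
    define m where "m = h * (q - 1)"
    define e where "e = h * (q + 1)"
    have "[m^2 + q = e^2] (mod p)"
    proof -
      have "4 * (m^2 + q) - 4 * e^2 = (2 * h)^2 * (q - 1)^2 + 4 * q - (2 * h)^2 * (q + 1)^2"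
        by (simp add: m_def e_def power_mult_distrib)
      also have "\<dots> = 4 * q - (2 * h)^2 * (4 * q)" by (simp add: power2_eq_square algebra_simps)
      also have "[4 * q - (2 * h)^2 * (4 * q) = 4 * q - 1^2 * (4 * q)] (mod p)" using h by (intro cong_diff cong_mult cong_pow cong_refl)
      finally have "p dvd 4 * (m^2 + q) - 4 * e^2" by (simp add: cong_iff_dvd_diff)
      then have "p dvd 2 * (2 * (m^2 + q - e^2))" by (simp add: algebra_simps)
      then have "p dvd m^2 + q - e^2" using two p(1) by (simp only: prime_dvd_mult_iff) simp
      then show ?thesis by (simp add: cong_iff_dvd_diff)
    qed
    with half[of m] have me: "[4 * (h * m)^2 + q = e^2] (mod p)" by (rule cong_trans)
    have h0: "\<not> p dvd h"
    proof
      assume "p dvd h"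
      then have "[2 * h = 0] (mod p)" by (simp add: cong_iff_dvd_diff)
      with h have "[1 = 0] (mod p)" by (metis cong_sym cong_trans)
      then have "p dvd 1" by (simp only: cong_iff_dvd_diff diff_0_right)
      then show False using p(1) not_prime_unit by blast
    qed
    then have e0: "\<not> p dvd e" using q(2) p(1) by (simp add: e_def prime_dvd_mult_iff)
    obtain f where f: "[e * f = 1] (mod p)" using inverse_mod_prime[OF p(1) e0] by blast
    have "\<not> QuadRes p (- (4 * (h * m)^2 + q))"
    proof
      assume "QuadRes p (- (4 * (h * m)^2 + q))"
      then obtain y where "[y^2 = - (4 * (h * m)^2 + q)] (mod p)" unfolding QuadRes_def by blast
      also have "[- (4 * (h * m)^2 + q) = - (e^2)] (mod p)" using me by (simp only: cong_minus_minus_iff)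
      finally have "[y^2 * f^2 = - (e^2) * f^2] (mod p)" by (intro cong_mult cong_refl)
      then have "[(y * f)^2 = - ((e * f)^2)] (mod p)" by (simp add: power_mult_distrib)
      also have "[- ((e * f)^2) = - (1^2)] (mod p)" using f by (simp only: cong_minus_minus_iff) (rule cong_pow)
      finally show False using False unfolding QuadRes_def by auto
    qed
    then show ?thesis by blast
  qed
qed

section \<open>Densities of sets of integers\<close>

text \<open>Counts the positive half only. This also serves the indefinite case, where the sets of
  values that occur are symmetric about 0.\<close>

definition dens :: "int set \<Rightarrow> real \<Rightarrow> bool" where
  "dens S d \<longleftrightarrow> (\<lambda>X::nat. real (card (S \<inter> {1..int X})) / real X) \<longlonglongrightarrow> d"

lemma dens_UNIV: "dens UNIV 1"
proof -
  have "\<forall>\<^sub>F X::nat in sequentially. real (card (UNIV \<inter> {1..int X})) / real X = 1"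
    using eventually_gt_at_top[of 0] by eventually_elim simp
  then show ?thesis unfolding dens_def by (rule tendsto_eventually)
qed

lemma Int_from_one: "A \<inter> {1..int X} = A \<inter> {1..} \<inter> {1..int X}"
  by auto

lemma dens_cong: "S \<inter> {1..} = S' \<inter> {1..} \<Longrightarrow> dens S d \<Longrightarrow> dens S' d"
proof -
  assume eq: "S \<inter> {1..} = S' \<inter> {1..}" and d: "dens S d"
  have "S \<inter> {1..int X} = S' \<inter> {1..int X}" for X
    unfolding Int_from_one[of S] Int_from_one[of S'] eq ..
  then show ?thesis using d unfolding dens_def by (simp only:)
qed

lemma dens_Un_disjoint:
  assumes "dens A a" "dens B b" "A \<inter> B = {}"
  shows "dens (A \<union> B) (a + b)"
proof -
  have "real (card ((A \<union> B) \<inter> {1..int X})) / real X = real (card (A \<inter> {1..int X})) / real X + real (card (B \<inter> {1..int X})) / real X" for X :: nat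
  proof -
    have "card ((A \<union> B) \<inter> {1..int X}) = card (A \<inter> {1..int X}) + card (B \<inter> {1..int X})"
      unfolding Int_Un_distrib2 using assms(3) by (intro card_Un_disjoint) auto
    then show ?thesis by (simp add: add_divide_distrib)
  qed
  then show ?thesis using tendsto_add[OF assms(1,2)[unfolded dens_def]] unfolding dens_def by simp
qed

lemma dens_Diff:
  assumes "dens A a" "dens B b" "B \<subseteq> A"
  shows "dens (A - B) (a - b)"
proof -
  have "real (card ((A - B) \<inter> {1..int X})) / real X = real (card (A \<inter> {1..int X})) / real X - real (card (B \<inter> {1..int X})) / real X" for X :: nat
  proof -
    have "card (A \<inter> {1..int X}) = card ((A - B) \<inter> {1..int X} \<union> B \<inter> {1..int X})" using assms(3) by (intro arg_cong[where f = card]) auto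
    also have "\<dots> = card ((A - B) \<inter> {1..int X}) + card (B \<inter> {1..int X})" by (rule card_Un_disjoint) auto
    finally show ?thesis by (simp add: add_divide_distrib)
  qed
  then show ?thesis using tendsto_diff[OF assms(1,2)[unfolded dens_def]] unfolding dens_def by simp
qed

lemma card_dilation:
  fixes a :: int
  assumes "a \<ge> 1"
  shows "card (((*) a ` S) \<inter> {1..int X}) = card (S \<inter> {1..int (X div nat a)})"
proof -
  have "((*) a ` S) \<inter> {1..int X} = (*) a ` (S \<inter> {1..int (X div nat a)})"
  proof -
    have "1 \<le> a * s \<and> a * s \<le> int X \<longleftrightarrow> 1 \<le> s \<and> s \<le> int (X div nat a)" for s
    proof -
      have "1 \<le> a * s \<longleftrightarrow> 1 \<le> s" using assms by (simp add: int_one_le_iff_zero_less zero_less_mult_iff)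
      moreover have "a * s \<le> int X \<longleftrightarrow> s \<le> int X div a"
      proof
        assume "a * s \<le> int X"
        then have "a * s div a \<le> int X div a" using assms by (intro zdiv_mono1) auto
        then show "s \<le> int X div a" using assms by simp
      next
        assume "s \<le> int X div a"
        then have "a * s \<le> a * (int X div a)" using assms by (intro mult_left_mono) auto
        also have "\<dots> \<le> int X" using mult_div_mod_eq[of a "int X"] pos_mod_sign[of a "int X"] assms by linarith
        finally show "a * s \<le> int X" .
      qed
      ultimately show ?thesis using assms by (simp add: zdiv_int)
    qed
    then show ?thesis by (auto simp: image_iff)
  qed
  moreover have "inj_on ((*) a) (S \<inter> {1..int (X div nat a)})" using assms by (auto simp: inj_on_def)
  ultimately show ?thesis by (simp add: card_image)
qed

lemma dens_dilation:
  fixes a :: int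
  assumes "dens S d" "a \<ge> 1"
  shows "dens ((*) a ` S) (d / a)"
proof -
  let ?b = "nat a"
  have b: "?b > 0" using assms by simp
  have lim: "filterlim (\<lambda>X. X div ?b) at_top sequentially"
  proof -
    have "\<forall>\<^sub>F X in sequentially. Z \<le> X div ?b" for Z
      using eventually_ge_at_top[of "Z * ?b"] by eventually_elim (use b in \<open>simp add: less_eq_div_iff_mult_less_eq\<close>)
    then show ?thesis by (simp add: filterlim_at_top)
  qed
  have 1: "(\<lambda>X. real (card (S \<inter> {1..int (X div ?b)})) / real (X div ?b)) \<longlonglongrightarrow> d"
    using filterlim_compose[OF assms(1)[unfolded dens_def] lim] .
  have 2: "(\<lambda>X. real (X div ?b) / real X) \<longlonglongrightarrow> 1 / a"
  proof (rule tendsto_sandwich)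
    show "\<forall>\<^sub>F X::nat in sequentially. 1 / real_of_int a - 1 / real X \<le> real (X div ?b) / real X"
      using eventually_gt_at_top[of 0]
    proof eventually_elim
      case (elim X)
      have "real X < (real (X div ?b) + 1) * real ?b"
      proof -
        have "X < (X div ?b + 1) * ?b" using b by (metis Suc_eq_plus1 dividend_less_div_times add.commute mult_Suc mult.commute)
        then have "real X < real ((X div ?b + 1) * ?b)" by (simp only: of_nat_less_iff)
        then show ?thesis by (simp only: of_nat_mult of_nat_add of_nat_1)
      qed
      then have "real X / real ?b - 1 \<le> real (X div ?b)" using b by (simp add: field_simps)
      then have "(real X / real ?b - 1) / real X \<le> real (X div ?b) / real X" by (intro divide_right_mono) auto
      then show ?case using elim assms by (simp add: diff_divide_distrib)
    qed
    show "\<forall>\<^sub>F X::nat in sequentially. real (X div ?b) / real X \<le> 1 / real_of_int a"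
      using eventually_gt_at_top[of 0]
    proof eventually_elim
      case (elim X)
      have "real (X div ?b) \<le> real X / real ?b" by (rule of_nat_div_le_of_nat)
      then have "real (X div ?b) / real X \<le> real X / real ?b / real X" by (intro divide_right_mono) auto
      then show ?case using elim assms by simp
    qed
    show "(\<lambda>X. 1 / real_of_int a - 1 / real X) \<longlonglongrightarrow> 1 / real_of_int a" by real_asymp
  qed simp
  have "\<forall>\<^sub>F X in sequentially. real (card (S \<inter> {1..int (X div ?b)})) / real (X div ?b) * (real (X div ?b) / real X) = real (card (((*) a ` S) \<inter> {1..int X})) / real X"
    using eventually_ge_at_top[of ?b]
  proof eventually_elim
    case (elim X)
    then have "X div ?b > 0" using b by (simp add: div_greater_zero_iff)
    then show ?case by (simp add: card_dilation[OF assms(2)])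
  qed
  from Lim_transform_eventually[OF tendsto_mult[OF 1 2] this] show ?thesis unfolding dens_def by simp
qed

lemma dens_null_Diff:
  assumes "dens S d" "null_set (S - S')" "S' \<inter> {1..} \<subseteq> S"
  shows "dens S' d"
proof -
  have "(\<lambda>X::nat. real (card ((S - S') \<inter> {1..int X})) / real X) \<longlonglongrightarrow> 0"
  proof (rule tendstoI)
    fix e :: real assume e: "e > 0"
    then have "e / 2 > 0" by simp
    then have "\<forall>\<^sub>F X::nat in sequentially. real (card ((S - S') \<inter> {1..int X})) \<le> e / 2 * real X" using assms(2) unfolding null_set_def by blast
    then show "\<forall>\<^sub>F X::nat in sequentially. dist (real (card ((S - S') \<inter> {1..int X})) / real X) 0 < e"
      using eventually_gt_at_top[of 0]
    proof eventually_elim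
      case (elim X)
      then have "real (card ((S - S') \<inter> {1..int X})) / real X \<le> e / 2" by (simp only: pos_divide_le_eq of_nat_0_less_iff)
      then have "real (card ((S - S') \<inter> {1..int X})) / real X < e" using e by linarith
      then show ?case by (simp add: dist_real_def)
    qed
  qed
  then have "dens (S - S') 0" by (simp add: dens_def)
  then have "dens ((S - S') \<inter> {1..}) 0" by (rule dens_cong[rotated]) auto
  moreover have "dens (S \<inter> {1..}) d" using assms(1) by (rule dens_cong[rotated]) auto
  ultimately have "dens (S \<inter> {1..} - (S - S') \<inter> {1..}) (d - 0)" by (intro dens_Diff) auto
  then have "dens (S \<inter> {1..} - (S - S') \<inter> {1..}) d" by simp
  then show ?thesis by (rule dens_cong[rotated]) (use assms(3) in auto)
qed

lemma tendsto_ratio_of_bounded: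
  fixes f :: "nat \<Rightarrow> real"
  assumes "\<And>\<epsilon>. \<epsilon> > 0 \<Longrightarrow> \<exists>C. \<forall>X. \<bar>f X - d * real X\<bar> \<le> C + \<epsilon> * real X"
  shows "(\<lambda>X. f X / real X) \<longlonglongrightarrow> d"
proof (rule tendstoI)
  fix e :: real assume e: "e > 0"
  then obtain C where C: "\<forall>X. \<bar>f X - d * real X\<bar> \<le> C + e / 2 * real X" using assms[of "e / 2"] by auto
  have "\<forall>\<^sub>F X::nat in sequentially. real X > \<bar>C\<bar> * 2 / e"
    using filterlim_real_sequentially by (simp add: filterlim_at_top_dense)
  then show "\<forall>\<^sub>F X in sequentially. dist (f X / real X) d < e"
    using eventually_gt_at_top[of 0]
  proof eventually_elim
    case (elim X)
    have "\<bar>f X - d * real X\<bar> \<le> C + e / 2 * real X" using C by blast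
    also have "\<dots> < e * real X"
    proof -
      have "\<bar>C\<bar> * 2 < real X * e" using elim e by (simp add: pos_divide_less_eq)
      moreover have "e / 2 * real X = real X * e / 2" "e * real X = real X * e" by simp_all
      ultimately show ?thesis by linarith
    qed
    finally have "\<bar>f X - d * real X\<bar> / real X < e" using elim by (simp add: pos_divide_less_eq)
    moreover have "dist (f X / real X) d = \<bar>f X - d * real X\<bar> / real X"
      using elim by (simp add: dist_real_def field_simps)
    ultimately show ?case by simp
  qed
qed

lemma dens_periodic_exists:
  fixes M :: nat
  assumes M: "M > 0" and per: "\<And>N. N \<in> S \<longleftrightarrow> N + int M \<in> S"
  shows "\<exists>d. dens S d"
proof -
  define f where "f = (\<lambda>X::nat. real (card (S \<inter> {1..int X})))"
  define s where "s = f M"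
  have shift: "f (X + M) = f X + s" for X
  proof -
    have "S \<inter> {1..int (X + M)} = S \<inter> {1..int M} \<union> (\<lambda>N. N + int M) ` (S \<inter> {1..int X})"
    proof -
      have "N \<in> (\<lambda>N. N + int M) ` (S \<inter> {1..int X})" if "N \<in> S" "N > int M" "N \<le> int (X + M)" for N
        using that per[of "N - int M"] by (intro image_eqI[of _ _ "N - int M"]) auto
      then show ?thesis using per by fastforce
    qed
    then have "card (S \<inter> {1..int (X + M)}) = card (S \<inter> {1..int M}) + card ((\<lambda>N. N + int M) ` (S \<inter> {1..int X}))"
      by (subst card_Un_disjoint[symmetric]) auto
    also have "card ((\<lambda>N. N + int M) ` (S \<inter> {1..int X})) = card (S \<inter> {1..int X})" by (rule card_image) (auto simp: inj_on_def)
    finally show ?thesis by (simp add: f_def s_def)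
  qed
  have f0: "0 \<le> f X" "f X \<le> real X" for X
  proof -
    have "card (S \<inter> {1..int X}) \<le> card {1..int X}" by (intro card_mono) auto
    then show "f X \<le> real X" by (simp add: f_def)
  qed (simp add: f_def)
  have s: "0 \<le> s" "s \<le> real M" unfolding s_def by (rule f0)+
  have bd: "\<bar>f X - s / real M * real X\<bar> \<le> real M" for X
  proof (induction X rule: less_induct)
    case (less X)
    show ?case
    proof (cases "X < M")
      case True
      have "0 \<le> s / real M * real X" using s by simp
      moreover have "s / real M * real X \<le> 1 * real X" using s M by (intro mult_right_mono) auto
      ultimately show ?thesis using f0[of X] True by linarith
    next
      case False
      then have "f X = f (X - M) + s" using shift[of "X - M"] by simp
      moreover have "s / real M * real X = s / real M * real (X - M) + s" using M False by (simp add: of_nat_diff field_simps)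
      ultimately show ?thesis using less.IH[of "X - M"] M False by simp
    qed
  qed
  have "(\<lambda>X. f X / real X) \<longlonglongrightarrow> s / real M"
  proof (rule tendsto_ratio_of_bounded)
    fix e :: real assume "e > 0"
    then show "\<exists>C. \<forall>X. \<bar>f X - s / real M * real X\<bar> \<le> C + e * real X"
      using bd by (intro exI[of _ "real M"] allI) (auto intro: add_increasing2)
  qed
  then show ?thesis unfolding dens_def f_def by blast
qed

text \<open>The counting functions satisfy \<open>f X = g X + f (X div b)\<close>, which forces
  \<open>d = t + d / b\<close>. Errors do not accumulate: the argument at least halves in each step,
  so half of the allowed error \<open>e * X\<close> is free to absorb the error of \<open>g\<close>
  and the rounding.\<close>

lemma dens_self_similar_exists:
  fixes b :: int
  assumes T: "dens T t" and b: "b \<ge> 2" and S: "S \<inter> {1..} = (T \<union> (*) b ` S) \<inter> {1..}" "T \<inter> (*) b ` S = {}"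
  shows "\<exists>d. dens S d"
proof -
  define f where "f = (\<lambda>X::nat. real (card (S \<inter> {1..int X})))"
  define g where "g = (\<lambda>X::nat. real (card (T \<inter> {1..int X})))"
  define d where "d = t * b / (b - 1)"
  have rec: "f X = g X + f (X div nat b)" for X
  proof -
    have "S \<inter> {1..int X} = T \<inter> {1..int X} \<union> ((*) b ` S) \<inter> {1..int X}"
      unfolding Int_from_one[of S] S(1) by auto
    then have "card (S \<inter> {1..int X}) = card (T \<inter> {1..int X}) + card (((*) b ` S) \<inter> {1..int X})"
      using S(2) by (subst card_Un_disjoint[symmetric]) auto
    then show ?thesis using card_dilation[of b S X] b by (simp add: f_def g_def)
  qed
  have g: "\<exists>C\<ge>0. \<forall>X. \<bar>g X - t * real X\<bar> \<le> C + e * real X" if e: "e > 0" for e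
  proof -
    have "\<forall>\<^sub>F X in sequentially. dist (g X / real X) t < e"
      using T e unfolding dens_def g_def by (rule tendstoD)
    then obtain n where n: "\<And>X. X \<ge> n \<Longrightarrow> dist (g X / real X) t < e" unfolding eventually_sequentially by blast
    define C where "C = (\<Sum>X\<le>n. \<bar>g X - t * real X\<bar>)"
    have C0: "C \<ge> 0" unfolding C_def by (rule sum_nonneg) simp
    have "\<bar>g X - t * real X\<bar> \<le> C + e * real X" for X
    proof (cases "X \<le> n")
      case True
      have "\<bar>g X - t * real X\<bar> \<le> C" unfolding C_def using True by (intro member_le_sum[where f = "\<lambda>X. \<bar>g X - t * real X\<bar>"]) auto
      then show ?thesis using e by (simp add: add_increasing2)
    next
      case False
      then have X: "real X > 0" by simp
      have "\<bar>g X / real X - t\<bar> < e" using n[of X] False by (simp add: dist_real_def)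
      then have "\<bar>g X / real X - t\<bar> * real X \<le> e * real X" by (intro mult_right_mono) auto
      moreover have "\<bar>g X / real X - t\<bar> * real X = \<bar>(g X / real X - t) * real X\<bar>" by (simp add: abs_mult)
      moreover have "(g X / real X - t) * real X = g X - t * real X" using X by (simp add: left_diff_distrib)
      ultimately show ?thesis using C0 by simp
    qed
    then show ?thesis using C0 by blast
  qed
  have rb: "real_of_int b \<ge> 2" using b by simp
  have dt: "d = t + d / b" using rb by (simp add: d_def field_simps)
  have "(\<lambda>X. f X / real X) \<longlonglongrightarrow> d"
  proof (rule tendsto_ratio_of_bounded)
    fix e :: real assume e: "e > 0"
    obtain C where C: "C \<ge> 0" "\<And>X. \<bar>g X - t * real X\<bar> \<le> C + e / 4 * real X" using g[of "e / 4"] e by auto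
    obtain n :: nat where n: "real n \<ge> (C + \<bar>d\<bar>) * 4 / e" "n \<ge> 1" using real_arch_simple[of "max 1 ((C + \<bar>d\<bar>) * 4 / e)"] by auto
    define K where "K = (\<Sum>X\<le>n. \<bar>f X - d * real X\<bar>)"
    have "\<bar>f X - d * real X\<bar> \<le> K + e * real X" for X
    proof (induction X rule: less_induct)
      case (less X)
      show ?case
      proof (cases "X \<le> n")
        case True
        have "\<bar>f X - d * real X\<bar> \<le> K" unfolding K_def using True by (intro member_le_sum[where f = "\<lambda>X. \<bar>f X - d * real X\<bar>"]) auto
        then show ?thesis using e by (simp add: add_increasing2)
      next
        case False
        let ?Y = "X div nat b"
        have Y: "?Y < X" using False n b by simp
        have y1: "real ?Y \<le> real X / b" using of_nat_div_le_of_nat[of X "nat b"] b by simp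
        have y2: "real X / b - 1 \<le> real ?Y"
        proof -
          have "X < (?Y + 1) * nat b" using b by (metis Suc_eq_plus1 dividend_less_div_times add.commute mult_Suc mult.commute zero_less_nat_eq less_le_trans zero_less_numeral)
          then have "real X < real ((?Y + 1) * nat b)" by (simp only: of_nat_less_iff)
          then show ?thesis using b by (simp add: field_simps)
        qed
        have "\<bar>d\<bar> * \<bar>real ?Y - real X / b\<bar> \<le> \<bar>d\<bar> * 1" using y1 y2 by (intro mult_left_mono) auto
        then have dY: "\<bar>d * real ?Y - d / b * real X\<bar> \<le> \<bar>d\<bar>" by (simp add: right_diff_distrib flip: abs_mult)
        have "f X - d * real X = (g X - t * real X) + (f ?Y - d * real ?Y) + (d * real ?Y - d / b * real X)"
          unfolding rec[of X] using arg_cong[OF dt, of "\<lambda>u. u * real X"] by (simp add: distrib_right)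
        then have "\<bar>f X - d * real X\<bar> \<le> \<bar>g X - t * real X\<bar> + \<bar>f ?Y - d * real ?Y\<bar> + \<bar>d * real ?Y - d / b * real X\<bar>" by linarith
        also have "\<dots> \<le> (C + e / 4 * real X) + (K + e * real ?Y) + \<bar>d\<bar>"
          using C(2)[of X] less.IH[OF Y] dY by linarith
        also have "e * real ?Y \<le> e * (real X / 2)"
        proof -
          have "real X / b \<le> real X / 2" using rb by (intro divide_left_mono) auto
          with y1 have "real ?Y \<le> real X / 2" by (rule order_trans)
          then show ?thesis using e by (intro mult_left_mono) auto
        qed
        also have "(C + e / 4 * real X) + (K + e * (real X / 2)) + \<bar>d\<bar> \<le> K + e * real X"
        proof -
          have "(C + \<bar>d\<bar>) * 4 / e \<le> real X" using n False by linarith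
          then have "(C + \<bar>d\<bar>) * 4 \<le> e * real X" using e by (simp add: pos_divide_le_eq mult.commute)
          then show ?thesis by (simp add: field_simps)
        qed
        finally show ?thesis by simp
      qed
    qed
    then show "\<exists>C. \<forall>X. \<bar>f X - d * real X\<bar> \<le> C + e * real X" by blast
  qed
  then show ?thesis unfolding dens_def f_def by blast
qed

section \<open>Density of the Euler products\<close>

definition no_simple_prime :: "int set \<Rightarrow> int set" where
  "no_simple_prime A = {N. \<forall>p\<in>A. p dvd N \<longrightarrow> p^2 dvd N}"

definition local_density :: "int \<Rightarrow> real" where
  "local_density p = 1 - 1 / real_of_int p + 1 / real_of_int p ^ 2"

lemma no_simple_prime_mult_prime:
  assumes A: "\<And>r. r \<in> A \<Longrightarrow> prime r" and p: "prime p" "p \<notin> A"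
  shows "p * N \<in> no_simple_prime A \<longleftrightarrow> N \<in> no_simple_prime A"
proof -
  have "(r dvd p * N \<longleftrightarrow> r dvd N) \<and> (r^2 dvd p * N \<longleftrightarrow> r^2 dvd N)" if "r \<in> A" for r
  proof -
    have c: "coprime r p" using A[OF that] p that by (metis primes_coprime)
    then have "coprime (r^2) p" by simp
    with c show ?thesis by (simp add: coprime_dvd_mult_right_iff)
  qed
  then show ?thesis unfolding no_simple_prime_def by auto
qed

text \<open>A new prime \<open>p\<close> removes the multiples of \<open>p\<close> and puts back
  those of \<open>p^2\<close>. As \<open>p\<close> lies outside the old set of primes, both are
  dilates of the old set, with densities scaled by 1 / p and 1 / p^2.\<close>

lemma dens_no_simple_prime:
  assumes "finite A" "\<And>p. p \<in> A \<Longrightarrow> prime p"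
  shows "dens (no_simple_prime A) (\<Prod>p\<in>A. local_density p)"
  using assms
proof (induction A rule: finite_induct)
  case empty
  show ?case using dens_UNIV by (simp add: no_simple_prime_def)
next
  case (insert p A)
  let ?U = "no_simple_prime A" and ?d = "\<Prod>p\<in>A. local_density p"
  have p: "prime p" "p \<ge> 1" using insert prime_ge_1_int by auto
  have U: "dens ?U ?d" using insert by auto
  have m: "p * N \<in> ?U \<longleftrightarrow> N \<in> ?U" for N using insert p by (intro no_simple_prime_mult_prime) auto
  have m2: "p^2 * N \<in> ?U \<longleftrightarrow> N \<in> ?U" for N using m[of "p * N"] m[of N] by (simp add: power2_eq_square mult.assoc)
  have e1: "(*) p ` ?U = {N \<in> ?U. p dvd N}" using m by (auto simp: image_iff elim!: dvdE)
  have e2: "(*) (p^2) ` ?U = {N \<in> ?U. p^2 dvd N}" using m2 by (auto simp: image_iff elim!: dvdE)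
  have "dens ((?U - (*) p ` ?U) \<union> (*) (p^2) ` ?U) ((?d - ?d / p) + ?d / (p^2))"
  proof (intro dens_Un_disjoint dens_Diff dens_dilation U)
    show "1 \<le> p" by (fact p)
    show "1 \<le> p^2" using p by (simp add: one_le_power)
    show "(*) p ` ?U \<subseteq> ?U" unfolding e1 by auto
    have "p dvd N" if "p^2 dvd N" for N using that by (metis dvd_trans dvd_triv_left power2_eq_square)
    then show "(?U - (*) p ` ?U) \<inter> (*) (p^2) ` ?U = {}" unfolding e1 e2 by auto
  qed
  moreover have "(?U - (*) p ` ?U) \<union> (*) (p^2) ` ?U = no_simple_prime (insert p A)"
    unfolding e1 e2 by (auto simp: no_simple_prime_def)
  moreover have "(?d - ?d / p) + ?d / (p^2) = (\<Prod>p\<in>insert p A. local_density p)"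
    using insert by (simp add: local_density_def algebra_simps)
  ultimately show ?case by (simp only:)
qed

lemma one_minus_inverse_prime_pos: "prime (p::nat) \<Longrightarrow> 0 < 1 - 1 / real p"
  using prime_gt_1_nat[of p] by (simp add: divide_less_eq)

text \<open>Sorting the integers with all prime factors in \<open>insert p A\<close> by divisibility by \<open>p\<close> gives one Euler factor.\<close>

lemma euler_product_bound:
  fixes A :: "nat set" and n :: nat
  assumes "finite A" "\<And>p. p \<in> A \<Longrightarrow> prime p"
  shows "(\<Prod>p\<in>A. 1 - 1 / real p) * (\<Sum>k | k \<in> {1..n} \<and> prime_factors k \<subseteq> A. 1 / real k) \<le> 1"
  using assms
proof (induction A rule: finite_induct)
  case empty
  have "{k. k \<in> {1..n} \<and> prime_factors k \<subseteq> {}} \<subseteq> {1}"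
  proof
    fix k assume "k \<in> {k. k \<in> {1..n} \<and> prime_factors k \<subseteq> {}}"
    then have k: "k > 0" "prime_factors k = {}" by auto
    have "k = 1"
    proof (rule ccontr)
      assume "k \<noteq> 1"
      then obtain p where "prime p" "p dvd k" using prime_factor_nat by blast
      then have "p \<in> prime_factors k" using k(1) by (simp add: in_prime_factors_iff)
      with k(2) show False by blast
    qed
    then show "k \<in> {1}" by simp
  qed
  then have "(\<Sum>k | k \<in> {1..n} \<and> prime_factors k \<subseteq> {}. 1 / real k) \<le> (\<Sum>k\<in>{1::nat}. 1 / real k)"
    by (intro sum_mono2) auto
  then show ?case by simp
next
  case (insert p A)
  let ?S = "\<lambda>A. {k. k \<in> {1..n} \<and> prime_factors k \<subseteq> A}"
  let ?f = "\<lambda>A. \<Sum>k\<in>?S A. 1 / real k"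
  have p: "prime p" using insert by simp
  have fS: "finite (?S A)" for A by simp
  have "?S (insert p A) \<subseteq> ?S A \<union> (*) p ` ?S (insert p A)"
  proof
    fix k assume k: "k \<in> ?S (insert p A)"
    show "k \<in> ?S A \<union> (*) p ` ?S (insert p A)"
    proof (cases "p dvd k")
      case False
      then have "p \<notin> prime_factors k" by auto
      then show ?thesis using k by auto
    next
      case True
      then obtain j where j: "k = p * j" by auto
      then have j0: "j > 0" using k by (cases j) auto
      have "j \<le> k" using j prime_gt_0_nat[OF p] by simp
      moreover have "prime_factors j \<subseteq> prime_factors k" using j k by (intro dvd_prime_factors) auto
      ultimately have "j \<in> ?S (insert p A)" using k j0 by auto
      then show ?thesis using j by blast
    qed
  qed
  then have "?f (insert p A) \<le> (\<Sum>k\<in>?S A \<union> (*) p ` ?S (insert p A). 1 / real k)" by (intro sum_mono2) auto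
  also have "\<dots> \<le> ?f A + (\<Sum>k\<in>(*) p ` ?S (insert p A). 1 / real k)"
    by (subst sum.union_inter[symmetric, where A = "?S A" and B = "(*) p ` ?S (insert p A)"]) (auto intro: sum_nonneg)
  also have "(\<Sum>k\<in>(*) p ` ?S (insert p A). 1 / real k) = (\<Sum>k\<in>?S (insert p A). 1 / real (p * k))"
    by (subst sum.reindex) (use p prime_gt_0_nat in \<open>auto simp: inj_on_def\<close>)
  also have "\<dots> = ?f (insert p A) / real p" by (simp add: sum_divide_distrib mult.commute)
  finally have step: "(1 - 1 / real p) * ?f (insert p A) \<le> ?f A" by (simp add: algebra_simps)
  have pr: "0 \<le> (\<Prod>p\<in>A. 1 - 1 / real p)"
    using insert one_minus_inverse_prime_pos by (intro prod_nonneg) (auto intro: less_imp_le)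
  have "(\<Prod>p\<in>insert p A. 1 - 1 / real p) * ?f (insert p A) = (\<Prod>p\<in>A. 1 - 1 / real p) * ((1 - 1 / real p) * ?f (insert p A))"
    using insert by (simp add: ac_simps)
  also have "\<dots> \<le> (\<Prod>p\<in>A. 1 - 1 / real p) * ?f A" using step pr by (rule mult_left_mono)
  also have "\<dots> \<le> 1" using insert by auto
  finally show ?case .
qed

lemma ln_le_harmonic_sum: "ln (real n + 1) \<le> (\<Sum>k\<in>{1..n}. 1 / real k)"
proof (induction n)
  case (Suc n)
  have "(real n + 1) * (1 + 1 / (real n + 1)) = real (Suc n) + 1" by (simp add: distrib_left)
  then have "ln (real (Suc n) + 1) = ln ((real n + 1) * (1 + 1 / (real n + 1)))" by (simp only:)
  also have "\<dots> = ln (real n + 1) + ln (1 + 1 / (real n + 1))" by (rule ln_mult_pos) (auto intro: add_pos_nonneg)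
  also have "\<dots> \<le> (\<Sum>k\<in>{1..n}. 1 / real k) + 1 / (real n + 1)"
    using Suc by (intro add_mono ln_add_one_self_le_self) auto
  finally show ?case by (simp add: add.commute)
qed simp

text \<open>Every integer up to \<open>n\<close> has only prime factors up to \<open>n\<close>, so
  by \<open>euler_product_bound\<close> the product is at most the inverse of a harmonic sum, hence
  of a logarithm.\<close>

lemma euler_product_tendsto_0: "(\<lambda>n. \<Prod>p | prime p \<and> p \<le> n. 1 - 1 / real p) \<longlonglongrightarrow> 0"
proof (rule tendsto_sandwich)
  have fin: "finite {p::nat. prime p \<and> p \<le> n}" for n by simp
  show "\<forall>\<^sub>F n::nat in sequentially. 0 \<le> (\<Prod>p | prime p \<and> p \<le> n. 1 - 1 / real p)"
    by (intro always_eventually allI prod_nonneg) (use one_minus_inverse_prime_pos in \<open>auto intro: less_imp_le\<close>)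
  show "\<forall>\<^sub>F n::nat in sequentially. (\<Prod>p | prime p \<and> p \<le> n. 1 - 1 / real p) \<le> inverse (ln (real n + 1))"
    using eventually_gt_at_top[of 0]
  proof eventually_elim
    case (elim n)
    have "{k. k \<in> {1..n} \<and> prime_factors k \<subseteq> {p. prime p \<and> p \<le> n}} = {1..n}"
    proof -
      have "prime_factors k \<subseteq> {p. prime p \<and> p \<le> n}" if "k \<in> {1..n}" for k
        using that by (auto simp: in_prime_factors_iff dest!: dvd_imp_le)
      then show ?thesis by blast
    qed
    then have "(\<Prod>p | prime p \<and> p \<le> n. 1 - 1 / real p) * (\<Sum>k\<in>{1..n}. 1 / real k) \<le> 1"
      using euler_product_bound[OF fin[of n], of n] by simp
    moreover have "(\<Prod>p | prime p \<and> p \<le> n. 1 - 1 / real p) * ln (real n + 1) \<le> (\<Prod>p | prime p \<and> p \<le> n. 1 - 1 / real p) * (\<Sum>k\<in>{1..n}. 1 / real k)"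
      using one_minus_inverse_prime_pos by (intro mult_left_mono ln_le_harmonic_sum prod_nonneg) (auto intro: less_imp_le)
    ultimately have "(\<Prod>p | prime p \<and> p \<le> n. 1 - 1 / real p) * ln (real n + 1) \<le> 1" by linarith
    moreover have "ln (real n + 1) > 0" using elim by simp
    ultimately show ?case by (simp add: pos_le_divide_eq inverse_eq_divide)
  qed
  show "(\<lambda>n. inverse (ln (real n + 1))) \<longlonglongrightarrow> 0" by real_asymp
qed simp

text \<open>The last bound carries the decay of the Euler product over to these products:
  \<open>local_density p\<close> exceeds 1 - 1/p, but 1 - x + x^2 is at most the square root of 1 -
  x for 0 < x \<le> 1/3.\<close>

lemma local_density_bounds:
  assumes "p \<ge> 3"
  shows "0 < local_density p" "local_density p \<le> 1" "1 - 1 / real_of_int p \<le> local_density p"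
    "(local_density p)^2 \<le> 1 - 1 / real_of_int p"
proof -
  define x where "x = 1 / real_of_int p"
  have x: "0 < x" "x \<le> 1 / 3" using assms by (auto simp: x_def field_simps)
  have l: "local_density p = 1 - x + x^2" by (simp add: local_density_def x_def power_divide)
  have x2: "0 \<le> x^2" "x^2 \<le> x * (1 / 3)" using x by (auto simp: power2_eq_square)
  show "0 < local_density p" "local_density p \<le> 1" unfolding l using x x2 by linarith+
  show "1 - 1 / real_of_int p \<le> local_density p" using x2 by (simp add: l x_def)
  have "(1 - x + x^2)^2 = 1 - x - x * (1 - 3 * x + 2 * x^2 - x^3)" by (simp add: power2_eq_square power3_eq_cube algebra_simps)
  moreover have "0 \<le> 1 - 3 * x + 2 * x^2 - x^3"
  proof -
    have "x^3 \<le> x^2" using x by (intro power_decreasing) auto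
    then show ?thesis using x x2 by linarith
  qed
  then have "0 \<le> x * (1 - 3 * x + 2 * x^2 - x^3)" using x by simp
  ultimately show "(local_density p)^2 \<le> 1 - 1 / real_of_int p" by (simp add: l x_def[symmetric])
qed

text \<open>Greedy choice: with the primes above \<open>b\<close> adjoined in increasing order, the
  product descends from 1 to 0 in steps of at most \<open>1 / b < \<epsilon> / 2\<close>. It is
  stopped at the first value below \<open>\<theta> + \<epsilon> / 2\<close>.\<close>

lemma local_density_products_dense:
  fixes \<theta> \<epsilon> :: real and B :: nat
  assumes \<theta>: "0 \<le> \<theta>" "\<theta> \<le> 1" and \<epsilon>: "\<epsilon> > 0"
  shows "\<exists>A::int set. finite A \<and> (\<forall>p\<in>A. prime p \<and> p > int B) \<and> \<bar>(\<Prod>p\<in>A. local_density p) - \<theta>\<bar> < \<epsilon>"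
proof -
  obtain b :: nat where b: "real b > 2 / \<epsilon>" "b \<ge> B" "b \<ge> 3"
    using reals_Archimedean2[of "max (2 / \<epsilon>) (real (max B 3))"] by (metis max_less_iff_conj nat_less_le of_nat_less_iff max.bounded_iff less_imp_le)
  define S where "S = (\<lambda>n. {p::nat. prime p \<and> b < p \<and> p \<le> n})"
  define g where "g = (\<lambda>n. \<Prod>p\<in>S n. local_density (int p))"
  have fS: "finite (S n)" for n by (rule finite_subset[of _ "{..n}"]) (auto simp: S_def)
  have p3: "int p \<ge> 3" if "p \<in> S n" for p n using that b by (simp add: S_def)
  have g0: "0 \<le> g n" "g n \<le> 1" for n unfolding g_def
    using local_density_bounds[OF p3] by (auto intro!: prod_nonneg prod_le_1 simp: less_imp_le)
  define c where "c = (\<Prod>p | prime p \<and> p \<le> b. 1 - 1 / real p)"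
  have c: "c > 0" unfolding c_def by (rule prod_pos) (use one_minus_inverse_prime_pos in auto)
  have lim: "g \<longlonglongrightarrow> 0"
  proof -
    have le: "(g n)^2 \<le> (\<Prod>p | prime p \<and> p \<le> n. 1 - 1 / real p) / c" if n: "n \<ge> b" for n
    proof -
      have "(g n)^2 = (\<Prod>p\<in>S n. (local_density (int p))^2)" unfolding g_def by (simp add: prod_power_distrib)
      also have "\<dots> \<le> (\<Prod>p\<in>S n. 1 - 1 / real p)"
        using local_density_bounds(4)[OF p3] by (intro prod_mono) auto
      also have "\<dots> = (\<Prod>p | prime p \<and> p \<le> n. 1 - 1 / real p) / c"
      proof -
        have "{p. prime p \<and> p \<le> n} = {p. prime p \<and> p \<le> b} \<union> S n" using n by (auto simp: S_def)
        then have "(\<Prod>p | prime p \<and> p \<le> n. 1 - 1 / real p) = c * (\<Prod>p\<in>S n. 1 - 1 / real p)"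
          unfolding c_def using fS by (subst prod.union_disjoint[symmetric]) (auto simp: S_def)
        then show ?thesis using c by simp
      qed
      finally show ?thesis .
    qed
    have "(\<lambda>n. (g n)^2) \<longlonglongrightarrow> 0"
    proof (rule tendsto_sandwich[of "\<lambda>_. 0"])
      show "\<forall>\<^sub>F n in sequentially. (g n)^2 \<le> (\<Prod>p | prime p \<and> p \<le> n. 1 - 1 / real p) / c"
        using eventually_ge_at_top[of b] by eventually_elim (rule le)
      show "(\<lambda>n. (\<Prod>p | prime p \<and> p \<le> n. 1 - 1 / real p) / c) \<longlonglongrightarrow> 0"
        using tendsto_divide[OF euler_product_tendsto_0 tendsto_const[of c]] c by simp
    qed auto
    then have "(\<lambda>n. sqrt ((g n)^2)) \<longlonglongrightarrow> sqrt 0" by (rule tendsto_real_sqrt)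
    then show ?thesis using g0 by simp
  qed
  have "\<forall>\<^sub>F n in sequentially. g n < \<theta> + \<epsilon> / 2" using order_tendstoD(2)[OF lim, of "\<theta> + \<epsilon> / 2"] \<theta> \<epsilon> by simp
  then obtain n0 where n0: "g n0 < \<theta> + \<epsilon> / 2" unfolding eventually_sequentially by blast
  define n where "n = (LEAST n. g n < \<theta> + \<epsilon> / 2)"
  have n: "g n < \<theta> + \<epsilon> / 2" unfolding n_def by (rule LeastI) (rule n0)
  have "\<bar>g n - \<theta>\<bar> < \<epsilon>"
  proof (cases "n = 0")
    case True
    have "S 0 = {}" by (auto simp: S_def)
    with True have "g n = 1" by (simp add: g_def)
    then show ?thesis using n \<theta> \<epsilon> by simp
  next
    case False
    then obtain m where m: "n = Suc m" by (cases n) auto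
    have gm: "g m \<ge> \<theta> + \<epsilon> / 2" using not_less_Least[of m "\<lambda>n. g n < \<theta> + \<epsilon> / 2"] by (simp add: n_def[symmetric] m not_less)
    have "g m - g n \<le> 1 / real b"
    proof (cases "n \<in> S n")
      case True
      then have Sn: "S n = insert n (S m)" "n \<notin> S m" by (auto simp: S_def m)
      then have gn: "g n = local_density (int n) * g m" unfolding g_def using fS by simp
      have nb: "n > b" using True by (simp add: S_def)
      have "g m - g n = (1 - local_density (int n)) * g m" by (simp add: gn algebra_simps)
      also have "\<dots> \<le> (1 / real n) * 1"
        using local_density_bounds[OF p3[OF True]] g0[of m] by (intro mult_mono) auto
      also have "\<dots> \<le> 1 / real b" using nb b by (simp add: frac_le)
      finally show ?thesis .
    next
      case False
      then have "S n = S m" by (auto simp: S_def m le_Suc_eq)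
      then show ?thesis by (simp add: g_def)
    qed
    moreover have "1 / real b < \<epsilon> / 2"
    proof -
      have "real b > 0" using b by simp
      then show ?thesis using b \<epsilon> by (simp add: field_simps)
    qed
    ultimately show ?thesis using gm n \<epsilon> by linarith
  qed
  moreover have "(\<Prod>p\<in>int ` S n. local_density p) = g n" unfolding g_def by (subst prod.reindex) auto
  moreover have "\<forall>p\<in>int ` S n. prime p \<and> p > int B" using b by (auto simp: S_def)
  ultimately show ?thesis using fS by (intro exI[of _ "int ` S n"]) auto
qed

section \<open>Arrow-shaped forms and their signatures\<close>

text \<open>In every form used here a single variable, of index \<open>b\<close>, is coupled to
  earlier variables; all other terms are squares. Such a form is diagonalized by one round of
  completing squares.\<close>

definition arrow_mat :: "nat \<Rightarrow> nat \<Rightarrow> (nat \<Rightarrow> 'a) \<Rightarrow> (nat \<Rightarrow> 'a) \<Rightarrow> 'a::comm_ring_1 mat" where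
  "arrow_mat n b d e = mat n n (\<lambda>(i, j). if i = j then d i else if j = b \<and> i < b then e i else 0)"

lemma arrow_mat_carrier: "arrow_mat n b d e \<in> carrier_mat n n"
  by (simp add: arrow_mat_def)

lemma arrow_mat_upper_triangular: "upper_triangular (arrow_mat n b d e)"
  by (auto simp: arrow_mat_def upper_triangular_def)

lemma sum_arrow_row:
  fixes x :: "nat \<Rightarrow> 'a::comm_ring_1"
  assumes "i < n" "b < n"
  shows "(\<Sum>j\<in>{0..<n}. (if i = j then d i else if j = b \<and> i < b then e i else 0) * x j) = d i * x i + (if i < b then e i * x b else 0)"
proof -
  have "(\<Sum>j\<in>{0..<n}. (if i = j then d i else if j = b \<and> i < b then e i else 0) * x j) =
    (\<Sum>j\<in>{0..<n}. (if j = i then d i * x i else 0) + (if j = b then (if i < b then e i * x b else 0) else 0))"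
    by (rule sum.cong) auto
  also have "\<dots> = d i * x i + (if i < b then e i * x b else 0)"
    using assms by (simp add: sum.distrib)
  finally show ?thesis .
qed

lemma arrow_mat_mult_vec:
  fixes x :: "'a::comm_ring_1 vec"
  assumes "i < n" "b < n" "x \<in> carrier_vec n"
  shows "(arrow_mat n b d e *\<^sub>v x) $ i = d i * x $ i + (if i < b then e i * x $ b else 0)"
proof -
  have "(arrow_mat n b d e *\<^sub>v x) $ i = (\<Sum>j\<in>{0..<n}. (if i = j then d i else if j = b \<and> i < b then e i else 0) * x $ j)"
    using assms by (simp add: arrow_mat_def scalar_prod_def)
  then show ?thesis using sum_arrow_row[OF assms(1,2), of d e "\<lambda>j. x $ j"] by simp
qed

lemma qf_eval_arrow:
  fixes x :: "'a::comm_ring_1 vec"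
  assumes b: "b < n" and x: "x \<in> carrier_vec n"
  shows "qf_eval (arrow_mat n b d e) x = (\<Sum>i\<in>{0..<n}. d i * (x $ i)^2) + (\<Sum>i\<in>{0..<b}. e i * x $ i) * x $ b"
proof -
  let ?A = "\<lambda>i j. if i = j then d i else if j = b \<and> i < b then e i else 0"
  have "qf_eval (arrow_mat n b d e) x = (\<Sum>i\<in>{0..<n}. \<Sum>j\<in>{i..<n}. ?A i j * x $ i * x $ j)"
    unfolding qf_eval_def using x by (intro sum.cong) (auto simp: arrow_mat_def)
  also have "\<dots> = (\<Sum>i\<in>{0..<n}. x $ i * (\<Sum>j\<in>{0..<n}. ?A i j * x $ j))"
  proof (rule sum.cong)
    fix i assume "i \<in> {0..<n}"
    have "(\<Sum>j\<in>{i..<n}. ?A i j * x $ i * x $ j) = (\<Sum>j\<in>{0..<n}. ?A i j * x $ i * x $ j)"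
      by (rule sum.mono_neutral_left) auto
    then show "(\<Sum>j\<in>{i..<n}. ?A i j * x $ i * x $ j) = x $ i * (\<Sum>j\<in>{0..<n}. ?A i j * x $ j)"
      by (simp add: sum_distrib_left mult.left_commute mult.commute)
  qed simp
  also have "\<dots> = (\<Sum>i\<in>{0..<n}. x $ i * (d i * x $ i + (if i < b then e i * x $ b else 0)))"
    using b by (intro sum.cong refl) (subst sum_arrow_row, auto)
  also have "\<dots> = (\<Sum>i\<in>{0..<n}. d i * (x $ i)^2 + (if i < b then e i * x $ i * x $ b else 0))"
    by (rule sum.cong) (auto simp: power2_eq_square algebra_simps)
  also have "\<dots> = (\<Sum>i\<in>{0..<n}. d i * (x $ i)^2) + (\<Sum>i\<in>{0..<n}. if i < b then e i * x $ i * x $ b else 0)"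
    by (rule sum.distrib)
  also have "(\<Sum>i\<in>{0..<n}. if i < b then e i * x $ i * x $ b else 0) = (\<Sum>i\<in>{0..<b}. e i * x $ i * x $ b)"
    using b by (intro sum.mono_neutral_cong_right) auto
  finally show ?thesis by (simp add: sum_distrib_right)
qed

lemma invertible_mat_of_det_nonzero:
  fixes P :: "'a::field mat"
  assumes P: "P \<in> carrier_mat n n" and "det P \<noteq> 0"
  shows "invertible_mat P"
proof -
  from det_non_zero_imp_unit[OF assms, of "()"] obtain B where
    B: "B \<in> carrier_mat n n" "B * P = 1\<^sub>m n" "P * B = 1\<^sub>m n"
    unfolding Units_def ring_mat_def by auto
  then show ?thesis using P unfolding invertible_mat_def inverts_mat_def by auto
qed

text \<open>The diagonal coefficients after completing the square in each variable before
  \<open>b\<close>; only the coefficient of variable \<open>b\<close> is changed by this.\<close>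

definition arrow_pivot :: "nat \<Rightarrow> (nat \<Rightarrow> int) \<Rightarrow> (nat \<Rightarrow> int) \<Rightarrow> nat \<Rightarrow> real" where
  "arrow_pivot b d e i = (if i = b then d b - (\<Sum>i\<in>{0..<b}. (real_of_int (e i))^2 / (4 * d i)) else d i)"

text \<open>For \<open>i < b\<close>, adding the multiple \<open>- e i / (2 * d i)\<close> of the
  variable \<open>b\<close> to the variable \<open>i\<close> diagonalizes the form, with the pivots
  as coefficients. \<open>P\<close> combines this with scaling by inverse square roots of the
  absolute pivots, so it is again arrow-shaped and its determinant is the product of its
  diagonal.\<close>

lemma arrow_mat_in_forms_of_signature:
  fixes d e :: "nat \<Rightarrow> int"
  assumes b: "b < r + s" and pos: "\<And>i. i < r \<Longrightarrow> arrow_pivot b d e i > 0"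
    and neg: "\<And>i. r \<le> i \<Longrightarrow> i < r + s \<Longrightarrow> arrow_pivot b d e i < 0"
  shows "arrow_mat (r + s) b d e \<in> forms_of_signature r s"
proof -
  let ?n = "r + s" and ?\<delta> = "arrow_pivot b d e"
  let ?A = "arrow_mat ?n b d e"
  have \<delta>0: "?\<delta> i \<noteq> 0" if "i < ?n" for i using pos[of i] neg[of i] that by (cases "i < r") auto
  have d0: "d i \<noteq> 0" if "i < ?n" "i \<noteq> b" for i using \<delta>0[OF that(1)] that(2) by (auto simp: arrow_pivot_def)
  have nondeg: "qf_nondegenerate ?A"
    unfolding qf_nondegenerate_def
  proof
    assume "det (?A + transpose_mat ?A) = 0"
    moreover have car: "?A + transpose_mat ?A \<in> carrier_mat ?n ?n" by (simp add: arrow_mat_def)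
    ultimately obtain v where v: "v \<in> carrier_vec ?n" "v \<noteq> 0\<^sub>v ?n" "(?A + transpose_mat ?A) *\<^sub>v v = 0\<^sub>v ?n"
      using det_0_iff_vec_prod_zero[OF car] by blast
    have eq: "2 * d i * v $ i + (if i < b then e i * v $ b else 0) + (if i = b then \<Sum>j\<in>{0..<b}. e j * v $ j else 0) = 0" if i: "i < ?n" for i
    proof -
      have "0 = ((?A + transpose_mat ?A) *\<^sub>v v) $ i" using v i by simp
      also have "\<dots> = (?A *\<^sub>v v + transpose_mat ?A *\<^sub>v v) $ i"
        using v by (subst add_mult_distrib_mat_vec[of _ ?n ?n]) (auto simp: arrow_mat_def)
      also have "\<dots> = (?A *\<^sub>v v) $ i + (transpose_mat ?A *\<^sub>v v) $ i" using i by (simp add: arrow_mat_def)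
      also have "(?A *\<^sub>v v) $ i = d i * v $ i + (if i < b then e i * v $ b else 0)" by (rule arrow_mat_mult_vec[OF i b v(1)])
      also have "(transpose_mat ?A *\<^sub>v v) $ i = (\<Sum>j\<in>{0..<?n}. (if j = i then d i * v $ i else 0) + (if i = b \<and> j < b then e j * v $ j else 0))"
      proof -
        have "(transpose_mat ?A *\<^sub>v v) $ i = (\<Sum>j\<in>{0..<?n}. (if j = i then d j else if i = b \<and> j < b then e j else 0) * v $ j)"
          using i v by (simp add: arrow_mat_def scalar_prod_def)
        also have "\<dots> = (\<Sum>j\<in>{0..<?n}. (if j = i then d i * v $ i else 0) + (if i = b \<and> j < b then e j * v $ j else 0))"
          by (rule sum.cong) auto
        finally show ?thesis .
      qed
      also have "\<dots> = d i * v $ i + (if i = b then \<Sum>j\<in>{0..<b}. e j * v $ j else 0)"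
      proof -
        have "(\<Sum>j\<in>{0..<?n}. if j < b then e j * v $ j else 0) = (\<Sum>j\<in>{0..<b}. e j * v $ j)"
          using b by (intro sum.mono_neutral_cong_right) auto
        then show ?thesis using i by (simp add: sum.distrib)
      qed
      finally show ?thesis by (simp add: algebra_simps)
    qed
    \<comment> \<open>For a kernel vector the rows before \<open>b\<close> express
      \<open>v $ i\<close> through \<open>v $ b\<close>; row \<open>b\<close> then says that twice
      the pivot times \<open>v $ b\<close> vanishes.\<close>
    have vi: "real_of_int (v $ i) = - (e i / (2 * real_of_int (d i))) * v $ b" if "i < b" for i
    proof -
      have "2 * d i * v $ i + e i * v $ b = 0" using eq[of i] that b by simp
      then have "real_of_int (2 * d i * v $ i + e i * v $ b) = 0" by (simp only: of_int_0)
      then have "2 * real_of_int (d i) * v $ i + e i * v $ b = 0" by simp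
      then show ?thesis using d0[of i] that b by (simp add: field_simps eq_neg_iff_add_eq_0)
    qed
    have "v $ b = 0"
    proof -
      have "2 * d b * v $ b + (\<Sum>j\<in>{0..<b}. e j * v $ j) = 0" using eq[OF b] by simp
      then have "2 * real_of_int (d b) * v $ b + (\<Sum>j\<in>{0..<b}. real_of_int (e j) * v $ j) = 0"
        by (simp only: of_int_eq_0_iff[symmetric, where ?'a = real] of_int_add of_int_mult of_int_sum of_int_numeral)
      also have "(\<Sum>j\<in>{0..<b}. real_of_int (e j) * v $ j) = (\<Sum>j\<in>{0..<b}. - 2 * v $ b * ((real_of_int (e j))^2 / (4 * d j)))"
        by (rule sum.cong) (use vi d0 b in \<open>auto simp: power2_eq_square field_simps\<close>)
      also have "\<dots> = - 2 * v $ b * (\<Sum>j\<in>{0..<b}. (real_of_int (e j))^2 / (4 * d j))" by (simp add: sum_distrib_left)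
      finally have "2 * v $ b * ?\<delta> b = 0" by (simp add: arrow_pivot_def algebra_simps)
      then show ?thesis using \<delta>0[OF b] by simp
    qed
    then have "v $ i = 0" if "i < ?n" for i
      using eq[OF that] d0[OF that] by (cases "i = b") (auto split: if_splits)
    then have "v = 0\<^sub>v ?n" using v(1) by (intro eq_vecI) auto
    with v(2) show False by simp
  qed
  define a where "a = (\<lambda>i. 1 / sqrt \<bar>?\<delta> i\<bar>)"
  define c where "c = (\<lambda>i. - (e i / (2 * real_of_int (d i))) * a b)"
  define P where "P = arrow_mat ?n b a c"
  have a2: "?\<delta> i * (a i * x)^2 = sgn (?\<delta> i) * x^2" if "i < ?n" for i x
  proof -
    have "?\<delta> i * (a i * x)^2 = (?\<delta> i / \<bar>?\<delta> i\<bar>) * x^2"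
      by (simp add: a_def power_mult_distrib power_divide)
    also have "?\<delta> i / \<bar>?\<delta> i\<bar> = sgn (?\<delta> i)" using \<delta>0[OF that] by (auto simp: sgn_if)
    finally show ?thesis .
  qed
  have inv: "invertible_mat P"
  proof (rule invertible_mat_of_det_nonzero)
    show Pc: "P \<in> carrier_mat ?n ?n" by (simp add: P_def arrow_mat_def)
    have "det P = prod_list (diag_mat P)" by (rule det_upper_triangular[OF _ Pc]) (simp add: P_def arrow_mat_upper_triangular)
    moreover have "0 \<notin> set (diag_mat P)" using \<delta>0 by (auto simp: P_def diag_mat_def arrow_mat_def a_def)
    ultimately show "det P \<noteq> 0" by (simp add: prod_list_zero_iff)
  qed
  have sig: "qf_has_signature ?A r s"
    unfolding qf_has_signature_def
  proof (intro exI[of _ P] conjI ballI inv)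
    show "P \<in> carrier_mat ?n ?n" by (simp add: P_def arrow_mat_def)
    fix x :: "real vec" assume x: "x \<in> carrier_vec ?n"
    have Ar: "map_mat real_of_int ?A = arrow_mat ?n b (\<lambda>i. real_of_int (d i)) (\<lambda>i. real_of_int (e i))"
      by (rule eq_matI) (auto simp: arrow_mat_def)
    let ?y = "P *\<^sub>v x"
    let ?t = "a b * x $ b"
    have yc: "?y \<in> carrier_vec ?n" unfolding P_def by (rule mult_mat_vec_carrier[OF arrow_mat_carrier x])
    have yi: "?y $ i = a i * x $ i + (if i < b then c i * x $ b else 0)" if "i < ?n" for i
      unfolding P_def by (rule arrow_mat_mult_vec[OF that b x])
    have yb: "?y $ b = ?t" using yi[OF b] by simp
    have cross: "real_of_int (d i) * (?y $ i)^2 + e i * ?y $ i * ?t = d i * (a i * x $ i)^2 - (real_of_int (e i))^2 / (4 * d i) * ?t^2" if "i < b" for i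
    proof -
      have y: "?y $ i = a i * x $ i - e i / (2 * real_of_int (d i)) * ?t" using yi[of i] that b by (simp add: c_def)
      have "D * (u - E / (2 * D) * t)^2 + E * (u - E / (2 * D) * t) * t = D * u^2 - E^2 / (4 * D) * t^2" if "D \<noteq> 0" for D E u t :: real
        using that by (simp add: power2_eq_square field_simps)
      from this[of "real_of_int (d i)" "a i * x $ i" "real_of_int (e i)" ?t] show ?thesis
        unfolding y using d0[of i] that b by simp
    qed
    have split: "(\<Sum>i\<in>{0..<?n}. f i) = (\<Sum>i\<in>{0..<b}. f i) + f b + (\<Sum>i\<in>{Suc b..<?n}. f i)" for f :: "nat \<Rightarrow> real"
    proof -
      have "{0..<?n} = {0..<b} \<union> {b} \<union> {Suc b..<?n}" using b by auto
      then show ?thesis by (simp add: sum.union_disjoint)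
    qed
    have "qf_eval (map_mat real_of_int ?A) ?y = (\<Sum>i\<in>{0..<?n}. d i * (?y $ i)^2) + (\<Sum>i\<in>{0..<b}. e i * ?y $ i) * ?t"
      unfolding Ar using qf_eval_arrow[OF b yc] yb by simp
    also have "\<dots> = (\<Sum>i\<in>{0..<b}. d i * (?y $ i)^2 + e i * ?y $ i * ?t) + d b * ?t^2 + (\<Sum>i\<in>{Suc b..<?n}. d i * (?y $ i)^2)"
      unfolding split yb by (simp add: sum.distrib sum_distrib_right)
    also have "(\<Sum>i\<in>{0..<b}. d i * (?y $ i)^2 + e i * ?y $ i * ?t) = (\<Sum>i\<in>{0..<b}. d i * (a i * x $ i)^2 - (real_of_int (e i))^2 / (4 * d i) * ?t^2)"
      using cross by (intro sum.cong) auto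
    also have "\<dots> = (\<Sum>i\<in>{0..<b}. ?\<delta> i * (a i * x $ i)^2) - (\<Sum>i\<in>{0..<b}. (real_of_int (e i))^2 / (4 * d i)) * ?t^2"
      by (simp add: sum_subtractf sum_distrib_right arrow_pivot_def)
    also have "(\<Sum>i\<in>{Suc b..<?n}. d i * (?y $ i)^2) = (\<Sum>i\<in>{Suc b..<?n}. ?\<delta> i * (a i * x $ i)^2)"
      using yi by (intro sum.cong) (auto simp: arrow_pivot_def)
    also have "(\<Sum>i\<in>{0..<b}. ?\<delta> i * (a i * x $ i)^2) - (\<Sum>i\<in>{0..<b}. (real_of_int (e i))^2 / (4 * d i)) * ?t^2 + d b * ?t^2
       + (\<Sum>i\<in>{Suc b..<?n}. ?\<delta> i * (a i * x $ i)^2) = (\<Sum>i\<in>{0..<?n}. ?\<delta> i * (a i * x $ i)^2)"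
      unfolding split by (simp add: arrow_pivot_def algebra_simps)
    also have "\<dots> = (\<Sum>i\<in>{0..<?n}. sgn (?\<delta> i) * (x $ i)^2)" using a2 by (intro sum.cong) auto
    also have "\<dots> = (\<Sum>i\<in>{0..<r}. sgn (?\<delta> i) * (x $ i)^2) + (\<Sum>i\<in>{r..<?n}. sgn (?\<delta> i) * (x $ i)^2)"
      by (rule sum.atLeastLessThan_concat[symmetric]) auto
    also have "\<dots> = (\<Sum>i\<in>{0..<r}. (x $ i)^2) + (\<Sum>i\<in>{r..<?n}. - ((x $ i)^2))"
      using pos neg by (intro arg_cong2[where f = "(+)"] sum.cong) auto
    finally show "qf_eval (map_mat real_of_int ?A) ?y = (\<Sum>i\<in>{0..<r}. (x $ i)^2) - (\<Sum>i\<in>{r..<?n}. (x $ i)^2)"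
      by (simp add: sum_negf)
  qed
  show ?thesis unfolding forms_of_signature_def int_quadratic_forms_def
    using nondeg sig by (simp add: arrow_mat_carrier arrow_mat_upper_triangular)
qed

lemma qf_values_arrow:
  assumes "b < n"
  shows "qf_values (arrow_mat n b d e) = {N. N \<noteq> 0 \<and> (\<exists>x. N = (\<Sum>i\<in>{0..<n}. d i * (x i)^2) + (\<Sum>i\<in>{0..<b}. e i * x i) * x b)}"
proof -
  have dim: "dim_row (arrow_mat n b d e) = n" by (simp add: arrow_mat_def)
  have "N \<in> qf_eval (arrow_mat n b d e) ` carrier_vec n \<longleftrightarrow> (\<exists>x. N = (\<Sum>i\<in>{0..<n}. d i * (x i)^2) + (\<Sum>i\<in>{0..<b}. e i * x i) * x b)" for N
  proof
    assume "N \<in> qf_eval (arrow_mat n b d e) ` carrier_vec n"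
    then obtain v where v: "v \<in> carrier_vec n" "N = qf_eval (arrow_mat n b d e) v" by blast
    then show "\<exists>x. N = (\<Sum>i\<in>{0..<n}. d i * (x i)^2) + (\<Sum>i\<in>{0..<b}. e i * x i) * x b"
      using qf_eval_arrow[OF assms v(1)] by (intro exI[of _ "\<lambda>i. v $ i"]) simp
  next
    assume "\<exists>x. N = (\<Sum>i\<in>{0..<n}. d i * (x i)^2) + (\<Sum>i\<in>{0..<b}. e i * x i) * x b"
    then obtain x where x: "N = (\<Sum>i\<in>{0..<n}. d i * (x i)^2) + (\<Sum>i\<in>{0..<b}. e i * x i) * x b" by blast
    have "(\<Sum>i\<in>{0..<b}. e i * x i) = (\<Sum>i\<in>{0..<b}. e i * vec n x $ i)" using assms by (intro sum.cong) auto
    then have "N = qf_eval (arrow_mat n b d e) (vec n x)"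
      using qf_eval_arrow[OF assms, of "vec n x" d e] x assms by simp
    then show "N \<in> qf_eval (arrow_mat n b d e) ` carrier_vec n" by (intro image_eqI) auto
  qed
  then show ?thesis unfolding qf_values_def dim by blast
qed

section \<open>Densities of value sets and change of sign\<close>

lemma form_densities_subset: "form_densities r s \<subseteq> {0..1}"
proof
  fix d assume "d \<in> form_densities r s"
  then obtain A where d: "has_density (qf_values A) d" unfolding form_densities_def by blast
  let ?S = "qf_values A"
  have z: "0 \<notin> ?S" by (simp add: qf_values_def)
  have c1: "card (?S \<inter> {1..int N}) \<le> N" for N using card_mono[of "{1..int N}" "?S \<inter> {1..int N}"] by simp
  have c2: "card (?S \<inter> {- int N..-1}) \<le> N" for N using card_mono[of "{- int N..-1}" "?S \<inter> {- int N..-1}"] by simp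
  have c3: "card (?S \<inter> {- int N..int N}) \<le> 2 * N" for N
  proof -
    have "?S \<inter> {- int N..int N} \<subseteq> {- int N..-1} \<union> {1..int N}"
    proof
      fix k assume k: "k \<in> ?S \<inter> {- int N..int N}"
      then have "k \<noteq> 0" using z by auto
      then show "k \<in> {- int N..-1} \<union> {1..int N}" using k by auto
    qed
    then have "card (?S \<inter> {- int N..int N}) \<le> card ({- int N..-1} \<union> {1..int N})" by (intro card_mono) auto
    also have "\<dots> = 2 * N" by (subst card_Un_disjoint) auto
    finally show ?thesis .
  qed
  have lim: "d \<in> {0..1}" if "f \<longlonglongrightarrow> d" "\<And>N. 0 \<le> f N \<and> f N \<le> 1" for f :: "nat \<Rightarrow> real"
    using LIMSEQ_le_const[OF that(1), of 0] LIMSEQ_le_const2[OF that(1), of 1] that(2) by auto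
  show "d \<in> {0..1}"
  proof (cases "positive_set ?S")
    case True
    then have "(\<lambda>N::nat. real (card (?S \<inter> {1..int N})) / real N) \<longlonglongrightarrow> d" using d by (simp add: has_density_def)
    then show ?thesis by (rule lim) (use c1 in \<open>auto simp: divide_le_eq_1\<close>)
  next
    case False
    show ?thesis
    proof (cases "negative_set ?S")
      case True
      then have "(\<lambda>N::nat. real (card (?S \<inter> {- int N..-1})) / real N) \<longlonglongrightarrow> d" using d False by (simp add: has_density_def)
      then show ?thesis by (rule lim) (use c2 in \<open>auto simp: divide_le_eq_1\<close>)
    next
      case nn: False
      then have "(\<lambda>N::nat. real (card (?S \<inter> {- int N..int N})) / (2 * real N)) \<longlonglongrightarrow> d" using d False by (simp add: has_density_def)
      then show ?thesis
      proof (rule lim)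
        fix N
        have "real (card (?S \<inter> {- int N..int N})) \<le> 2 * real N" using c3[of N] by linarith
        then show "0 \<le> real (card (?S \<inter> {- int N..int N})) / (2 * real N) \<and> real (card (?S \<inter> {- int N..int N})) / (2 * real N) \<le> 1"
          by (auto simp: divide_le_eq_1)
      qed
    qed
  qed
qed

lemma card_uminus_Int:
  fixes S :: "int set"
  shows "card (uminus ` S \<inter> {a..b}) = card (S \<inter> {- b..- a})"
proof -
  have "uminus ` S \<inter> {a..b} = uminus ` (S \<inter> {- b..- a})" by auto
  then show ?thesis by (simp add: card_image)
qed

lemma has_density_uminus:
  assumes "has_density S d"
  shows "has_density (uminus ` S) d"
proof -
  have ps: "positive_set (uminus ` S) \<longleftrightarrow> negative_set S" "negative_set (uminus ` S) \<longleftrightarrow> positive_set S"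
    by (auto simp: positive_set_def negative_set_def)
  have c: "card (uminus ` S \<inter> {1..int N}) = card (S \<inter> {- int N..-1})"
    "card (uminus ` S \<inter> {- int N..-1}) = card (S \<inter> {1..int N})"
    "card (uminus ` S \<inter> {- int N..int N}) = card (S \<inter> {- int N..int N})" for N
    using card_uminus_Int[of S 1 "int N"] card_uminus_Int[of S "- int N" "- 1"] card_uminus_Int[of S "- int N" "int N"] by simp_all
  show ?thesis
  \<comment> \<open>Positivity is tested first, so a set that is both positive and negative is
    counted on the positive side before and after the reflection; both counts are 0.\<close>
  proof (cases "positive_set S \<and> negative_set S")
    case True
    then have "S \<inter> {1..int N} = {}" "S \<inter> {- int N..-1} = {}" for N
      by (force simp: positive_set_def negative_set_def)+
    then show ?thesis using assms True unfolding has_density_def ps c by simp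
  next
    case False
    then show ?thesis using assms unfolding has_density_def ps c by auto
  qed
qed

lemma qf_eval_uminus:
  assumes "A \<in> carrier_mat n n" "x \<in> carrier_vec n"
  shows "qf_eval (- A) x = - qf_eval A x"
  unfolding qf_eval_def using assms by (simp add: sum_negf[symmetric])

text \<open>Negation leaves the negative squares in front, while the normal form lists the positive
  ones first. The base change is therefore composed with the cyclic permutation \<open>\<pi>\<close>
  of the coordinates, whose inverse is \<open>\<rho>\<close>.\<close>

lemma forms_of_signature_uminus:
  assumes "A \<in> forms_of_signature r s"
  shows "- A \<in> forms_of_signature s r"
proof -
  have A: "A \<in> carrier_mat (r + s) (r + s)" "upper_triangular A" "qf_nondegenerate A" "qf_has_signature A r s"
    using assms by (auto simp: forms_of_signature_def int_quadratic_forms_def)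
  have sr: "s + r = r + s" by simp
  have "- A + transpose_mat (- A) = (- 1) \<cdot>\<^sub>m (A + transpose_mat A)"
    using A(1) by (intro eq_matI) auto
  then have "det (- A + transpose_mat (- A)) = (- 1) ^ dim_col (A + transpose_mat A) * det (A + transpose_mat A)"
    by (simp only: det_smult)
  then have nd: "qf_nondegenerate (- A)" using A(3) by (simp add: qf_nondegenerate_def)
  have ut: "upper_triangular (- A)" using A(1,2) by (auto simp: upper_triangular_def)
  obtain P :: "real mat" where P: "P \<in> carrier_mat (r + s) (r + s)" "invertible_mat P"
    "\<And>x. x \<in> carrier_vec (r + s) \<Longrightarrow> qf_eval (map_mat of_int A) (P *\<^sub>v x) = (\<Sum>i\<in>{0..<r}. (x $ i)\<^sup>2) - (\<Sum>i\<in>{r..<r + s}. (x $ i)\<^sup>2)"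
    using A(4) unfolding qf_has_signature_def by blast
  define \<pi> where "\<pi> = (\<lambda>i. if i < r then s + i else i - r)"
  define \<rho> where "\<rho> = (\<lambda>i. if i < s then r + i else i - s)"
  define Pm :: "real mat" where "Pm = mat (r + s) (r + s) (\<lambda>(i, j). if j = \<pi> i then 1 else 0)"
  define Pm' :: "real mat" where "Pm' = mat (r + s) (r + s) (\<lambda>(i, j). if j = \<rho> i then 1 else 0)"
  have pr: "\<pi> i < r + s" "\<rho> i < r + s" "\<rho> (\<pi> i) = i" "\<pi> (\<rho> i) = i" if "i < r + s" for i
    using that by (auto simp: \<pi>_def \<rho>_def)
  have car: "Pm \<in> carrier_mat (r + s) (r + s)" "Pm' \<in> carrier_mat (r + s) (r + s)" by (auto simp: Pm_def Pm'_def)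
  have mult: "Pm * Pm' = 1\<^sub>m (r + s)"
  proof (rule eq_matI)
    fix i j assume ij: "i < dim_row (1\<^sub>m (r + s) :: real mat)" "j < dim_col (1\<^sub>m (r + s) :: real mat)"
    then have "(Pm * Pm') $$ (i, j) = (\<Sum>l\<in>{0..<r + s}. (if l = \<pi> i then 1 else 0) * (if j = \<rho> l then 1 else 0))"
      by (simp add: Pm_def Pm'_def scalar_prod_def)
    also have "\<dots> = (\<Sum>l\<in>{0..<r + s}. if l = \<pi> i then (if j = \<rho> l then 1 else 0) else 0)" by (rule sum.cong) auto
    also have "\<dots> = 1\<^sub>m (r + s) $$ (i, j)" using ij pr by simp
    finally show "(Pm * Pm') $$ (i, j) = 1\<^sub>m (r + s) $$ (i, j)" .
  qed (auto simp: Pm_def Pm'_def)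
  have "det Pm * det Pm' = 1" using det_mult[OF car] mult by simp
  then have dPm: "det Pm \<noteq> 0" by auto
  have dP: "det P \<noteq> 0"
  proof -
    obtain B where B: "P * B = 1\<^sub>m (r + s)" "B * P = 1\<^sub>m (dim_row B)" using P(1,2) unfolding invertible_mat_def inverts_mat_def by auto
    have "dim_col B = r + s" using arg_cong[OF B(1), of dim_col] by simp
    moreover have "dim_row B = r + s" using arg_cong[OF B(2), of dim_col] P(1) by simp
    ultimately have "B \<in> carrier_mat (r + s) (r + s)" by auto
    from det_mult[OF P(1) this] have "det P * det B = 1" using B(1) by simp
    then show ?thesis by auto
  qed
  have sig: "qf_has_signature (- A) s r"
    unfolding qf_has_signature_def sr
  proof (intro exI[of _ "P * Pm"] conjI ballI)
    show PP: "P * Pm \<in> carrier_mat (r + s) (r + s)" using P car by simp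
    show "invertible_mat (P * Pm)"
      by (rule invertible_mat_of_det_nonzero[OF PP]) (use det_mult[OF P(1) car(1)] dP dPm in simp)
    fix x :: "real vec" assume x: "x \<in> carrier_vec (r + s)"
    have y: "Pm *\<^sub>v x \<in> carrier_vec (r + s)" using car x by simp
    have yi: "(Pm *\<^sub>v x) $ i = x $ \<pi> i" if "i < r + s" for i
    proof -
      have "(Pm *\<^sub>v x) $ i = (\<Sum>j\<in>{0..<r + s}. (if j = \<pi> i then 1 else 0) * x $ j)"
        using that x by (simp add: Pm_def scalar_prod_def)
      also have "\<dots> = (\<Sum>j\<in>{0..<r + s}. if j = \<pi> i then x $ j else 0)" by (rule sum.cong) auto
      also have "\<dots> = x $ \<pi> i" using pr[OF that] by simp
      finally show ?thesis .
    qed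
    have "map_mat of_int (- A) = - (map_mat of_int A :: real mat)" using A(1) by (intro eq_matI) auto
    then have "qf_eval (map_mat of_int (- A)) (P * Pm *\<^sub>v x) = - qf_eval (map_mat of_int A) (P *\<^sub>v (Pm *\<^sub>v x))"
      using qf_eval_uminus[of "map_mat of_int A" "r + s" "P *\<^sub>v (Pm *\<^sub>v x)"] A(1) P(1) y car x
      by (simp add: assoc_mult_mat_vec[OF P(1) car(1) x])
    also have "\<dots> = (\<Sum>i\<in>{r..<r + s}. (x $ \<pi> i)\<^sup>2) - (\<Sum>i\<in>{0..<r}. (x $ \<pi> i)\<^sup>2)"
    proof -
      have "(\<Sum>i\<in>{0..<r}. ((Pm *\<^sub>v x) $ i)\<^sup>2) = (\<Sum>i\<in>{0..<r}. (x $ \<pi> i)\<^sup>2)" using yi by (intro sum.cong) simp_all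
      moreover have "(\<Sum>i\<in>{r..<r + s}. ((Pm *\<^sub>v x) $ i)\<^sup>2) = (\<Sum>i\<in>{r..<r + s}. (x $ \<pi> i)\<^sup>2)" using yi by (intro sum.cong) simp_all
      ultimately show ?thesis using P(3)[OF y] by simp
    qed
    also have "(\<Sum>i\<in>{r..<r + s}. (x $ \<pi> i)\<^sup>2) = (\<Sum>i\<in>{0..<s}. (x $ i)\<^sup>2)"
      by (rule sum.reindex_bij_witness[where i = "\<lambda>i. i + r" and j = "\<lambda>i. i - r"]) (auto simp: \<pi>_def)
    also have "(\<Sum>i\<in>{0..<r}. (x $ \<pi> i)\<^sup>2) = (\<Sum>i\<in>{s..<r + s}. (x $ i)\<^sup>2)"
      by (rule sum.reindex_bij_witness[where i = "\<lambda>i. i - s" and j = "\<lambda>i. s + i"]) (auto simp: \<pi>_def)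
    finally show "qf_eval (map_mat of_int (- A)) (P * Pm *\<^sub>v x) = (\<Sum>i\<in>{0..<s}. (x $ i)\<^sup>2) - (\<Sum>i\<in>{s..<r + s}. (x $ i)\<^sup>2)" .
  qed
  show ?thesis unfolding forms_of_signature_def int_quadratic_forms_def using A(1) ut nd sig by (simp add: sr)
qed

lemma form_densities_swap: "form_densities r s \<subseteq> form_densities s r"
proof
  fix d assume "d \<in> form_densities r s"
  then obtain A where A: "A \<in> forms_of_signature r s" "has_density (qf_values A) d" unfolding form_densities_def by blast
  have car: "A \<in> carrier_mat (r + s) (r + s)" using A(1) by (simp add: forms_of_signature_def int_quadratic_forms_def)
  have "qf_values (- A) = uminus ` qf_values A"
  proof -
    have "qf_eval (- A) ` carrier_vec (r + s) = uminus ` (qf_eval A ` carrier_vec (r + s))"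
      unfolding image_image by (rule image_cong) (use qf_eval_uminus[OF car] in auto)
    then show ?thesis unfolding qf_values_def using car by auto
  qed
  then have "has_density (qf_values (- A)) d" using has_density_uminus[OF A(2)] by simp
  then show "d \<in> form_densities s r" unfolding form_densities_def using forms_of_signature_uminus[OF A(1)] by blast
qed

lemma has_density_of_dens:
  assumes "dens S d" "\<And>k. k \<in> S \<Longrightarrow> k > 0"
  shows "has_density S d"
  using assms unfolding has_density_def dens_def positive_set_def by force

lemma has_density_of_symmetric_dens:
  assumes d: "dens S d" and sym: "\<And>k. k \<in> S \<longleftrightarrow> - k \<in> S" and z: "0 \<notin> S"
  shows "has_density S d"
proof (cases "S = {}")
  case True
  then show ?thesis using d by (simp add: has_density_def dens_def positive_set_def)
next
  case False
  then obtain k where k: "k \<in> S" by auto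
  then have "k \<noteq> 0" using z by auto
  then have np: "\<not> positive_set S" "\<not> negative_set S"
  proof -
    have k': "- k \<in> S" using k sym by blast
    have "\<not> positive_set S \<and> \<not> negative_set S"
    proof (cases "k > 0")
      case True
      then have "- k < 0" by simp
      then show ?thesis using True k k' unfolding positive_set_def negative_set_def by blast
    next
      case False
      then have "k < 0" "- k > 0" using \<open>k \<noteq> 0\<close> by auto
      then show ?thesis using k k' unfolding positive_set_def negative_set_def by blast
    qed
    then show "\<not> positive_set S" "\<not> negative_set S" by auto
  qed
  have "card (S \<inter> {- int N..int N}) = 2 * card (S \<inter> {1..int N})" for N
  proof -
    have "S \<inter> {- int N..int N} = S \<inter> {1..int N} \<union> S \<inter> {- int N..-1}"
    proof -
      have "k \<ge> 1 \<or> k \<le> -1" if "k \<in> S" for k using that z by (cases "k = 0") auto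
      then show ?thesis by force
    qed
    moreover have "S \<inter> {- int N..-1} = uminus ` (S \<inter> {1..int N})"
    proof -
      have "k \<in> uminus ` (S \<inter> {1..int N})" if "k \<in> S" "k \<in> {- int N..-1}" for k
        using that sym[of k] by (intro image_eqI[of _ _ "- k"]) auto
      then show ?thesis using sym by auto
    qed
    then have "card (S \<inter> {- int N..-1}) = card (S \<inter> {1..int N})" by (simp add: card_image)
    moreover have "card (S \<inter> {1..int N} \<union> S \<inter> {- int N..-1}) = card (S \<inter> {1..int N}) + card (S \<inter> {- int N..-1})"
      by (rule card_Un_disjoint) auto
    ultimately show ?thesis by simp
  qed
  then show ?thesis using d np unfolding has_density_def dens_def by simp
qed

section \<open>Indefinite forms\<close>

lemma prod_prime_squares_dvd:
  fixes S :: "int set"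
  assumes "finite S" "\<And>p. p \<in> S \<Longrightarrow> prime p" "\<And>p. p \<in> S \<Longrightarrow> p^2 dvd n"
  shows "(\<Prod>S)^2 dvd n"
  using assms
proof (induction S rule: finite_induct)
  case (insert p S)
  have "coprime p (\<Prod>S)"
  proof (rule prod_coprime_right)
    fix q assume "q \<in> S"
    then show "coprime p q" using insert by (metis insertCI primes_coprime)
  qed
  then have "coprime (p^2) ((\<Prod>S)^2)" by simp
  with insert show ?case by (simp add: power_mult_distrib divides_mult)
qed simp

text \<open>Reduces representing \<open>N\<close> with modulus \<open>\<Prod>A\<close> to
  representing \<open>N'\<close> with a modulus coprime to it: multiplying all variables by
  \<open>d\<close> multiplies the values by \<open>d^2\<close> and restores the missing factor
  \<open>d\<close> of the modulus.\<close>

lemma prod_split_dvd: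
  fixes A :: "int set"
  assumes A: "finite A" "\<And>p. p \<in> A \<Longrightarrow> prime p" and N: "N \<in> no_simple_prime A"
  shows "\<exists>d N'. d = \<Prod>{p \<in> A. p dvd N} \<and> N = d^2 * N' \<and> d \<ge> 1 \<and> \<Prod>A = d * \<Prod>{p \<in> A. \<not> p dvd N} \<and>
    (\<forall>p\<in>A. \<not> p dvd N \<longrightarrow> \<not> p dvd N')"
proof -
  let ?D = "{p \<in> A. p dvd N}"
  have "(\<Prod>?D)^2 dvd N" using A N by (intro prod_prime_squares_dvd) (auto simp: no_simple_prime_def)
  then obtain N' where N': "N = (\<Prod>?D)^2 * N'" by blast
  have "\<Prod>?D > 0" using A by (intro prod_pos) (auto dest: prime_gt_0_int)
  moreover have "\<Prod>A = \<Prod>?D * \<Prod>{p \<in> A. \<not> p dvd N}"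
  proof -
    have "A = ?D \<union> {p \<in> A. \<not> p dvd N}" by auto
    then show ?thesis using A(1) by (metis (no_types, lifting) prod.union_disjoint finite_Un disjoint_iff mem_Collect_eq)
  qed
  moreover have "\<not> p dvd N'" if "p \<in> A" "\<not> p dvd N" for p
  proof
    assume "p dvd N'"
    then have "p dvd (\<Prod>?D)^2 * N'" by (rule dvd_mult)
    then have "p dvd N" by (simp only: N'[symmetric])
    with that(2) show False by blast
  qed
  ultimately show ?thesis using N' by (intro exI[of _ "\<Prod>?D"] exI[of _ N']) simp
qed

lemma coprime_prod_primes:
  fixes A :: "int set"
  assumes "\<And>p. p \<in> A \<Longrightarrow> prime p" "\<And>p. p \<in> A \<Longrightarrow> \<not> p dvd y"
  shows "coprime y (\<Prod>A)"
  using assms by (intro prod_coprime_right) (metis coprime_commute prime_imp_coprime)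

text \<open>
  With \<open>y = a\<^sup>2 - N c\<^sup>2\<close> for coprime \<open>a\<close>, \<open>c\<close>, the number \<open>N\<close> is a square modulo \<open>y\<close>, while \<open>y\<close> can
  still be prescribed modulo every prime not dividing \<open>N\<close>.
\<close>

lemma indefinite_form_represents_coprime:
  fixes A :: "int set" and u N :: int
  assumes A: "finite A" "\<And>p. p \<in> A \<Longrightarrow> prime p" "\<And>p. p \<in> A \<Longrightarrow> odd p"
    and u: "\<And>p. p \<in> A \<Longrightarrow> \<not> QuadRes p (- u)" and N: "\<And>p. p \<in> A \<Longrightarrow> \<not> p dvd N"
  shows "\<exists>z y t. N = z^2 + u * y^2 + \<Prod>A * t * y"
proof (cases "A = {}")
  case True
  then show ?thesis by (intro exI[of _ 0] exI[of _ 1] exI[of _ "N - u"]) simp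
next
  case False
  have "\<forall>p. \<exists>y z a c. p \<in> A \<longrightarrow> [u * y^2 + z^2 = N] (mod p) \<and> \<not> p dvd y \<and> [a^2 - N * c^2 = y] (mod p)"
  proof
    fix p
    show "\<exists>y z a c. p \<in> A \<longrightarrow> [u * y^2 + z^2 = N] (mod p) \<and> \<not> p dvd y \<and> [a^2 - N * c^2 = y] (mod p)"
    proof (cases "p \<in> A")
      case True
      obtain y z where yz: "[u * y^2 + z^2 = N] (mod p)" "\<not> p dvd y"
        using anisotropic_values_mod_prime(2)[OF A(2)[OF True] A(3)[OF True] u[OF True] N[OF True]] by blast
      have "\<not> p dvd 1" using A(2)[OF True] not_prime_unit by blast
      moreover have "\<not> p dvd - N" using N[OF True] by simp
      ultimately obtain a c where "[1 * a^2 + (- N) * c^2 = y] (mod p)"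
        using diagonal_form_universal_mod_prime[OF A(2)[OF True] A(3)[OF True]] by blast
      then have "[a^2 - N * c^2 = y] (mod p)" by simp
      with yz show ?thesis by blast
    qed blast
  qed
  then obtain fy fz fa fc where f: "\<And>p. p \<in> A \<Longrightarrow> [u * (fy p)^2 + (fz p)^2 = N] (mod p)"
    "\<And>p. p \<in> A \<Longrightarrow> \<not> p dvd fy p" "\<And>p. p \<in> A \<Longrightarrow> [(fa p)^2 - N * (fc p)^2 = fy p] (mod p)"
    by metis
  define m where "m = \<Prod>A"
  have m0: "m > 0" unfolding m_def using A(2) by (intro prod_pos) (auto dest: prime_gt_0_int)
  have pm: "p dvd m" if "p \<in> A" for p unfolding m_def using dvd_prodI[of A p "\<lambda>x. x"] A(1) that by simp
  obtain c0 where c0: "\<And>p. p \<in> A \<Longrightarrow> [c0 = fc p] (mod p)" using chinese_remainder_primes_int[OF A(1,2), of fc] by blast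
  \<comment> \<open>Adding \<open>m\<close> makes \<open>c\<close> positive, so that its prime
    divisors form a finite set.\<close>
  define c where "c = c0 mod m + m"
  have c_pos: "c > 0" using m0 by (simp add: c_def add_nonneg_pos)
  have c: "[c = fc p] (mod p)" if "p \<in> A" for p
  proof -
    have "[c = c0] (mod m)" by (simp add: c_def unique_euclidean_semiring_class.cong_def)
    then have "[c = c0] (mod p)" using pm[OF that] by (rule cong_dvd_modulus)
    then show ?thesis using c0[OF that] by (rule cong_trans)
  qed
  let ?R = "{p. prime p \<and> p dvd c}"
  have fR: "finite ?R" by (rule finite_subset[of _ "{0..c}"]) (auto simp: prime_ge_0_int dest: zdvd_imp_le[OF _ c_pos])
  \<comment> \<open>The value 1 at primes of \<open>c\<close> outside \<open>A\<close> keeps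
    \<open>a\<close> coprime to \<open>c\<close> there; at a prime of \<open>A\<close> a common
    divisor of \<open>a\<close> and \<open>c\<close> would divide \<open>y\<close>, which is
    prescribed to be a unit.\<close>
  obtain a where a: "\<And>p. p \<in> A \<union> ?R \<Longrightarrow> [a = (if p \<in> A then fa p else 1)] (mod p)"
  proof -
    have "finite (A \<union> ?R)" "\<And>p. p \<in> A \<union> ?R \<Longrightarrow> prime p" using A fR by auto
    from chinese_remainder_primes_int[OF this, of "\<lambda>p. if p \<in> A then fa p else 1"] show ?thesis using that by blast
  qed
  define y where "y = a^2 - N * c^2"
  have yp: "[y = fy p] (mod p)" if "p \<in> A" for p
  proof -
    have "[a = fa p] (mod p)" using a[of p] that by simp
    then have "[y = (fa p)^2 - N * (fc p)^2] (mod p)" unfolding y_def using c[OF that]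
      by (intro cong_diff cong_mult cong_pow cong_refl)
    then show ?thesis using f(3)[OF that] by (rule cong_trans)
  qed
  have ynd: "\<not> p dvd y" if "p \<in> A" for p using f(2)[OF that] cong_dvd_iff[OF yp[OF that]] by blast
  have ac: "coprime a c"
  proof (rule ccontr)
    assume "\<not> coprime a c"
    then have "\<not> is_unit (gcd a c)" "gcd a c \<noteq> 0" using c_pos by (auto simp: coprime_iff_gcd_eq_1)
    then obtain p where p: "prime p" "p dvd gcd a c" using prime_divisor_exists by blast
    then have pa: "p dvd a" and pc: "p dvd c" by (meson dvd_trans gcd_dvd1 gcd_dvd2)+
    show False
    proof (cases "p \<in> A")
      case True
      have "p dvd y" unfolding y_def using pa pc by (simp add: power2_eq_square)
      then show False using ynd[OF True] by blast
    next
      case False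
      then have "[a = 1] (mod p)" using a[of p] p pc by simp
      then have "p dvd 1" using pa cong_dvd_iff by blast
      then show False using p(1) not_prime_unit by blast
    qed
  qed
  have "coprime c y"
  proof -
    have "coprime c (a^2)" using ac by (simp add: coprime_commute)
    then have "coprime c (a^2 - (N * c) * c)"
      by (metis coprime_iff_gcd_eq_1 gcd_add_mult add.commute mult_minus_left diff_conv_add_uminus gcd.commute)
    then show ?thesis by (simp add: y_def power2_eq_square mult.assoc)
  qed
  then obtain c' where c': "[c * c' = 1] (mod y)" using cong_solve_coprime_int by blast
  \<comment> \<open>This is \<open>a / c\<close> modulo \<open>y\<close>, and its square is
    \<open>N\<close> there.\<close>
  define s where "s = a * c'"
  have s: "[s^2 = N] (mod y)"
  proof -
    have "[a^2 = N * c^2] (mod y)" by (simp add: cong_iff_dvd_diff y_def)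
    from cong_scalar_right[OF this, of "c'^2"] have "[s^2 = N * (c * c')^2] (mod y)" by (simp add: s_def power_mult_distrib mult.assoc)
    also have "[N * (c * c')^2 = N * 1^2] (mod y)" using c' by (intro cong_mult cong_pow cong_refl)
    finally show ?thesis by simp
  qed
  have ym: "coprime y m" unfolding m_def using A(2) ynd by (rule coprime_prod_primes)
  obtain z1 where z1: "\<And>p. p \<in> A \<Longrightarrow> [z1 = fz p] (mod p)" using chinese_remainder_primes_int[OF A(1,2), of fz] by blast
  \<comment> \<open>With \<open>z\<close> a square root of \<open>N\<close> modulo \<open>y\<close>
    and a local solution modulo \<open>m\<close>, both \<open>y\<close> and \<open>m\<close> divide
    \<open>N - z^2 - u * y^2\<close>; the quotient by \<open>m * y\<close> is the value of the
    linear variable \<open>t\<close>.\<close>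
  obtain z where z: "[z = s] (mod y)" "[z = z1] (mod m)" using binary_chinese_remainder_int[OF ym] by blast
  have d1: "y dvd N - z^2 - u * y^2"
  proof -
    have "[z^2 = N] (mod y)" using cong_trans[OF cong_pow[OF z(1)] s] .
    then have "y dvd N - z^2" by (metis cong_iff_dvd_diff cong_sym)
    then show ?thesis by (simp add: power2_eq_square)
  qed
  have d2: "m dvd N - z^2 - u * y^2" unfolding m_def
  proof (rule prod_primes_dvd[OF A(1,2)])
    fix p assume p: "p \<in> A"
    have "[z = fz p] (mod p)" using cong_trans[OF cong_dvd_modulus[OF z(2) pm[OF p]] z1[OF p]] .
    then have "[u * y^2 + z^2 = u * (fy p)^2 + (fz p)^2] (mod p)" using yp[OF p] by (intro cong_add cong_mult cong_pow cong_refl)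
    then have "[u * y^2 + z^2 = N] (mod p)" using f(1)[OF p] by (rule cong_trans)
    then have "p dvd N - (u * y^2 + z^2)" by (metis cong_iff_dvd_diff cong_sym)
    then show "p dvd N - z^2 - u * y^2" by (simp add: algebra_simps)
  qed
  have "m * y dvd N - z^2 - u * y^2" using d1 d2 ym by (simp add: divides_mult coprime_commute)
  then obtain t where "N - z^2 - u * y^2 = m * y * t" ..
  then have "N = z^2 + u * y^2 + \<Prod>A * t * y" by (simp add: m_def algebra_simps)
  then show ?thesis by blast
qed

text \<open>The first part scales a representation of the cofactor supplied by
  \<open>prod_split_dvd\<close>. In the second part anisotropy at \<open>p\<close> forces
  \<open>p\<close> to divide \<open>y\<close> and \<open>z\<close>, and then \<open>p^2\<close>
  divides every term, the mixed one because \<open>p\<close> divides both \<open>\<Prod>A\<close>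
  and \<open>y\<close>.\<close>

lemma indefinite_form_represents_iff:
  fixes A :: "int set" and u N :: int
  assumes A: "finite A" "\<And>p. p \<in> A \<Longrightarrow> prime p" "\<And>p. p \<in> A \<Longrightarrow> odd p"
    and u: "\<And>p. p \<in> A \<Longrightarrow> \<not> QuadRes p (- u)"
  shows "N \<in> no_simple_prime A \<Longrightarrow> \<exists>z y t. N = z^2 + u * y^2 + \<Prod>A * t * y"
    and "N = z^2 + u * y^2 + \<Prod>A * t * y + (\<Prod>A)^2 * w \<Longrightarrow> N \<in> no_simple_prime A"
proof -
  assume "N \<in> no_simple_prime A"
  from prod_split_dvd[of A N, OF A(1) A(2) this] obtain d N' where d1: "N = d^2 * N'"
    and d2: "\<Prod>A = d * \<Prod>{p \<in> A. \<not> p dvd N}" and d3: "\<And>p. p \<in> A \<Longrightarrow> \<not> p dvd N \<Longrightarrow> \<not> p dvd N'"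
    by blast
  have "\<exists>z y t. N' = z^2 + u * y^2 + \<Prod>{p \<in> A. \<not> p dvd N} * t * y"
    using A u d3 by (intro indefinite_form_represents_coprime) auto
  then obtain z y t where zyt: "N' = z^2 + u * y^2 + \<Prod>{p \<in> A. \<not> p dvd N} * t * y" by blast
  have "N = (d * z)^2 + u * (d * y)^2 + \<Prod>A * t * (d * y)"
  proof -
    have "d^2 * (z^2 + u * y^2 + M * t * y) = (d * z)^2 + u * (d * y)^2 + (d * M) * t * (d * y)" for M
      by (simp add: power2_eq_square algebra_simps)
    then show ?thesis using d1 unfolding d2 zyt by simp
  qed
  then show "\<exists>z y t. N = z^2 + u * y^2 + \<Prod>A * t * y" by blast
next
  assume N: "N = z^2 + u * y^2 + \<Prod>A * t * y + (\<Prod>A)^2 * w"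
  show "N \<in> no_simple_prime A" unfolding no_simple_prime_def
  proof (rule CollectI, intro ballI impI)
    fix p assume p: "p \<in> A" "p dvd N"
    have pm: "p dvd \<Prod>A" using dvd_prodI[of A p "\<lambda>x. x"] A(1) p(1) by simp
    then have "p dvd \<Prod>A * t * y + (\<Prod>A)^2 * w" by (simp add: power2_eq_square)
    moreover have "u * y^2 + z^2 = N - (\<Prod>A * t * y + (\<Prod>A)^2 * w)" using N by simp
    ultimately have "p dvd u * y^2 + z^2" using p(2) by simp
    from anisotropic_mod_prime[OF A(2)[OF p(1)] u[OF p(1)] this] have py: "p dvd y" and pz: "p dvd z" by blast+
    have "p * p dvd \<Prod>A * t * y" by (rule mult_dvd_mono[OF dvd_mult2[OF pm] py])
    then show "p^2 dvd N" unfolding N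
      by (intro dvd_add dvd_power_same pz dvd_mult[OF dvd_power_same[OF py]] dvd_mult2[OF dvd_power_same[OF pm]])
        (simp add: power2_eq_square)
  qed
qed

lemma nonresidue_for_all_exists:
  fixes A :: "int set"
  assumes A: "finite A" "\<And>p. p \<in> A \<Longrightarrow> prime p" "\<And>p. p \<in> A \<Longrightarrow> odd p"
  shows "\<exists>u>0. \<forall>p\<in>A. \<not> QuadRes p (- u)"
proof -
  have "\<forall>p. \<exists>a. p \<in> A \<longrightarrow> \<not> QuadRes p a" using quadratic_nonresidue_exists A by blast
  then obtain f where f: "\<And>p. p \<in> A \<Longrightarrow> \<not> QuadRes p (f p)" by metis
  obtain x where x: "\<And>p. p \<in> A \<Longrightarrow> [x = - f p] (mod p)" using chinese_remainder_primes_int[OF A(1,2), of "\<lambda>p. - f p"] by blast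
  define m where "m = \<Prod>A"
  have m0: "m > 0" unfolding m_def using A(2) by (intro prod_pos) (auto dest: prime_gt_0_int)
  \<comment> \<open>Adding \<open>m\<close> makes \<open>u\<close> positive, as the signature
    requires.\<close>
  define u where "u = x mod m + m"
  have "u > 0" using m0 by (simp add: u_def add_nonneg_pos)
  moreover have "\<not> QuadRes p (- u)" if "p \<in> A" for p
  proof
    assume Q: "QuadRes p (- u)"
    have "p dvd m" unfolding m_def using dvd_prodI[of A p "\<lambda>x. x"] A(1) that by simp
    moreover have "[u = x] (mod m)" by (simp add: u_def unique_euclidean_semiring_class.cong_def)
    ultimately have "[u = x] (mod p)" using cong_dvd_modulus by blast
    then have "[u = - f p] (mod p)" using x[OF that] by (rule cong_trans)
    then have "[- u = - (- f p)] (mod p)" by (simp only: cong_minus_minus_iff)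
    then have "[- u = f p] (mod p)" by simp
    then show False using QuadRes_cong[OF _ Q] f[OF that] by blast
  qed
  ultimately show ?thesis by blast
qed

text \<open>The variables 0, 1 and \<open>r\<close> carry \<open>z\<close>, \<open>y\<close> and
  \<open>t\<close>. The variable \<open>t\<close> has no square term, but completing the square in
  \<open>y\<close> gives it the negative pivot - m^2 / (4 u); hence its place at index
  \<open>r\<close>, where the negative pivots begin.\<close>

lemma indefinite_densities:
  fixes A :: "int set"
  assumes rs: "r \<ge> 2" "s \<ge> 1" and A: "finite A" "\<And>p. p \<in> A \<Longrightarrow> prime p" "\<And>p. p \<in> A \<Longrightarrow> odd p"
  shows "(\<Prod>p\<in>A. local_density p) \<in> form_densities r s"
proof -
  obtain u where u: "u > 0" "\<And>p. p \<in> A \<Longrightarrow> \<not> QuadRes p (- u)" using nonresidue_for_all_exists[OF A] by blast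
  define m where "m = \<Prod>A"
  have m0: "m > 0" unfolding m_def using A(2) by (intro prod_pos) (auto dest: prime_gt_0_int)
  define d where "d = (\<lambda>i::nat. if i = 0 then 1 else if i = 1 then u else if i < r then m^2 else if i = r then 0 else - (m^2))"
  define e where "e = (\<lambda>i::nat. if i = 1 then m else 0)"
  have b: "r < r + s" using rs by simp
  have sum_e: "(\<Sum>i\<in>{0..<r}. e i * x i) = m * x 1" for x :: "nat \<Rightarrow> int"
  proof -
    have "(\<Sum>i\<in>{0..<r}. e i * x i) = (\<Sum>i\<in>{0..<r}. if i = 1 then m * x 1 else 0)" by (rule sum.cong) (auto simp: e_def)
    then show ?thesis using rs by simp
  qed
  have form: "arrow_mat (r + s) r d e \<in> forms_of_signature r s"
  proof (rule arrow_mat_in_forms_of_signature[OF b])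
    show "arrow_pivot r d e i > 0" if "i < r" for i using that u m0 by (simp add: arrow_pivot_def d_def)
    show "arrow_pivot r d e i < 0" if "r \<le> i" "i < r + s" for i
    proof (cases "i = r")
      case True
      have "(\<Sum>i\<in>{0..<r}. (real_of_int (e i))^2 / (4 * d i)) = (\<Sum>i\<in>{0..<r}. if i = 1 then (real_of_int m)^2 / (4 * u) else 0)"
        by (rule sum.cong) (auto simp: e_def d_def)
      also have "\<dots> = (real_of_int m)^2 / (4 * u)" using rs by simp
      finally show ?thesis using True rs u m0 by (simp add: arrow_pivot_def d_def)
    next
      case False
      then show ?thesis using that rs m0 by (simp add: arrow_pivot_def d_def)
    qed
  qed
  have vals: "qf_values (arrow_mat (r + s) r d e) = no_simple_prime A - {0}"
  proof -
    have "(\<exists>x. N = (\<Sum>i\<in>{0..<r + s}. d i * (x i)^2) + (\<Sum>i\<in>{0..<r}. e i * x i) * x r) \<longleftrightarrow> N \<in> no_simple_prime A" for N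
    proof
      assume "\<exists>x. N = (\<Sum>i\<in>{0..<r + s}. d i * (x i)^2) + (\<Sum>i\<in>{0..<r}. e i * x i) * x r"
      then obtain x where x: "N = (\<Sum>i\<in>{0..<r + s}. d i * (x i)^2) + m * x 1 * x r" unfolding sum_e by blast
      have "m^2 dvd (\<Sum>i\<in>{2..<r + s}. d i * (x i)^2)" by (rule dvd_sum) (auto simp: d_def)
      then obtain w where w: "(\<Sum>i\<in>{2..<r + s}. d i * (x i)^2) = m^2 * w" ..
      have "{0..<r + s} = insert 0 (insert 1 {2..<r + s})" using rs by auto
      then have "(\<Sum>i\<in>{0..<r + s}. d i * (x i)^2) = (x 0)^2 + u * (x 1)^2 + m^2 * w" using w by (simp add: d_def)
      then have "N = (x 0)^2 + u * (x 1)^2 + \<Prod>A * x r * x 1 + (\<Prod>A)^2 * w" unfolding x m_def by (simp add: algebra_simps)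
      from indefinite_form_represents_iff(2)[of A u N "x 0" "x 1" "x r" w, OF A u(2) this]
      show "N \<in> no_simple_prime A" by blast
    next
      assume "N \<in> no_simple_prime A"
      then obtain z y t where zyt: "N = z^2 + u * y^2 + m * t * y"
        using indefinite_form_represents_iff(1)[OF A u(2)] unfolding m_def by blast
      define x where "x = (\<lambda>i::nat. if i = 0 then z else if i = 1 then y else if i = r then t else 0)"
      have "(\<Sum>i\<in>{0..<r + s}. d i * (x i)^2) = (\<Sum>i\<in>{0, 1}. d i * (x i)^2)"
        using rs by (intro sum.mono_neutral_right) (auto simp: x_def d_def)
      also have "\<dots> = z^2 + u * y^2" by (simp add: x_def d_def)
      finally have "N = (\<Sum>i\<in>{0..<r + s}. d i * (x i)^2) + (\<Sum>i\<in>{0..<r}. e i * x i) * x r"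
        unfolding sum_e zyt using rs by (simp add: x_def)
      then show "\<exists>x. N = (\<Sum>i\<in>{0..<r + s}. d i * (x i)^2) + (\<Sum>i\<in>{0..<r}. e i * x i) * x r" by blast
    qed
    then show ?thesis unfolding qf_values_arrow[OF b] by blast
  qed
  have "dens (no_simple_prime A - {0}) (\<Prod>p\<in>A. local_density p)"
    by (rule dens_cong[OF _ dens_no_simple_prime[OF A(1,2)]]) auto
  then have "has_density (qf_values (arrow_mat (r + s) r d e)) (\<Prod>p\<in>A. local_density p)"
    unfolding vals by (rule has_density_of_symmetric_dens) (auto simp: no_simple_prime_def)
  then show ?thesis unfolding form_densities_def using form by blast
qed

section \<open>Definite forms\<close>

lemma four_bqf: "4 * bqf c y z = (2 * y + z)^2 + (4 * c - 1) * z^2"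
  by (simp add: bqf_def power2_eq_square algebra_simps)

lemma odd_prime_not_dvd_two:
  fixes p :: int
  assumes "prime p" "odd p"
  shows "\<not> p dvd 2"
  using assms by (metis dvd_refl prime_int_numeral_eq primes_dvd_imp_eq two_is_prime_nat even_numeral)

lemma prime_eq_two_or_odd:
  fixes p :: int
  assumes "prime p"
  shows "p = 2 \<or> odd p"
  using assms by (metis prime_int_numeral_eq primes_dvd_imp_eq two_is_prime_nat)

text \<open>Local solutions are found in the diagonal coordinates \<open>s = 2 * y + z\<close> and
  \<open>z\<close>; modulo an odd prime \<open>y\<close> is recovered from them.\<close>

lemma bqf_local_lift:
  fixes p k c x s z N :: int
  assumes p: "prime p" "odd p" and eq: "[4 * k * x^2 + s^2 + (4 * c - 1) * z^2 = 4 * N] (mod p)" and s: "\<not> p dvd s"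
  shows "\<exists>y. [k * x^2 + bqf c y z = N] (mod p) \<and> \<not> p dvd 2 * y + z \<and> [2 * y + z = s] (mod p)"
proof -
  have two: "\<not> p dvd 2" by (rule odd_prime_not_dvd_two[OF p])
  obtain y where y: "[2 * y = s - z] (mod p)" using solve_linear_mod_prime[OF p(1) two] by blast
  have ys: "[2 * y + z = s] (mod p)" using cong_add[OF y cong_refl[of z]] by simp
  have "4 * (k * x^2 + bqf c y z) = 4 * k * x^2 + (2 * y + z)^2 + (4 * c - 1) * z^2"
    by (simp add: distrib_left four_bqf)
  also have "[4 * k * x^2 + (2 * y + z)^2 + (4 * c - 1) * z^2 = 4 * k * x^2 + s^2 + (4 * c - 1) * z^2] (mod p)"
    using ys by (intro cong_add cong_pow cong_refl)
  also note eq
  finally have "p dvd 2 * (2 * (k * x^2 + bqf c y z - N))" by (simp add: cong_iff_dvd_diff algebra_simps)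
  then have "p dvd k * x^2 + bqf c y z - N" using two p(1) by (simp only: prime_dvd_mult_iff) simp
  then have "[k * x^2 + bqf c y z = N] (mod p)" by (simp add: cong_iff_dvd_diff)
  moreover have "\<not> p dvd 2 * y + z" using s cong_dvd_iff[OF ys] by blast
  ultimately show ?thesis using ys by blast
qed

text \<open>Euler's criterion: (q - 1) / 2 = 2c - 1 is odd.\<close>

lemma neg_one_nonresidue:
  fixes q c :: int
  assumes q: "prime q" "q = 4 * c - 1"
  shows "\<not> QuadRes q (- 1)"
proof
  assume R: "QuadRes q (- 1)"
  have q2: "q > 2" using prime_ge_2_int[OF q(1)] q(2) by presburger
  define n where "n = nat q"
  have n: "int n = q" "prime n" "n > 2" using q q2 by (auto simp: n_def)
  have "[Legendre (- 1) (int n) = (- 1) ^ ((n - 1) div 2)] (mod (int n))" by (rule euler_criterion[OF n(2,3)])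
  moreover have "Legendre (- 1) (int n) = 1"
  proof -
    have "\<not> q dvd - 1" using q(1) not_prime_unit by auto
    then show ?thesis using R n(1) by (simp add: Legendre_def cong_iff_dvd_diff)
  qed
  moreover have "odd ((n - 1) div 2)"
  proof -
    have "int (4 * nat (c - 1) + 3) = q" using q2 q(2) by simp
    then have "n = 4 * nat (c - 1) + 3" using n(1) by (metis of_nat_eq_iff)
    then have "(n - 1) div 2 = 2 * nat (c - 1) + 1" by simp
    then show ?thesis by simp
  qed
  ultimately have "[1 = - 1] (mod q)" using n(1) by simp
  then have "q dvd 2" by (simp add: cong_iff_dvd_diff)
  then show False using q2 zdvd_imp_le[of q 2] by simp
qed

text \<open>If \<open>x\<close> is congruent to \<open>l * z\<close> modulo \<open>p\<close>, four
  times the ternary form becomes \<open>(4 * l^2 + q) * z^2 + (2 * y + z)^2\<close>, so the last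
  assumption makes it an anisotropic plane modulo \<open>p\<close>. The bound
  \<open>p > q + 1\<close> makes \<open>p\<close> odd and \<open>q\<close>, \<open>q + 1\<close>
  units modulo \<open>p\<close>, which the existence of \<open>l\<close> requires.\<close>

locale definite_family =
  fixes c q l :: int and A :: "int set"
  assumes q: "prime q" "q = 4 * c - 1" and A: "finite A" "\<And>p. p \<in> A \<Longrightarrow> prime p" "\<And>p. p \<in> A \<Longrightarrow> p > q + 1"
    and l: "\<And>p. p \<in> A \<Longrightarrow> \<not> QuadRes p (- (4 * l^2 + q))"
begin

lemma c1: "c \<ge> 1" using q prime_ge_2_int[OF q(1)] by simp

lemma odd_q: "odd q" using q(2) by simp

lemma q_notin_A: "q \<notin> A" using A(3)[of q] by auto

lemma odd_A: "odd p" if "p \<in> A" for p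
  using prime_eq_two_or_odd[OF A(2)[OF that]] A(3)[OF that] prime_ge_2_int[OF q(1)] by auto

text \<open>Modulo \<open>p\<close> in \<open>B\<close> an anisotropic plane takes every unit with
  \<open>s = 2 * y + z\<close> nonzero. Modulo \<open>q\<close> four times the form is
  \<open>(2 * x)^2 + s^2\<close> and behaves in the same way. At the other odd primes
  \<open>s = 1\<close> is prescribed and \<open>4 * x^2 + q * z^2\<close> takes every
  residue.\<close>

lemma local_unit:
  assumes B: "B \<subseteq> A" and N: "\<not> q dvd N" "\<And>p. p \<in> B \<Longrightarrow> \<not> p dvd N" and p: "prime p"
  shows "\<exists>x y z. [1 * x^2 + bqf c y z = N] (mod p) \<and> \<not> p dvd 2 * y + z \<and> (p \<in> B \<longrightarrow> p dvd 1 * x + 0 * y + (- l) * z)"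
proof -
  consider "p = 2" | "p \<in> B" | "p = q" | "odd p" "p \<notin> B" "p \<noteq> q" using prime_eq_two_or_odd[OF p] by blast
  then show ?thesis
  proof cases
    case 1
    have "even ((N - c)^2 + c - N)" by auto
    then have "[1 * (N - c)^2 + bqf c 0 1 = N] (mod p)" by (simp add: bqf_def cong_iff_dvd_diff 1)
    moreover have "p \<notin> B" using 1 B A(3)[of 2] prime_ge_2_int[OF q(1)] by auto
    ultimately show ?thesis by (intro exI[of _ "N - c"] exI[of _ 0] exI[of _ 1]) (simp add: 1)
  next
    case 2
    then have pA: "p \<in> A" using B by blast
    have "\<not> p dvd 2 * (2 * N)" using N(2)[OF 2] odd_prime_not_dvd_two[OF p odd_A[OF pA]] p by (simp only: prime_dvd_mult_iff) simp
    then have "\<not> p dvd 4 * N" by simp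
    from anisotropic_values_mod_prime(1)[OF p odd_A[OF pA] l[OF pA] this]
    obtain z s where zs: "[(4 * l^2 + q) * z^2 + s^2 = 4 * N] (mod p)" "\<not> p dvd s" by blast
    have "4 * 1 * (l * z)^2 + s^2 + (4 * c - 1) * z^2 = (4 * l^2 + q) * z^2 + s^2" unfolding q(2)[symmetric] by (simp add: power2_eq_square algebra_simps)
    then have "[4 * 1 * (l * z)^2 + s^2 + (4 * c - 1) * z^2 = 4 * N] (mod p)" using zs(1) by (simp only:)
    from bqf_local_lift[OF p odd_A[OF pA] this zs(2)]
    obtain y where "[1 * (l * z)^2 + bqf c y z = N] (mod p)" "\<not> p dvd 2 * y + z" by blast
    then show ?thesis by (intro exI[of _ "l * z"] exI[of _ y] exI[of _ z]) simp
  next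
    case 3
    have op: "odd p" using 3 odd_q by simp
    have "\<not> p dvd 2 * (2 * N)" using N(1) odd_prime_not_dvd_two[OF p op] p 3 by (simp only: prime_dvd_mult_iff) simp
    then have "\<not> p dvd 4 * N" by simp
    moreover have "\<not> QuadRes p (- 1)" using neg_one_nonresidue[OF q] 3 by simp
    ultimately obtain w s where ws: "[1 * w^2 + s^2 = 4 * N] (mod p)" "\<not> p dvd s"
      using anisotropic_values_mod_prime(1)[OF p op, of 1 "4 * N"] by blast
    obtain x where x: "[2 * x = w] (mod p)" using solve_linear_mod_prime[OF p odd_prime_not_dvd_two[OF p op]] by blast
    have "[(2 * x)^2 + s^2 = w^2 + s^2] (mod p)" using x by (intro cong_add cong_pow cong_refl)
    then have "[(2 * x)^2 + s^2 = 4 * N] (mod p)" using ws(1) by (simp add: cong_trans)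
    then have "[4 * 1 * x^2 + s^2 + (4 * c - 1) * 0^2 = 4 * N] (mod p)" by (simp add: power_mult_distrib)
    from bqf_local_lift[OF p op this ws(2)]
    obtain y where "[1 * x^2 + bqf c y 0 = N] (mod p)" "\<not> p dvd 2 * y + 0" by blast
    moreover have "p \<notin> B" using 3 B q_notin_A by blast
    ultimately show ?thesis by blast
  next
    case 4
    have two: "\<not> p dvd 2" by (rule odd_prime_not_dvd_two[OF p 4(1)])
    have "\<not> p dvd 2 * 2" using two p by (simp only: prime_dvd_mult_iff) simp
    then have f: "\<not> p dvd 4" by simp
    have "\<not> p dvd q" using p q(1) 4(3) primes_dvd_imp_eq by blast
    from diagonal_form_universal_mod_prime[OF p 4(1) f this, of "4 * N - 1"]
    obtain x z where "[4 * x^2 + q * z^2 = 4 * N - 1] (mod p)" by blast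
    from cong_add[OF this cong_refl[of 1]] have "[4 * 1 * x^2 + 1^2 + (4 * c - 1) * z^2 = 4 * N] (mod p)" using q(2) by (simp add: algebra_simps)
    moreover have "\<not> p dvd 1" using p not_prime_unit by blast
    ultimately obtain y where "[1 * x^2 + bqf c y z = N] (mod p)" "\<not> p dvd 2 * y + z"
      using bqf_local_lift[OF p 4(1), of 1 x 1 c z N] by blast
    with 4(2) show ?thesis by blast
  qed
qed

text \<open>Treats the quotients by \<open>q\<close> of values divisible by \<open>q\<close>. The
  form and the linear condition are those obtained from the substitution in \<open>bqf_dual\<close>,
  where \<open>z\<close> becomes \<open>2 * y + z\<close> and \<open>x\<close> becomes
  \<open>q * x\<close>. Modulo \<open>q\<close> four times the new form is the square of
  \<open>2 * y + z\<close>, whence the hypothesis on \<open>4 * N\<close>.\<close>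

lemma local_multiple:
  assumes B: "B \<subseteq> A" and N: "\<not> q dvd N" "QuadRes q (4 * N)" "\<And>p. p \<in> B \<Longrightarrow> \<not> p dvd N" and p: "prime p"
  shows "\<exists>x y z. [q * x^2 + bqf c y z = N] (mod p) \<and> \<not> p dvd 2 * y + z \<and> (p \<in> B \<longrightarrow> p dvd q * x + (- 2 * l) * y + (- l) * z)"
proof -
  consider "p = 2" | "p \<in> B" | "p = q" | "odd p" "p \<notin> B" "p \<noteq> q" using prime_eq_two_or_odd[OF p] by blast
  then show ?thesis
  proof cases
    case 1
    have "even (q * (N - c)^2 + c - N)" using odd_q by auto
    then have "[q * (N - c)^2 + bqf c 0 1 = N] (mod p)" by (simp add: bqf_def cong_iff_dvd_diff 1)
    moreover have "p \<notin> B" using 1 B A(3)[of 2] prime_ge_2_int[OF q(1)] by auto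
    ultimately show ?thesis by (intro exI[of _ "N - c"] exI[of _ 0] exI[of _ 1]) (simp add: 1)
  next
    case 2
    then have pA: "p \<in> A" using B by blast
    have pq: "\<not> p dvd q" using p q(1) pA q_notin_A primes_dvd_imp_eq by blast
    have "\<not> p dvd 2 * (2 * (q * N))" using N(3)[OF 2] pq odd_prime_not_dvd_two[OF p odd_A[OF pA]] p by (simp only: prime_dvd_mult_iff) simp
    then have "\<not> p dvd 4 * (q * N)" by simp
    \<comment> \<open>Multiplied by \<open>4 * q\<close>, the form reads
      \<open>(4 * l^2 + q) * s^2 + (q * z)^2\<close> with \<open>s = 2 * y + z\<close>. The
      coordinate to be kept nonzero is now the one with coefficient
      \<open>4 * l^2 + q\<close>.\<close>
    from anisotropic_values_mod_prime(2)[OF p odd_A[OF pA] l[OF pA] this]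
    obtain s t where st: "[(4 * l^2 + q) * s^2 + t^2 = 4 * (q * N)] (mod p)" "\<not> p dvd s" by blast
    obtain z where z: "[q * z = t] (mod p)" using solve_linear_mod_prime[OF p pq] by blast
    obtain x where x: "[q * x = l * s] (mod p)" using solve_linear_mod_prime[OF p pq] by blast
    have "q * (4 * q * x^2 + s^2 + (4 * c - 1) * z^2 - 4 * N) = 4 * (q * x)^2 + q * s^2 + (q * z)^2 - 4 * (q * N)"
      unfolding q(2)[symmetric] by (simp add: power2_eq_square algebra_simps)
    also have "[4 * (q * x)^2 + q * s^2 + (q * z)^2 - 4 * (q * N) = 4 * (l * s)^2 + q * s^2 + t^2 - 4 * (q * N)] (mod p)"
      by (rule cong_diff[OF cong_add[OF cong_add[OF cong_scalar_left[OF cong_pow[OF x]] cong_refl] cong_pow[OF z]] cong_refl])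
    also have "4 * (l * s)^2 + q * s^2 + t^2 - 4 * (q * N) = (4 * l^2 + q) * s^2 + t^2 - 4 * (q * N)" by (simp add: power2_eq_square algebra_simps)
    also have "[(4 * l^2 + q) * s^2 + t^2 - 4 * (q * N) = 4 * (q * N) - 4 * (q * N)] (mod p)" using st(1) by (intro cong_diff cong_refl)
    finally have "p dvd q * (4 * q * x^2 + s^2 + (4 * c - 1) * z^2 - 4 * N)" by (simp add: cong_iff_dvd_diff)
    then have "p dvd 4 * q * x^2 + s^2 + (4 * c - 1) * z^2 - 4 * N" using pq p by (simp only: prime_dvd_mult_iff) simp
    then have "[4 * q * x^2 + s^2 + (4 * c - 1) * z^2 = 4 * N] (mod p)" by (simp add: cong_iff_dvd_diff)
    from bqf_local_lift[OF p odd_A[OF pA] this st(2)]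
    obtain y where y: "[q * x^2 + bqf c y z = N] (mod p)" "\<not> p dvd 2 * y + z" "[2 * y + z = s] (mod p)" by blast
    have "[q * x - l * (2 * y + z) = l * s - l * s] (mod p)" by (rule cong_diff[OF x cong_scalar_left[OF y(3)]])
    then have "p dvd q * x - l * (2 * y + z)" by (simp add: cong_iff_dvd_diff)
    then have "p dvd q * x + (- 2 * l) * y + (- l) * z" by (simp add: algebra_simps)
    with y show ?thesis by blast
  next
    case 3
    have op: "odd p" using 3 odd_q by simp
    obtain s where s: "[s^2 = 4 * N] (mod p)" using N(2) 3 unfolding QuadRes_def by blast
    have "\<not> p dvd 2 * (2 * N)" using N(1) odd_prime_not_dvd_two[OF p op] p 3 by (simp only: prime_dvd_mult_iff) simp
    then have "\<not> p dvd 4 * N" by simp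
    then have "\<not> p dvd s^2" using cong_dvd_iff[OF s] by blast
    then have s0: "\<not> p dvd s" by (auto simp: power2_eq_square)
    have "[4 * q * 0^2 + s^2 + (4 * c - 1) * 0^2 = 4 * N] (mod p)" using s by simp
    from bqf_local_lift[OF p op this s0]
    obtain y where "[q * 0^2 + bqf c y 0 = N] (mod p)" "\<not> p dvd 2 * y + 0" by blast
    moreover have "p \<notin> B" using 3 B q_notin_A by blast
    ultimately show ?thesis by blast
  next
    case 4
    have two: "\<not> p dvd 2" by (rule odd_prime_not_dvd_two[OF p 4(1)])
    have pq: "\<not> p dvd q" using p q(1) 4(3) primes_dvd_imp_eq by blast
    have "\<not> p dvd 2 * (2 * q)" using two pq p by (simp only: prime_dvd_mult_iff) simp
    then have f: "\<not> p dvd 4 * q" by simp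
    from diagonal_form_universal_mod_prime[OF p 4(1) f pq, of "4 * N - 1"]
    obtain x z where "[4 * q * x^2 + q * z^2 = 4 * N - 1] (mod p)" by blast
    from cong_add[OF this cong_refl[of 1]] have "[4 * q * x^2 + 1^2 + (4 * c - 1) * z^2 = 4 * N] (mod p)" unfolding q(2)[symmetric] by (simp add: algebra_simps)
    moreover have "\<not> p dvd 1" using p not_prime_unit by blast
    ultimately obtain y where "[q * x^2 + bqf c y z = N] (mod p)" "\<not> p dvd 2 * y + z"
      using bqf_local_lift[OF p 4(1), of q x 1 c z N] by blast
    with 4(2) show ?thesis by blast
  qed
qed

end

lemma null_set_finite:
  assumes "finite E"
  shows "null_set E"
  unfolding null_set_def
proof (intro allI impI)
  fix \<epsilon> :: real assume e: "\<epsilon> > 0"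
  have "\<forall>\<^sub>F X::nat in sequentially. real X \<ge> real (card E) / \<epsilon>"
    using filterlim_real_sequentially by (simp add: filterlim_at_top)
  then show "\<forall>\<^sub>F X::nat in sequentially. real (card (E \<inter> {1..int X})) \<le> \<epsilon> * real X"
  proof eventually_elim
    case (elim X)
    have "card (E \<inter> {1..int X}) \<le> card E" using assms by (intro card_mono) auto
    moreover have "real (card E) \<le> \<epsilon> * real X" using elim e by (simp add: pos_divide_le_eq mult.commute)
    ultimately show ?case by linarith
  qed
qed

lemma dens_mono:
  assumes "dens S a" "dens S' b" "S \<inter> {1..} \<subseteq> S'"
  shows "a \<le> b"
proof (rule LIMSEQ_le[OF assms(1,2)[unfolded dens_def]])
  have "card (S \<inter> {1..int X}) \<le> card (S' \<inter> {1..int X})" for X using assms(3) by (intro card_mono) auto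
  then show "\<exists>N. \<forall>n\<ge>N. real (card (S \<inter> {1..int n})) / real n \<le> real (card (S' \<inter> {1..int n})) / real n"
    by (simp add: divide_right_mono)
qed

section \<open>The ternary form on the sublattice\<close>

context definite_family
begin

definition m :: int where "m = \<Prod>A"

definition represented :: "int set" where
  "represented = {N. \<exists>x y z. N = x^2 + bqf c y z \<and> m dvd x - l * z}"

text \<open>The locally admissible integers not divisible by \<open>q^2\<close>. When
  \<open>q\<close> divides a value exactly once, four times the quotient is congruent to
  \<open>z^2\<close> modulo \<open>q\<close>; this is the residue condition. Multiples of
  \<open>q^2\<close> are reached by scaling instead.\<close>

definition eligible :: "int set" where
  "eligible = {N \<in> no_simple_prime A. \<not> q dvd N \<or> \<not> q^2 dvd N \<and> QuadRes q (4 * (N div q))}"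

lemma m_pos: "m > 0"
  unfolding m_def using A(2) by (intro prod_pos) (auto dest: prime_gt_0_int)

lemma q_pos: "q > 0" using q(1) prime_gt_0_int by blast

lemma prime_dvd_m: "p dvd m" if "p \<in> A"
  unfolding m_def using dvd_prodI[of A p "\<lambda>x. x"] A(1) that by simp

lemma q_coprime_prod: "coprime q (\<Prod>B)" if "B \<subseteq> A" for B
proof (rule prod_coprime_right)
  fix p assume "p \<in> B"
  then have "p \<in> A" using that by blast
  then show "coprime q p" using A(2) q(1) q_notin_A primes_coprime by metis
qed

text \<open>If the anisotropic plane in \<open>z\<close> and \<open>2 * y + z\<close> vanishes
  modulo \<open>p\<close>, then \<open>p\<close> divides \<open>z\<close> and \<open>y\<close>, and
  the congruence defining the sublattice passes this on to \<open>x\<close>.\<close>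

lemma represented_no_simple_prime:
  assumes N: "N = x^2 + bqf c y z + m^2 * w" and dv: "m dvd x - l * z"
  shows "N \<in> no_simple_prime A"
  unfolding no_simple_prime_def
proof (rule CollectI, intro ballI impI)
  fix p assume p: "p \<in> A" "p dvd N"
  have pp: "prime p" "\<not> p dvd 2" using A(2)[OF p(1)] odd_prime_not_dvd_two odd_A[OF p(1)] by auto
  have pm: "p dvd m" by (rule prime_dvd_m[OF p(1)])
  then have px: "p dvd x - l * z" using dv by (rule dvd_trans)
  have "p dvd m^2 * w" using pm by (simp add: power2_eq_square)
  then have "p dvd N - m^2 * w" using p(2) by (rule dvd_diff[rotated])
  then have "p dvd x^2 + bqf c y z" using N by simp
  then have "p dvd 4 * (x^2 + bqf c y z)" by (rule dvd_mult)
  moreover have "4 * (x^2 + bqf c y z) = ((4 * l^2 + q) * z^2 + (2 * y + z)^2) + 4 * ((x - l * z) * (x + l * z))"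
  proof -
    have "4 * (x^2 + bqf c y z) = 4 * x^2 + ((2 * y + z)^2 + q * z^2)" using four_bqf[of c y z] q(2) by simp
    also have "\<dots> = ((4 * l^2 + q) * z^2 + (2 * y + z)^2) + 4 * ((x - l * z) * (x + l * z))"
      by (simp add: power2_eq_square algebra_simps)
    finally show ?thesis .
  qed
  moreover have "p dvd 4 * ((x - l * z) * (x + l * z))" using px by simp
  ultimately have "p dvd (4 * l^2 + q) * z^2 + (2 * y + z)^2" by (simp add: dvd_add_left_iff)
  from anisotropic_mod_prime[OF pp(1) l[OF p(1)] this] have pz: "p dvd z" and ps: "p dvd 2 * y + z" by blast+
  have "p dvd 2 * y" using ps pz by (simp add: dvd_add_left_iff)
  then have py: "p dvd y" using pp by (simp add: prime_dvd_mult_iff)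
  have "p dvd (x - l * z) + l * z" using px pz by (intro dvd_add dvd_mult)
  then have px': "p dvd x" by simp
  have "p^2 dvd bqf c y z" unfolding bqf_def power2_eq_square mult.assoc
    by (intro dvd_add mult_dvd_mono[OF py py] mult_dvd_mono[OF py pz] dvd_mult[OF mult_dvd_mono[OF pz pz]])
  moreover have "p^2 dvd x^2" "p^2 dvd m^2 * w" using px' pm by (auto intro: dvd_power_same)
  ultimately show "p^2 dvd N" unfolding N by (intro dvd_add)
qed

lemma represented_scale: "N \<in> represented \<Longrightarrow> a^2 * N \<in> represented"
proof -
  assume "N \<in> represented"
  then obtain x y z where N: "N = x^2 + bqf c y z" "m dvd x - l * z" unfolding represented_def by blast
  have "a^2 * N = (a * x)^2 + bqf c (a * y) (a * z)" unfolding N(1) bqf_def by (simp add: power2_eq_square algebra_simps)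
  moreover have "m dvd a * (x - l * z)" using N(2) by (rule dvd_mult)
  then have "m dvd a * x - l * (a * z)" by (simp add: algebra_simps)
  ultimately show ?thesis unfolding represented_def by blast
qed

text \<open>Descent at \<open>q\<close>: modulo \<open>q\<close> four times the form is
  \<open>(2 * x)^2 + (2 * y + z)^2\<close>, anisotropic because -1 is a nonresidue, so
  \<open>q\<close> divides both terms. What remains after division by \<open>q\<close> is
  \<open>z^2\<close> modulo \<open>q\<close>; if that vanishes as well, the whole vector is
  divisible by \<open>q\<close>.\<close>

lemma represented_multiple_q:
  assumes N: "N \<in> represented" "q dvd N"
  shows "q^2 dvd N \<Longrightarrow> \<exists>N'. N = q^2 * N' \<and> N' \<in> represented" "QuadRes q (4 * (N div q))"
proof -
  obtain x y z where xyz: "N = x^2 + bqf c y z" "m dvd x - l * z" using N(1) unfolding represented_def by blast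
  have two: "\<not> q dvd 2" by (rule odd_prime_not_dvd_two[OF q(1) odd_q])
  have N4: "4 * N = (2 * x)^2 + (2 * y + z)^2 + q * z^2"
    unfolding xyz(1) distrib_left four_bqf q(2)[symmetric] by (simp add: power_mult_distrib)
  have "q dvd 4 * N" using N(2) by simp
  then have "q dvd ((2 * x)^2 + (2 * y + z)^2) + q * z^2" by (simp only: N4)
  then have "q dvd (2 * x)^2 + (2 * y + z)^2" by (simp only: dvd_add_left_iff[OF dvd_triv_left])
  then have "q dvd 1 * (2 * x)^2 + (2 * y + z)^2" by simp
  from anisotropic_mod_prime[OF q(1) neg_one_nonresidue[OF q] this] have "q dvd 2 * x" "q dvd 2 * y + z" by blast+
  then have "q dvd x" and qs: "q dvd 2 * y + z" using two q(1) by (simp_all add: prime_dvd_mult_iff)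
  then obtain x1 s1 where x1: "x = q * x1" and s1: "2 * y + z = q * s1" by (auto elim!: dvdE)
  have N4': "4 * N = q * (4 * q * x1^2 + q * s1^2 + z^2)" unfolding N4 s1 x1 by (simp add: power2_eq_square algebra_simps)
  obtain N1 where N1: "N = q * N1" using N(2) ..
  have n1: "4 * N1 = 4 * q * x1^2 + q * s1^2 + z^2" using N4' N1 q_pos by (metis mult.left_commute mult_cancel_left less_irrefl)
  have "N div q = N1" using N1 q_pos by simp
  moreover have "[z^2 = 4 * N1] (mod q)" unfolding n1 by (simp add: cong_iff_dvd_diff)
  ultimately show "QuadRes q (4 * (N div q))" unfolding QuadRes_def by auto
  assume "q^2 dvd N"
  then have "q dvd N1" using N1 q_pos by (simp add: power2_eq_square)
  then have "q dvd 4 * N1" by simp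
  then have "q dvd (4 * q * x1^2 + q * s1^2) + z^2" by (simp only: n1)
  moreover have "q dvd 4 * q * x1^2 + q * s1^2" by simp
  ultimately have "q dvd z^2" by (simp only: dvd_add_right_iff)
  then have qz: "q dvd z" using q(1) prime_dvd_power by blast
  then have "q dvd 2 * y" using qs by (simp add: dvd_add_left_iff)
  then have qy: "q dvd y" using two q(1) by (simp add: prime_dvd_mult_iff)
  obtain y1 z1 where y1: "y = q * y1" "z = q * z1" using qy qz by (auto elim!: dvdE)
  have "N = q^2 * (x1^2 + bqf c y1 z1)" unfolding xyz(1) x1 y1 bqf_def by (simp add: power2_eq_square algebra_simps)
  moreover have "m dvd x1 - l * z1"
  proof -
    have "m dvd q * (x1 - l * z1)" using xyz(2) unfolding x1 y1 by (simp add: algebra_simps)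
    moreover have "coprime m q" using q_coprime_prod[of A] by (simp add: m_def coprime_commute)
    ultimately show ?thesis by (simp add: coprime_dvd_mult_right_iff)
  qed
  ultimately show "\<exists>N'. N = q^2 * N' \<and> N' \<in> represented" unfolding represented_def by blast
qed

lemma represented_eligible:
  assumes "N \<in> represented" "\<not> q^2 dvd N"
  shows "N \<in> eligible"
proof -
  obtain x y z where xyz: "N = x^2 + bqf c y z" "m dvd x - l * z" using assms(1) unfolding represented_def by blast
  then have "N = x^2 + bqf c y z + m^2 * 0" by simp
  then have "N \<in> no_simple_prime A" using xyz(2) by (rule represented_no_simple_prime)
  then show ?thesis using assms represented_multiple_q(2)[OF assms(1)] unfolding eligible_def by blast
qed

text \<open>
  The vectors on which the form is divisible by \<open>q\<close> form a sublattice, on which a \<open>q\<close>-th of the form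
  is again of the same shape, with the first coefficient multiplied by \<open>q\<close>.
\<close>

lemma bqf_dual: "bqf c ((2 * c - 1) * z - y) (2 * y + z) = q * bqf c y z"
  unfolding q(2) bqf_def by (simp add: algebra_simps)

text \<open>With \<open>d\<close> the product of the primes of \<open>A\<close> dividing
  \<open>N\<close>, an eligible \<open>N\<close> is \<open>d^2 * N'\<close> or
  \<open>d^2 * q * N1\<close>. The cofactor meets the hypotheses of
  \<open>almost_all_represented\<close> for the set \<open>B\<close> of the remaining primes, with
  the form itself or with its dual. There are finitely many \<open>B\<close>, so the omitted
  integers lie in finitely many dilates of null sets.\<close>

lemma eligible_null: "null_set (eligible - represented)"
proof -
  let ?E1 = "\<lambda>B. {N \<in> {N. \<not> q dvd N \<and> (\<forall>p\<in>B. \<not> p dvd N)}.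
    \<not> (\<exists>x y z. N = 1 * x^2 + bqf c y z \<and> \<Prod>B dvd 1 * x + 0 * y + (- l) * z)}"
  let ?E2 = "\<lambda>B. {N \<in> {N. \<not> q dvd N \<and> QuadRes q (4 * N) \<and> (\<forall>p\<in>B. \<not> p dvd N)}.
    \<not> (\<exists>x y z. N = q * x^2 + bqf c y z \<and> \<Prod>B dvd q * x + (- 2 * l) * y + (- l) * z)}"
  have n1: "null_set (?E1 B)" if "B \<subseteq> A" for B
  proof (rule almost_all_represented)
    show "finite B" using that A(1) finite_subset by blast
    show "prime p" if "p \<in> B" for p using that \<open>B \<subseteq> A\<close> A(2) by blast
    fix N p :: int assume "N \<in> {N. \<not> q dvd N \<and> (\<forall>p\<in>B. \<not> p dvd N)}" "prime p"
    then show "\<exists>x y z. [1 * x^2 + bqf c y z = N] (mod p) \<and> \<not> p dvd 2 * y + z \<and> (p \<in> B \<longrightarrow> p dvd 1 * x + 0 * y + (- l) * z)"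
      by (intro local_unit that) auto
  qed (use c1 in auto)
  have n2: "null_set (?E2 B)" if "B \<subseteq> A" for B
  proof (rule almost_all_represented)
    show "finite B" using that A(1) finite_subset by blast
    show "prime p" if "p \<in> B" for p using that \<open>B \<subseteq> A\<close> A(2) by blast
    fix N p :: int assume "N \<in> {N. \<not> q dvd N \<and> QuadRes q (4 * N) \<and> (\<forall>p\<in>B. \<not> p dvd N)}" "prime p"
    then show "\<exists>x y z. [q * x^2 + bqf c y z = N] (mod p) \<and> \<not> p dvd 2 * y + z \<and> (p \<in> B \<longrightarrow> p dvd q * x + (- 2 * l) * y + (- l) * z)"
      by (intro local_multiple that) auto
  qed (use c1 q_pos in auto)
  let ?d = "\<lambda>B. \<Prod>(A - B)"
  have d1: "?d B \<ge> 1" for B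
  proof -
    have "?d B > 0" using A(2) by (intro prod_pos) (auto dest: prime_gt_0_int)
    then show ?thesis by simp
  qed
  have dil: "null_set ((*) k ` E)" if "null_set E" "k \<ge> 1" for k :: int and E
  proof (rule null_set_image[OF that(1)])
    fix e :: int assume "1 \<le> k * e"
    then have "e > 0" using that(2) zero_less_mult_iff[of k e] by auto
    then show "1 \<le> e \<and> e \<le> k * e" using that(2) by (simp add: mult_le_cancel_right1)
  qed
  have "null_set (\<Union>B\<in>Pow A. (*) ((?d B)^2) ` ?E1 B \<union> (*) ((?d B)^2 * q) ` ?E2 B)"
  proof (rule null_set_UN)
    show "finite (Pow A)" using A(1) by simp
    fix B assume B: "B \<in> Pow A"
    have "(?d B)^2 \<ge> 1" using d1[of B] by (simp add: one_le_power)
    moreover from this have "(?d B)^2 * q \<ge> 1 * 1" using q_pos by (intro mult_mono) auto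
    ultimately show "null_set ((*) ((?d B)^2) ` ?E1 B \<union> (*) ((?d B)^2 * q) ` ?E2 B)"
      using B by (intro null_set_Un dil n1 n2) auto
  qed
  then show ?thesis
  proof (rule null_set_mono, intro subsetI)
    fix N assume N: "N \<in> (eligible - represented) \<inter> {1..}"
    then have U: "N \<in> no_simple_prime A" by (simp add: eligible_def)
    from prod_split_dvd[of A N, OF A(1) A(2) U] obtain d N' where d: "d = \<Prod>{p \<in> A. p dvd N}" "N = d^2 * N'" "d \<ge> 1"
      "\<Prod>A = d * \<Prod>{p \<in> A. \<not> p dvd N}" "\<forall>p\<in>A. \<not> p dvd N \<longrightarrow> \<not> p dvd N'" by blast
    let ?B = "{p \<in> A. \<not> p dvd N}"
    have BA: "?B \<in> Pow A" by auto
    have dB: "d = ?d ?B" unfolding d(1) by (rule arg_cong[where f = "\<lambda>S. \<Prod>S"]) auto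
    have qd: "coprime q d" unfolding d(1) by (rule q_coprime_prod) auto
    have lift: "N \<in> represented" if "N' = x^2 + bqf c y z" "\<Prod>?B dvd x - l * z" for x y z
    proof -
      have "N = (d * x)^2 + bqf c (d * y) (d * z)" unfolding d(2) that(1) bqf_def by (simp add: power2_eq_square algebra_simps)
      moreover have "m dvd d * (x - l * z)" unfolding m_def d(4) by (intro mult_dvd_mono that(2) dvd_refl)
      then have "m dvd d * x - l * (d * z)" by (simp add: algebra_simps)
      ultimately show ?thesis unfolding represented_def by blast
    qed
    show "N \<in> (\<Union>B\<in>Pow A. (*) ((?d B)^2) ` ?E1 B \<union> (*) ((?d B)^2 * q) ` ?E2 B)"
    proof (cases "q dvd N")
      case False
      then have "\<not> q dvd N'" using d(2) by auto
      moreover have "\<not> (\<exists>x y z. N' = 1 * x^2 + bqf c y z \<and> \<Prod>?B dvd 1 * x + 0 * y + (- l) * z)"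
      proof (rule notI, elim exE conjE)
        fix x y z assume "N' = 1 * x^2 + bqf c y z" "\<Prod>?B dvd 1 * x + 0 * y + (- l) * z"
        then have "N' = x^2 + bqf c y z" "\<Prod>?B dvd x - l * z" by simp_all
        then have "N \<in> represented" by (rule lift)
        with N show False by blast
      qed
      ultimately have "N' \<in> ?E1 ?B" using d(5) by blast
      then have "N \<in> (*) ((?d ?B)^2) ` ?E1 ?B" using d(2) unfolding dB[symmetric] by (rule image_eqI[rotated])
      then show ?thesis by (intro UN_I[OF BA] UnI1)
    next
      case True
      then have el: "\<not> q^2 dvd N" "QuadRes q (4 * (N div q))" using N unfolding eligible_def by auto
      have "coprime q (d^2)" using qd by simp
      then have "q dvd N'" using True unfolding d(2) by (simp add: coprime_dvd_mult_right_iff)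
      then obtain N1 where N1: "N' = q * N1" ..
      have NN: "N = (d^2 * q) * N1" using d(2) N1 by simp
      have q1: "\<not> q dvd N1"
      proof
        assume "q dvd N1"
        then have "q * q dvd q * N1" by simp
        then have "q^2 dvd d^2 * (q * N1)" by (simp add: power2_eq_square)
        then show False using el(1) NN by (simp add: mult.assoc)
      qed
      have Q1: "QuadRes q (4 * N1)"
      proof -
        have "N div q = d^2 * N1" using NN q_pos by simp
        then obtain y where y: "[y^2 = 4 * (d^2 * N1)] (mod q)" using el(2) unfolding QuadRes_def by auto
        obtain e where e: "[d * e = 1] (mod q)" using cong_solve_coprime_int[of d q] qd by (auto simp: coprime_commute)
        from cong_scalar_right[OF y, of "e^2"] have "[(y * e)^2 = (d * e)^2 * (4 * N1)] (mod q)"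
          by (simp add: power_mult_distrib ac_simps)
        also have "[(d * e)^2 * (4 * N1) = 1^2 * (4 * N1)] (mod q)" using e by (intro cong_mult cong_pow cong_refl)
        finally show ?thesis unfolding QuadRes_def by auto
      qed
      have "\<not> p dvd N1" if "p \<in> ?B" for p using that d(5) N1 by auto
      moreover have "\<not> (\<exists>x y z. N1 = q * x^2 + bqf c y z \<and> \<Prod>?B dvd q * x + (- 2 * l) * y + (- l) * z)"
      proof (rule notI, elim exE conjE)
        fix x y z assume xyz: "N1 = q * x^2 + bqf c y z" "\<Prod>?B dvd q * x + (- 2 * l) * y + (- l) * z"
        have "N' = (q * x)^2 + q * bqf c y z" unfolding N1 xyz(1) by (simp add: power2_eq_square algebra_simps)
        then have "N' = (q * x)^2 + bqf c ((2 * c - 1) * z - y) (2 * y + z)" unfolding bqf_dual .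
        moreover have "\<Prod>?B dvd q * x - l * (2 * y + z)" using xyz(2) by (simp add: algebra_simps)
        ultimately have "N \<in> represented" by (rule lift)
        with N show False by blast
      qed
      ultimately have "N1 \<in> ?E2 ?B" using q1 Q1 by blast
      then have "N \<in> (*) ((?d ?B)^2 * q) ` ?E2 ?B" using NN unfolding dB[symmetric] by (rule image_eqI[rotated])
      then show ?thesis by (intro UN_I[OF BA] UnI2)
    qed
  qed
qed

end

context definite_family
begin

lemma eligible_periodic: "N \<in> eligible \<longleftrightarrow> N + m^2 * q^2 \<in> eligible"
proof -
  let ?M = "m^2 * q^2"
  have u: "N \<in> no_simple_prime A \<longleftrightarrow> N + ?M \<in> no_simple_prime A"
  proof -
    have "(p dvd N \<longleftrightarrow> p dvd N + ?M) \<and> (p^2 dvd N \<longleftrightarrow> p^2 dvd N + ?M)" if "p \<in> A" for p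
    proof -
      have "p^2 dvd m^2" using prime_dvd_m[OF that] by (rule dvd_power_same)
      then have 2: "p^2 dvd ?M" by (rule dvd_mult2)
      then have "p dvd ?M" by (metis dvd_trans dvd_triv_left power2_eq_square)
      with 2 show ?thesis by (simp add: dvd_add_left_iff)
    qed
    then show ?thesis unfolding no_simple_prime_def by auto
  qed
  have q1: "q dvd N \<longleftrightarrow> q dvd N + ?M" and q2: "q^2 dvd N \<longleftrightarrow> q^2 dvd N + ?M"
    by (simp_all add: dvd_add_left_iff)
  have "QuadRes q (4 * (N div q)) \<longleftrightarrow> QuadRes q (4 * ((N + ?M) div q))" if "q dvd N"
  proof -
    have "(N + ?M) div q = N div q + m^2 * q" using that q_pos by (auto simp: power2_eq_square algebra_simps elim!: dvdE simp flip: distrib_left)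
    then have "[4 * (N div q) = 4 * ((N + ?M) div q)] (mod q)" by (simp add: cong_iff_dvd_diff)
    then show ?thesis using QuadRes_cong cong_sym by blast
  qed
  then show ?thesis unfolding eligible_def using u q1 q2 by blast
qed

text \<open>The represented integers outside the multiples of \<open>q^2\<close> have the density of
  the periodic set \<open>eligible\<close>, and by descent \<open>represented\<close> is this set
  together with its own dilate by \<open>q^2\<close>. The estimate follows because, up to a null
  set, only multiples of \<open>q\<close> are missing from \<open>no_simple_prime A\<close>.\<close>

lemma dens_represented:
  "\<exists>d. dens represented d \<and> \<bar>d - (\<Prod>p\<in>A. local_density p)\<bar> \<le> 1 / real_of_int q"
proof -
  let ?U = "no_simple_prime A" and ?\<delta> = "\<Prod>p\<in>A. local_density p"
  have M: "nat (m^2 * q^2) > 0" "int (nat (m^2 * q^2)) = m^2 * q^2" using m_pos q_pos by simp_all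
  have "\<exists>t. dens eligible t"
    by (rule dens_periodic_exists[OF M(1)]) (unfold M(2), rule eligible_periodic)
  then obtain t where t: "dens eligible t" by blast
  define T where "T = {N \<in> represented. \<not> q^2 dvd N}"
  have qq: "q dvd N" if "q^2 dvd N" for N using that by (metis dvd_trans dvd_triv_left power2_eq_square)
  have "null_set (eligible - T)"
    by (rule null_set_mono[OF eligible_null]) (auto simp: T_def eligible_def dest: qq)
  moreover have "T \<inter> {1..} \<subseteq> eligible" using represented_eligible by (auto simp: T_def)
  ultimately have T: "dens T t" by (rule dens_null_Diff[OF t])
  have q2: "q^2 \<ge> 2"
  proof -
    have "2 * 1 \<le> q * q" using prime_ge_2_int[OF q(1)] by (intro mult_mono) auto
    then show ?thesis by (simp add: power2_eq_square)
  qed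
  have eq: "represented = T \<union> (*) (q^2) ` represented"
  proof
    show "T \<union> (*) (q^2) ` represented \<subseteq> represented" using represented_scale by (auto simp: T_def)
    show "represented \<subseteq> T \<union> (*) (q^2) ` represented"
    proof
      fix N assume N: "N \<in> represented"
      show "N \<in> T \<union> (*) (q^2) ` represented"
        using represented_multiple_q(1)[OF N] qq N by (cases "q^2 dvd N") (auto simp: T_def)
    qed
  qed
  have "\<exists>d. dens represented d"
    by (rule dens_self_similar_exists[OF T q2]) (use eq in \<open>auto simp: T_def\<close>)
  then obtain d where d: "dens represented d" by blast
  have U: "dens ?U ?\<delta>" by (rule dens_no_simple_prime[OF A(1,2)])
  have sub: "represented \<subseteq> ?U"
  proof
    fix N assume "N \<in> represented"
    then obtain x y z where xyz: "N = x^2 + bqf c y z" "m dvd x - l * z" unfolding represented_def by blast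
    then have "N = x^2 + bqf c y z + m^2 * 0" by simp
    then show "N \<in> ?U" using xyz(2) by (rule represented_no_simple_prime)
  qed
  have "d \<le> ?\<delta>" by (rule dens_mono[OF d U]) (use sub in auto)
  moreover have "?\<delta> - ?\<delta> / q \<le> d"
  proof -
    have mq: "q * N \<in> ?U \<longleftrightarrow> N \<in> ?U" for N using A q(1) q_notin_A by (intro no_simple_prime_mult_prime) auto
    have qU: "(*) q ` ?U = {N \<in> ?U. q dvd N}" using mq by (auto simp: image_iff elim!: dvdE)
    have "dens (?U - (*) q ` ?U) (?\<delta> - ?\<delta> / q)"
      using q_pos by (intro dens_Diff dens_dilation U) (auto simp: qU)
    moreover have "null_set ((?U - (*) q ` ?U) - represented \<inter> (?U - (*) q ` ?U))"
      by (rule null_set_mono[OF eligible_null]) (auto simp: qU eligible_def)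
    ultimately have "dens (represented \<inter> (?U - (*) q ` ?U)) (?\<delta> - ?\<delta> / q)"
      by (rule dens_null_Diff) auto
    from dens_mono[OF this d] show ?thesis by auto
  qed
  moreover have "?\<delta> / q \<le> 1 / q"
  proof -
    have "?\<delta> \<le> 1" using dens_mono[OF U dens_UNIV] by auto
    then show ?thesis using q_pos by (simp add: divide_right_mono)
  qed
  ultimately have "\<bar>d - ?\<delta>\<bar> \<le> 1 / real_of_int q" by linarith
  with d show ?thesis by blast
qed

text \<open>A multiple of \<open>m^2\<close>, so that further variables respect the conditions at
  \<open>A\<close>, and of \<open>q\<close>, with quotient congruent to \<open>- (m^2)\<close>
  modulo \<open>q\<close>. Subtracting \<open>M * w^2\<close> from \<open>q * N1\<close> thus
  changes \<open>N1\<close> to \<open>N1 + m^2 * w^2\<close> modulo \<open>q\<close>, and making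
  this a square \<open>t^2\<close> means representing \<open>N1\<close> by the hyperbolic plane
  \<open>t^2 - m^2 * w^2\<close>.\<close>

definition M :: int where "M = m^2 * (q * (q - 1))"

text \<open>The substitution \<open>x = m * t + l * z\<close> parametrizes the sublattice; with the
  variables in the order \<open>t\<close>, \<open>y\<close>, \<open>z\<close> the form is
  arrow-shaped, and \<open>z\<close> is the coupled variable.\<close>

definition diag :: "nat \<Rightarrow> int" where
  "diag i = (if i = 0 then m^2 else if i = 1 then 1 else if i = 2 then c + l^2 else M)"

definition cross :: "nat \<Rightarrow> int" where
  "cross i = (if i = 0 then 2 * m * l else if i = 1 then 1 else 0)"

lemma M_pos: "M > 0"
  using m_pos prime_ge_2_int[OF q(1)] by (simp add: M_def)

lemma definite_form:
  assumes "n \<ge> 3"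
  shows "arrow_mat n 2 diag cross \<in> forms_of_signature n 0"
proof -
  have "arrow_mat (n + 0) 2 diag cross \<in> forms_of_signature n 0"
  proof (rule arrow_mat_in_forms_of_signature)
    fix i assume "i < n"
    show "arrow_pivot 2 diag cross i > 0"
    proof (cases "i = 2")
      case True
      have "(\<Sum>i\<in>{0..<2}. (real_of_int (cross i))^2 / (4 * diag i)) = (real_of_int (cross 0))^2 / (4 * diag 0) + (real_of_int (cross 1))^2 / (4 * diag 1)"
        by (simp add: numeral_2_eq_2)
      also have "\<dots> = (real_of_int l)^2 + 1 / 4"
        using m_pos by (simp add: cross_def diag_def power_mult_distrib)
      finally show ?thesis using True c1 by (simp add: arrow_pivot_def diag_def)
    next
      case False
      then show ?thesis using m_pos M_pos by (simp add: arrow_pivot_def diag_def)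
    qed
  qed (use assms in auto)
  then show ?thesis by simp
qed

lemma definite_values:
  assumes n: "n \<ge> 3"
  shows "qf_values (arrow_mat n 2 diag cross) =
    {N. N \<noteq> 0 \<and> (\<exists>x y z w. m dvd x - l * z \<and> N = x^2 + bqf c y z + M * (\<Sum>i\<in>{3..<n}. (w i)^2))}"
proof -
  have ev: "(\<Sum>i\<in>{0..<n}. diag i * (x i)^2) + (\<Sum>i\<in>{0..<2}. cross i * x i) * x 2 =
     (m * x 0 + l * x 2)^2 + bqf c (x 1) (x 2) + M * (\<Sum>i\<in>{3..<n}. (x i)^2)" for x :: "nat \<Rightarrow> int"
  proof -
    have "{0..<n} = insert 0 (insert 1 (insert 2 {3..<n}))" using n by auto
    then have "(\<Sum>i\<in>{0..<n}. diag i * (x i)^2) = m^2 * (x 0)^2 + ((x 1)^2 + ((c + l^2) * (x 2)^2 + (\<Sum>i\<in>{3..<n}. diag i * (x i)^2)))"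
      by (simp add: diag_def)
    also have "(\<Sum>i\<in>{3..<n}. diag i * (x i)^2) = M * (\<Sum>i\<in>{3..<n}. (x i)^2)"
      unfolding sum_distrib_left by (rule sum.cong) (auto simp: diag_def)
    finally have 1: "(\<Sum>i\<in>{0..<n}. diag i * (x i)^2) = m^2 * (x 0)^2 + ((x 1)^2 + ((c + l^2) * (x 2)^2 + M * (\<Sum>i\<in>{3..<n}. (x i)^2)))" .
    have 2: "(\<Sum>i\<in>{0..<2}. cross i * x i) = 2 * m * l * x 0 + x 1" by (simp add: numeral_2_eq_2 cross_def)
    show ?thesis unfolding 1 2 bqf_def by (simp add: power2_eq_square algebra_simps)
  qed
  have "(\<exists>x. N = (\<Sum>i\<in>{0..<n}. diag i * (x i)^2) + (\<Sum>i\<in>{0..<2}. cross i * x i) * x 2) \<longleftrightarrow>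
    (\<exists>x y z w. m dvd x - l * z \<and> N = x^2 + bqf c y z + M * (\<Sum>i\<in>{3..<n}. (w i)^2))" for N
  proof
    assume "\<exists>x. N = (\<Sum>i\<in>{0..<n}. diag i * (x i)^2) + (\<Sum>i\<in>{0..<2}. cross i * x i) * x 2"
    then obtain x where "N = (m * x 0 + l * x 2)^2 + bqf c (x 1) (x 2) + M * (\<Sum>i\<in>{3..<n}. (x i)^2)" unfolding ev by blast
    moreover have "m dvd (m * x 0 + l * x 2) - l * x 2" by simp
    ultimately show "\<exists>x y z w. m dvd x - l * z \<and> N = x^2 + bqf c y z + M * (\<Sum>i\<in>{3..<n}. (w i)^2)" by blast
  next
    assume "\<exists>x y z w. m dvd x - l * z \<and> N = x^2 + bqf c y z + M * (\<Sum>i\<in>{3..<n}. (w i)^2)"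
    then obtain x y z w where a: "m dvd x - l * z" and N: "N = x^2 + bqf c y z + M * (\<Sum>i\<in>{3..<n}. (w i)^2)" by blast
    obtain t where t: "x - l * z = m * t" using a ..
    define v where "v = (\<lambda>i::nat. if i = 0 then t else if i = 1 then y else if i = 2 then z else w i)"
    have "(\<Sum>i\<in>{3..<n}. (v i)^2) = (\<Sum>i\<in>{3..<n}. (w i)^2)" by (rule sum.cong) (auto simp: v_def)
    moreover have "x = m * t + l * z" using t by simp
    ultimately have "N = (m * v 0 + l * v 2)^2 + bqf c (v 1) (v 2) + M * (\<Sum>i\<in>{3..<n}. (v i)^2)"
      unfolding N by (simp add: v_def)
    then show "\<exists>x. N = (\<Sum>i\<in>{0..<n}. diag i * (x i)^2) + (\<Sum>i\<in>{0..<2}. cross i * x i) * x 2" unfolding ev by blast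
  qed
  then show ?thesis using n by (simp add: qf_values_arrow)
qed

lemma bqf_nonneg: "bqf c y z \<ge> 0"
proof -
  have "4 * bqf c y z \<ge> 0" unfolding four_bqf using c1 by simp
  then show ?thesis by simp
qed

lemma definite_values_pos:
  assumes "n \<ge> 3" "N \<in> qf_values (arrow_mat n 2 diag cross)"
  shows "N > 0"
proof -
  obtain x y z w where N: "N \<noteq> 0" "N = x^2 + bqf c y z + M * (\<Sum>i\<in>{3..<n}. (w i)^2)"
    using assms unfolding definite_values[OF assms(1)] by blast
  have "0 \<le> M * (\<Sum>i\<in>{3..<n}. (w i)^2)" using M_pos by (intro mult_nonneg_nonneg sum_nonneg) auto
  then have "N \<ge> 0" unfolding N(2) using bqf_nonneg[of y z] by simp
  with N(1) show ?thesis by simp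
qed

lemma ternary_density:
  "\<exists>d\<in>form_densities 3 0. \<bar>d - (\<Prod>p\<in>A. local_density p)\<bar> \<le> 1 / real_of_int q"
proof -
  obtain d where d: "dens represented d" "\<bar>d - (\<Prod>p\<in>A. local_density p)\<bar> \<le> 1 / real_of_int q" using dens_represented by blast
  have vals: "qf_values (arrow_mat 3 2 diag cross) = represented - {0}"
    unfolding definite_values[OF order_refl] represented_def by auto
  have "represented \<inter> {1..} = (represented - {0}) \<inter> {1..}" by auto
  from dens_cong[OF this d(1)] have "dens (qf_values (arrow_mat 3 2 diag cross)) d" by (simp only: vals)
  then have "has_density (qf_values (arrow_mat 3 2 diag cross)) d"
    by (rule has_density_of_dens) (rule definite_values_pos[OF order_refl])
  then have "d \<in> form_densities 3 0" unfolding form_densities_def using definite_form[OF order_refl] by blast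
  with d(2) show ?thesis by blast
qed

text \<open>This is how a fourth variable removes the obstruction at \<open>q\<close>. In a
  factorization \<open>N1 = u * v\<close> modulo \<open>q\<close> the sum \<open>u + v\<close>
  becomes \<open>2 * t\<close> and must not vanish; the pairs (1, N1) and (2, N1 / 2) cannot both
  fail unless \<open>q\<close> divides 3, whence \<open>q > 3\<close>.\<close>

lemma shift_to_eligible:
  assumes N: "N \<in> no_simple_prime A" and q3: "q > 3"
  shows "\<exists>w\<in>{0..<q}. N - M * w^2 \<in> eligible"
proof (cases "q dvd N")
  case False
  then have "N - M * 0^2 \<in> eligible" using N by (simp add: eligible_def)
  then show ?thesis using q_pos by (intro bexI[of _ 0]) auto
next
  case True
  then obtain N1 where N1: "N = q * N1" ..
  have two: "\<not> q dvd 2" by (rule odd_prime_not_dvd_two[OF q(1) odd_q])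
  have qm: "\<not> q dvd m" using q_coprime_prod[of A] q(1) unfolding m_def by (metis coprime_absorb_left dvd_refl not_prime_unit subset_refl)
  \<comment> \<open>Write \<open>N1 = (t - m w) (t + m w)\<close> modulo \<open>q\<close> with \<open>t \<noteq> 0\<close>.\<close>
  have "\<exists>t w. [t^2 = N1 + m^2 * w^2] (mod q) \<and> \<not> q dvd t"
  proof -
    have fac: "\<exists>t w. [t^2 = N1 + m^2 * w^2] (mod q) \<and> \<not> q dvd t" if uv: "[u * v = N1] (mod q)" "\<not> q dvd u + v" for u v
    proof -
      obtain t where t: "[2 * t = u + v] (mod q)" using solve_linear_mod_prime[OF q(1) two] by blast
      have "\<not> q dvd 2 * m" using two qm q(1) by (simp add: prime_dvd_mult_iff)
      then obtain w where w: "[2 * m * w = v - u] (mod q)" using solve_linear_mod_prime[OF q(1)] by blast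
      have "[(2 * t)^2 - (2 * m * w)^2 = (u + v)^2 - (v - u)^2] (mod q)" by (rule cong_diff[OF cong_pow[OF t] cong_pow[OF w]])
      moreover have "(u + v)^2 - (v - u)^2 = 4 * (u * v)" by (simp add: power2_eq_square algebra_simps)
      ultimately have "[(2 * t)^2 - (2 * m * w)^2 = 4 * N1] (mod q)" using cong_scalar_left[OF uv(1), of 4] by (simp only: cong_trans)
      then have "q dvd 2 * (2 * (t^2 - (N1 + m^2 * w^2)))" by (simp add: cong_iff_dvd_diff power2_eq_square algebra_simps)
      then have "q dvd t^2 - (N1 + m^2 * w^2)" using two q(1) by (simp only: prime_dvd_mult_iff) simp
      then have "[t^2 = N1 + m^2 * w^2] (mod q)" by (simp add: cong_iff_dvd_diff)
      moreover have "\<not> q dvd t"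
      proof
        assume "q dvd t"
        then have "q dvd 2 * t" by simp
        then show False using uv(2) cong_dvd_iff[OF t] by blast
      qed
      ultimately show ?thesis by blast
    qed
    show ?thesis
    proof (cases "q dvd 1 + N1")
      case False
      then show ?thesis by (intro fac[of 1 N1]) auto
    next
      case True
      obtain h where h: "[2 * h = N1] (mod q)" using solve_linear_mod_prime[OF q(1) two] by blast
      have "\<not> q dvd 2 + h"
      proof
        assume "q dvd 2 + h"
        then have "q dvd 2 * (2 + h)" by (rule dvd_mult)
        moreover have "[2 * (2 + h) = 4 + N1] (mod q)" using cong_add[OF cong_refl[of 4] h] by simp
        ultimately have "q dvd 4 + N1" using cong_dvd_iff by blast
        then have "q dvd (4 + N1) - (1 + N1)" using True by (rule dvd_diff)
        then have "q dvd 3" by simp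
        then show False using q3 zdvd_imp_le[of q 3] by simp
      qed
      then show ?thesis using h by (intro fac[of 2 h]) auto
    qed
  qed
  then obtain t w0 where tw: "[t^2 = N1 + m^2 * w0^2] (mod q)" "\<not> q dvd t" by blast
  \<comment> \<open>Reduced modulo \<open>q\<close>, so that finitely many translates suffice and
    \<open>M * w^2\<close> stays below the fixed bound \<open>M * q^2\<close>.\<close>
  define w where "w = w0 mod q"
  have w: "w \<in> {0..<q}" using q_pos by (simp add: w_def)
  have "[w = w0] (mod q)" by (simp add: w_def)
  then have "[N1 + m^2 * w^2 = N1 + m^2 * w0^2] (mod q)" by (intro cong_add cong_mult cong_pow cong_refl)
  then have tw': "[t^2 = N1 + m^2 * w^2] (mod q)" using tw(1) cong_trans cong_sym by blast
  define K where "K = N1 - m^2 * ((q - 1) * w^2)"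
  have NK: "N - M * w^2 = q * K" unfolding N1 M_def K_def by (simp add: algebra_simps)
  have "N1 + m^2 * w^2 - K = q * (m^2 * w^2)" unfolding K_def by (simp add: algebra_simps)
  then have "[N1 + m^2 * w^2 = K] (mod q)" by (simp add: cong_iff_dvd_diff)
  with tw' have tK: "[t^2 = K] (mod q)" by (rule cong_trans)
  have "\<not> q dvd t^2" using tw(2) q(1) prime_dvd_power by blast
  then have qK: "\<not> q dvd K" using cong_dvd_iff[OF tK] by blast
  have "[(2 * t)^2 = 4 * K] (mod q)" using cong_scalar_left[OF tK, of 4] by (simp add: power_mult_distrib)
  then have QK: "QuadRes q (4 * K)" unfolding QuadRes_def by blast
  have "N - M * w^2 \<in> no_simple_prime A"
  proof -
    have "(p dvd N \<longleftrightarrow> p dvd N - M * w^2) \<and> (p^2 dvd N \<longleftrightarrow> p^2 dvd N - M * w^2)" if "p \<in> A" for p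
    proof -
      have "p^2 dvd m^2" using prime_dvd_m[OF that] by (rule dvd_power_same)
      then have 2: "p^2 dvd M * w^2" unfolding M_def by (simp add: mult.assoc)
      then have "p dvd M * w^2" by (metis dvd_trans dvd_triv_left power2_eq_square)
      with 2 show ?thesis by (simp add: dvd_diff_left_iff)
    qed
    then show ?thesis using N unfolding no_simple_prime_def by auto
  qed
  moreover have "\<not> q^2 dvd N - M * w^2" unfolding NK using qK q_pos by (simp add: power2_eq_square)
  moreover have "(N - M * w^2) div q = K" unfolding NK using q_pos by simp
  ultimately have "N - M * w^2 \<in> eligible" using QK by (simp add: eligible_def)
  with w show ?thesis by blast
qed

text \<open>Every \<open>N\<close> in \<open>no_simple_prime A\<close> beyond \<open>M * q^2\<close>
  is a positive eligible integer plus \<open>M * w^2\<close> with \<open>0 \<le> w < q\<close>. The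
  omitted integers therefore lie in \<open>q\<close> translates of a null set and a finite set, and
  no error from \<open>q\<close> remains in the density.\<close>

lemma higher_density:
  assumes n: "n \<ge> 4" and q3: "q > 3"
  shows "(\<Prod>p\<in>A. local_density p) \<in> form_densities n 0"
proof -
  have n3: "n \<ge> 3" using n by simp
  let ?S = "qf_values (arrow_mat n 2 diag cross)" and ?U = "no_simple_prime A"
  have "?S \<subseteq> ?U"
  proof
    fix N assume "N \<in> ?S"
    then obtain x y z w where N: "m dvd x - l * z" "N = x^2 + bqf c y z + M * (\<Sum>i\<in>{3..<n}. (w i)^2)"
      unfolding definite_values[OF n3] by blast
    then have "N = x^2 + bqf c y z + m^2 * ((q * (q - 1)) * (\<Sum>i\<in>{3..<n}. (w i)^2))" by (simp add: M_def mult.assoc)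
    then show "N \<in> ?U" using N(1) by (rule represented_no_simple_prime)
  qed
  moreover have "null_set (?U - ?S)"
  proof -
    let ?E = "(eligible - represented) \<inter> {1..}"
    have "null_set (\<Union>w\<in>{0..<q}. (\<lambda>e. e + M * w^2) ` ?E)"
    proof (rule null_set_UN)
      fix w
      show "null_set ((\<lambda>e. e + M * w^2) ` ?E)"
        by (rule null_set_image[OF null_set_mono[OF eligible_null]]) (use M_pos in auto)
    qed simp
    moreover have "null_set {1..M * q^2}" by (rule null_set_finite) simp
    ultimately have "null_set ((\<Union>w\<in>{0..<q}. (\<lambda>e. e + M * w^2) ` ?E) \<union> {1..M * q^2})" by (rule null_set_Un)
    then show ?thesis
    proof (rule null_set_mono, intro subsetI)
      fix N assume N: "N \<in> (?U - ?S) \<inter> {1..}"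
      show "N \<in> (\<Union>w\<in>{0..<q}. (\<lambda>e. e + M * w^2) ` ?E) \<union> {1..M * q^2}"
      proof (cases "N \<le> M * q^2")
        case True
        then show ?thesis using N by auto
      next
        case False
        obtain w where w: "w \<in> {0..<q}" "N - M * w^2 \<in> eligible" using shift_to_eligible[OF _ q3, of N] N by blast
        have "w^2 \<le> q^2" using w(1) by (intro power_mono) auto
        then have "M * w^2 \<le> M * q^2" using M_pos by (intro mult_left_mono) auto
        then have "N - M * w^2 \<ge> 1" using False by simp
        moreover have "N - M * w^2 \<notin> represented"
        proof
          assume "N - M * w^2 \<in> represented"
          then obtain x y z where xyz: "N - M * w^2 = x^2 + bqf c y z" "m dvd x - l * z" unfolding represented_def by blast
          have "(\<Sum>i\<in>{3..<n}. (if i = 3 then w else 0)^2) = (\<Sum>i\<in>{3..<n}. if i = 3 then w^2 else 0)" by (rule sum.cong) auto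
          also have "\<dots> = w^2" using n by simp
          finally have "N = x^2 + bqf c y z + M * (\<Sum>i\<in>{3..<n}. (if i = 3 then w else 0)^2)" using xyz(1) by simp
          then have "\<exists>x y z w. m dvd x - l * z \<and> N = x^2 + bqf c y z + M * (\<Sum>i\<in>{3..<n}. (w i)^2)"
            using xyz(2) by (intro exI[of _ x] exI[of _ y] exI[of _ z] exI[of _ "\<lambda>i. if i = 3 then w else 0"]) simp
          then have "N \<in> ?S" unfolding definite_values[OF n3] using N by auto
          then show False using N by blast
        qed
        ultimately have "N - M * w^2 \<in> ?E" using w(2) by blast
        then have "N \<in> (\<lambda>e. e + M * w^2) ` ?E" by (rule image_eqI[rotated]) simp
        then show ?thesis using w(1) by blast
      qed
    qed
  qed
  ultimately have "dens ?S (\<Prod>p\<in>A. local_density p)"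
    using dens_null_Diff[OF dens_no_simple_prime[OF A(1,2)]] by blast
  then have "has_density ?S (\<Prod>p\<in>A. local_density p)" by (rule has_density_of_dens) (rule definite_values_pos[OF n3])
  then show ?thesis unfolding form_densities_def using definite_form[OF n3] by blast
qed

end

section \<open>Choice of the primes and conclusion\<close>

lemma prime_factor_3_mod_4:
  fixes n :: nat
  assumes "n mod 4 = 3"
  shows "\<exists>p. prime p \<and> p dvd n \<and> p mod 4 = 3"
  using assms
proof (induction n rule: less_induct)
  case (less n)
  have "n \<noteq> 1" using less.prems by auto
  then obtain p where p: "prime p" "p dvd n" using prime_factor_nat by blast
  then obtain k where k: "n = p * k" by auto
  show ?case
  proof (cases "p mod 4 = 3")
    case True
    then show ?thesis using p by blast
  next
    case False
    have n4: "(p mod 4) * (k mod 4) mod 4 = 3" using less.prems by (simp add: k mod_mult_eq)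
    have "k mod 4 = 3"
    proof -
      have "p mod 4 = 0 \<or> p mod 4 = 1 \<or> p mod 4 = 2" using False by presburger
      moreover have "k mod 4 = 0 \<or> k mod 4 = 1 \<or> k mod 4 = 2 \<or> k mod 4 = 3" by presburger
      ultimately show ?thesis using n4 by (elim disjE) simp_all
    qed
    moreover have "k < n" using k p prime_gt_1_nat[OF p(1)] less.prems by (cases "k = 0") auto
    ultimately obtain r where "prime r" "r dvd k" "r mod 4 = 3" using less.IH by blast
    then show ?thesis using k by auto
  qed
qed

text \<open>Euclid's argument with \<open>4 * fact B - 1\<close>, which is 3 modulo 4 and has no
  prime factor up to \<open>B\<close>.\<close>

lemma large_prime_3_mod_4: "\<exists>q c :: int. prime q \<and> q = 4 * c - 1 \<and> q > int B"
proof -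
  have f: "fact B \<ge> (1::nat)" by (rule fact_ge_1)
  define n :: nat where "n = 4 * fact B - 1"
  obtain k where "fact B = Suc k" using f by (cases "fact B :: nat") auto
  then have "n = 4 * k + 3" by (simp add: n_def)
  then have "n mod 4 = 3" by presburger
  then obtain p where p: "prime p" "p dvd n" "p mod 4 = 3" using prime_factor_3_mod_4 by blast
  have pB: "p > B"
  proof (rule ccontr)
    assume "\<not> p > B"
    then have "p dvd fact B" using p(1) by (simp add: prime_dvd_fact_iff)
    then have "p dvd 4 * fact B" by simp
    moreover have "4 * fact B = n + 1" using f by (simp add: n_def)
    ultimately have "p dvd n + 1" by (simp only:)
    then have "p dvd 1" using p(2) dvd_add_right_iff by blast
    then show False using p(1) not_prime_unit by blast
  qed
  have p4: "int p = 4 * (int (p div 4) + 1) - 1" using p(3) by presburger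
  show ?thesis
  proof (intro exI conjI)
    show "prime (int p)" using p(1) by simp
    show "int p = 4 * (int (p div 4) + 1) - 1" by (rule p4)
    show "int p > int B" using pB by simp
  qed
qed

text \<open>The choice \<open>q > 2 / \<epsilon>\<close> keeps the defect of the ternary density
  below \<open>\<epsilon> / 2\<close>, and the Euler product is within \<open>\<epsilon> / 2\<close>
  of \<open>\<theta>\<close>. The set \<open>A\<close> has to be chosen after \<open>q\<close>, and
  \<open>l\<close> is glued from its residues modulo the primes of \<open>A\<close>.\<close>

lemma definite_densities_dense:
  fixes \<theta> \<epsilon> :: real
  assumes n: "n \<ge> 3" and \<theta>: "0 \<le> \<theta>" "\<theta> \<le> 1" and \<epsilon>: "\<epsilon> > 0"
  shows "\<exists>d\<in>form_densities n 0. \<bar>d - \<theta>\<bar> < \<epsilon>"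
proof -
  obtain B :: nat where B: "real B > max (2 / \<epsilon>) 3" using reals_Archimedean2 by blast
  obtain q c :: int where q: "prime q" "q = 4 * c - 1" "q > int B" using large_prime_3_mod_4 by blast
  have q3: "q > 3" using B q(3) by simp
  have "2 / \<epsilon> < real_of_int q" using B q(3) by simp
  then have q\<epsilon>: "1 / real_of_int q < \<epsilon> / 2" using q3 \<epsilon> by (simp add: field_simps)
  have "\<epsilon> / 2 > 0" using \<epsilon> by simp
  from local_density_products_dense[OF \<theta> this, of "nat (q + 1)"]
  obtain A where A: "finite A" "\<And>p. p \<in> A \<Longrightarrow> prime p" "\<And>p. p \<in> A \<Longrightarrow> p > q + 1" and close: "\<bar>(\<Prod>p\<in>A. local_density p) - \<theta>\<bar> < \<epsilon> / 2"
    using q3 by auto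
  have "\<forall>p. \<exists>l. p \<in> A \<longrightarrow> \<not> QuadRes p (- (4 * l^2 + q))"
  proof
    fix p
    show "\<exists>l. p \<in> A \<longrightarrow> \<not> QuadRes p (- (4 * l^2 + q))"
    proof (cases "p \<in> A")
      case True
      have "odd p" using prime_eq_two_or_odd[OF A(2)[OF True]] A(3)[OF True] q3 by auto
      moreover have "\<not> p dvd q" "\<not> p dvd q + 1" using A(3)[OF True] q3 zdvd_imp_le[of p q] zdvd_imp_le[of p "q + 1"] by auto
      ultimately show ?thesis using anisotropic_plane_exists[OF A(2)[OF True]] by blast
    qed blast
  qed
  then obtain f where f: "\<And>p. p \<in> A \<Longrightarrow> \<not> QuadRes p (- (4 * (f p)^2 + q))" by metis
  obtain l where l: "\<And>p. p \<in> A \<Longrightarrow> [l = f p] (mod p)" using chinese_remainder_primes_int[OF A(1,2), of f] by blast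
  have "\<not> QuadRes p (- (4 * l^2 + q))" if "p \<in> A" for p
  proof
    assume Q: "QuadRes p (- (4 * l^2 + q))"
    have "[4 * l^2 + q = 4 * (f p)^2 + q] (mod p)" using l[OF that] by (intro cong_add cong_mult cong_pow cong_refl)
    then have "[- (4 * l^2 + q) = - (4 * (f p)^2 + q)] (mod p)" by (simp only: cong_minus_minus_iff)
    then show False using QuadRes_cong[OF _ Q] f[OF that] by blast
  qed
  then interpret definite_family c q l A using q A by unfold_locales auto
  show ?thesis
  proof (cases "n = 3")
    case True
    obtain d where d: "d \<in> form_densities 3 0" "\<bar>d - (\<Prod>p\<in>A. local_density p)\<bar> \<le> 1 / real_of_int q" using ternary_density by blast
    have "\<bar>d - \<theta>\<bar> < \<epsilon>" using d(2) close q\<epsilon> by linarith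
    with d(1) True show ?thesis by blast
  next
    case False
    then have "(\<Prod>p\<in>A. local_density p) \<in> form_densities n 0" using n q3 by (intro higher_density) auto
    moreover have "\<bar>(\<Prod>p\<in>A. local_density p) - \<theta>\<bar> < \<epsilon>" using close \<epsilon> by linarith
    ultimately show ?thesis by blast
  qed
qed

lemma indefinite_densities_dense:
  fixes \<theta> \<epsilon> :: real
  assumes rs: "r \<ge> 2" "s \<ge> 1" and \<theta>: "0 \<le> \<theta>" "\<theta> \<le> 1" and \<epsilon>: "\<epsilon> > 0"
  shows "\<exists>d\<in>form_densities r s. \<bar>d - \<theta>\<bar> < \<epsilon>"
proof -
  obtain A where A: "finite A" "\<And>p. p \<in> A \<Longrightarrow> prime p" "\<And>p. p \<in> A \<Longrightarrow> p > 2" "\<bar>(\<Prod>p\<in>A. local_density p) - \<theta>\<bar> < \<epsilon>"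
    using local_density_products_dense[OF \<theta> \<epsilon>, of 2] by auto
  have "odd p" if "p \<in> A" for p using prime_eq_two_or_odd[OF A(2)[OF that]] A(3)[OF that] by auto
  then have "(\<Prod>p\<in>A. local_density p) \<in> form_densities r s" using A by (intro indefinite_densities rs) auto
  with A(4) show ?thesis by blast
qed

theorem theorem1p13:
  fixes n r s :: nat
  assumes "n \<ge> 3" and "r + s = n"
  shows "dense_in (form_densities r s) {0..1}"
  unfolding dense_in_def
proof
  show "form_densities r s \<subseteq> {0..1}" by (rule form_densities_subset)
  have swap: "form_densities r s = form_densities s r" using form_densities_swap by blast
  have dense: "\<exists>d\<in>form_densities r s. \<bar>d - \<theta>\<bar> < \<epsilon>" if \<theta>: "0 \<le> \<theta>" "\<theta> \<le> 1" and \<epsilon>: "\<epsilon> > 0" for \<theta> \<epsilon> :: real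
  proof -
    \<comment> \<open>As \<open>r + s \<ge> 3\<close>, a mixed signature has an entry of at least 2;
      a change of sign brings it to the first place.\<close>
    consider "s = 0" | "r = 0" | "r \<ge> 2" "s \<ge> 1" | "s \<ge> 2" "r \<ge> 1" using assms by linarith
    then show ?thesis
    proof cases
      case 1
      then show ?thesis using definite_densities_dense[OF assms(1) \<theta> \<epsilon>] assms(2) by simp
    next
      case 2
      then show ?thesis using definite_densities_dense[OF assms(1) \<theta> \<epsilon>] assms(2) unfolding swap by simp
    next
      case 3
      then show ?thesis using \<theta> \<epsilon> by (rule indefinite_densities_dense)
    next
      case 4
      then show ?thesis using \<theta> \<epsilon> unfolding swap by (rule indefinite_densities_dense)
    qed
  qed
  show "{0..1} \<subseteq> closure (form_densities r s)"
  proof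
    fix \<theta> :: real assume "\<theta> \<in> {0..1}"
    then show "\<theta> \<in> closure (form_densities r s)"
      unfolding closure_approachable dist_real_def using dense by auto
  qed
qed

end
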